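(* Let $u_0\in H^3(\mathbb{S}^1)$ with $u_0>0$ on $\mathbb{S}^1$. Then there exist a time $0<T\leq\infty$, $T=T(\|u_0\|_{H^3(\mathbb{S}^1)},\min_x u_0(x))$, and a unique positive solution $$0<u\in C([0,T],H^3(\mathbb{S}^1))$$ of the problem $$\partial_t u-\partial_x\arctan\left(\frac{\partial_x u}{u}\right)=0\ \text{ on }\mathbb{S}^1\times[0,T],\qquad u(x,0)=u_0(x)\ \text{ on }\mathbb{S}^1.$$
   Context: $\mathbb{S}^1$ is the one-dimensional torus of length $2\pi$, identified with $[-\pi,\pi]$ with periodic boundary conditions. The notation $T=T(\|u_0\|_{H^3},\min_x u_0)$ means that $T$ depends on $u_0$ only through these two quantities. A positive solution is a function $u>0$ in $C([0,T],H^3(\mathbb{S}^1))$ (with $[0,T]$ read as $[0,\infty)$ if $T=\infty$) satisfying the equation and the initial condition in the classical sense. *)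

theory Defs
  imports "HOL-Analysis.Analysis"
begin

text \<open>Functions on the torus of length \<open>2 * pi\<close> are represented by \<open>2 * pi\<close>-periodic
  functions on the real line; integrals over the torus are integrals over one period.\<close>

definition torus_test_function :: "(real \<Rightarrow> real) \<Rightarrow> bool" where
  "torus_test_function \<phi> \<longleftrightarrow> periodic_fun_simple \<phi> (2 * pi) \<and>
     (\<forall>n x. ((deriv ^^ n) \<phi>) differentiable (at x))"

definition L2_torus :: "(real \<Rightarrow> real) set" where
  "L2_torus = {f. periodic_fun_simple f (2 * pi) \<and> f \<in> borel_measurable borel \<and>
     set_integrable lborel {-pi..pi} (\<lambda>x. (f x)\<^sup>2)}"

definition L2_torus_norm :: "(real \<Rightarrow> real) \<Rightarrow> real" where
  "L2_torus_norm f = sqrt (LBINT x:{-pi..pi}. (f x)\<^sup>2)"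

definition is_weak_deriv :: "nat \<Rightarrow> (real \<Rightarrow> real) \<Rightarrow> (real \<Rightarrow> real) \<Rightarrow> bool" where
  "is_weak_deriv k f g \<longleftrightarrow> (\<forall>\<phi>. torus_test_function \<phi> \<longrightarrow>
     (LBINT x:{-pi..pi}. f x * (deriv ^^ k) \<phi> x) =
     (-1) ^ k * (LBINT x:{-pi..pi}. g x * \<phi> x))"

definition sobolev_torus :: "nat \<Rightarrow> (real \<Rightarrow> real) set" where
  "sobolev_torus k = {f \<in> L2_torus. \<forall>j\<le>k. \<exists>g\<in>L2_torus. is_weak_deriv j f g}"

text \<open>Weak derivatives in \<open>L2\<close> are unique only up to null sets, so a representative is chosen;
  the Sobolev norm does not depend on the choice.\<close>

definition weak_deriv :: "nat \<Rightarrow> (real \<Rightarrow> real) \<Rightarrow> (real \<Rightarrow> real)" where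
  "weak_deriv k f = (SOME g. g \<in> L2_torus \<and> is_weak_deriv k f g)"

definition sobolev_torus_norm :: "nat \<Rightarrow> (real \<Rightarrow> real) \<Rightarrow> real" where
  "sobolev_torus_norm k f = sqrt (\<Sum>j\<le>k. (L2_torus_norm (weak_deriv j f))\<^sup>2)"

text \<open>Elements of \<open>sobolev_torus\<close> are functions, not classes modulo null sets. Every class in
  \<open>H3\<close> contains exactly one continuous periodic function, and this is the representative to
  which pointwise conditions (positivity, minimum, classical derivatives) refer.\<close>

definition H3_torus :: "(real \<Rightarrow> real) set" where
  "H3_torus = {f \<in> sobolev_torus 3. continuous_on UNIV f}"

definition H3_norm :: "(real \<Rightarrow> real) \<Rightarrow> real" where
  "H3_norm = sobolev_torus_norm 3"

text \<open>\<open>{0..T}\<close> for finite \<open>T\<close>, and \<open>{0..}\<close> for \<open>T = \<infinity>\<close>.\<close>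

definition time_interval :: "ereal \<Rightarrow> real set" where
  "time_interval T = {t. 0 \<le> t \<and> ereal t \<le> T}"

definition continuous_into_H3 :: "real set \<Rightarrow> (real \<Rightarrow> real \<Rightarrow> real) \<Rightarrow> bool" where
  "continuous_into_H3 J u \<longleftrightarrow> (\<forall>t\<in>J. u t \<in> H3_torus) \<and>
     (\<forall>t\<in>J. ((\<lambda>s. H3_norm (\<lambda>x. u s x - u t x)) \<longlongrightarrow> 0) (at t within J))"

text \<open>Space-time functions take time as first argument. At the end points of \<open>J\<close> the time
  derivative is one-sided.\<close>

definition solves_arctan_equation :: "real set \<Rightarrow> (real \<Rightarrow> real \<Rightarrow> real) \<Rightarrow> bool" where
  "solves_arctan_equation J u \<longleftrightarrow> (\<forall>t\<in>J. \<forall>x. u t differentiable (at x)) \<and>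
     (\<forall>t\<in>J. \<forall>x. \<exists>d.
        ((\<lambda>s. u s x) has_real_derivative d) (at t within J) \<and>
        ((\<lambda>y. arctan (deriv (u t) y / u t y)) has_real_derivative d) (at x))"

definition positive_solution ::
    "real set \<Rightarrow> (real \<Rightarrow> real) \<Rightarrow> (real \<Rightarrow> real \<Rightarrow> real) \<Rightarrow> bool" where
  "positive_solution J u0 u \<longleftrightarrow>
     continuous_into_H3 J u \<and> (\<forall>t\<in>J. \<forall>x. 0 < u t x) \<and>
     solves_arctan_equation J u \<and> (\<forall>x. u 0 x = u0 x)"

end

theory Submission
  imports Defs "HOL-Complex_Analysis.Great_Picard"
begin

text \<open>Carrying out the derivative, the equation reads \<open>u_t = (u u_xx - u_x\<^sup>2) / (u\<^sup>2 + u_x\<^sup>2)\<close>.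
It is quasilinear and parabolic as long as \<open>u\<close> stays positive, with diffusion coefficient
\<open>u / (u\<^sup>2 + u_x\<^sup>2)\<close>. This coefficient is bounded below in terms of a lower bound of \<open>u\<close> and a bound
of \<open>u\<close> in C1, and the latter is controlled by the H3 norm. So a lower bound of \<open>u\<close> and a bound in H3
together give uniform parabolicity, and the third derivative \<open>w\<close> of \<open>u\<close> satisfies an energy
estimate: the flux \<open>g = arctan (u_x / u)\<close> has third derivative \<open>u / (u\<^sup>2 + u_x\<^sup>2) * w_x\<close> plus a
remainder that is linear in \<open>w\<close> with bounded coefficients (\<open>flux_rem_le\<close>). Testing with \<open>w_x\<close>
bounds the H3 norm, and the time integral of the H4 seminorm as well, for a time that depends only
on the two bounds (\<open>galerkin_energy\<close>). Neither bound can be lost instantly: a Hartley coefficient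
of the solution moves with bounded speed because \<open>arctan\<close> is bounded, while the H3 bound makes the
tail of the series uniformly small (\<open>hseries_close\<close>).

The estimate is applied to Galerkin approximations. The torus carries the orthonormal basis
\<open>(cos kx + sin kx) / sqrt (2 pi)\<close>, with \<open>k\<close> ranging over the integers, whose members satisfy
\<open>h_k' = k h_(-k)\<close>. It is real and needs a single index, so differentiation is the operation
\<open>D c k = - k c (- k)\<close> on coefficients, and the equation becomes \<open>c' = D (flux coefficients of c)\<close>.
Truncating it to \<open>|k| \<le> n\<close> gives an ordinary differential equation. Its right-hand side is globally
Lipschitz after \<open>u\<close> is replaced by \<open>max u \<mu>\<close> in the denominator, and the lower bound shows
afterwards that this changes nothing (\<open>galerkin_bounds\<close>). Arzela and Ascoli provide a limit. The
energy identity of a single mode bounds \<open>k^6 c_k(t)\<^sup>2\<close> by a number \<open>\<beta> k\<close> that is independent of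
\<open>t\<close>, and the integrated estimates make \<open>\<beta>\<close> summable (\<open>coef_solution_exists\<close>). This summable
majorant is what gives continuity in time with values in H3, by dominated convergence
(\<open>coef_solution_positive_solution\<close>).

To connect coefficients with the space H3 one needs that the weak derivatives of a function have
the expected coefficients and conversely that square summable coefficients belong to an L2 function
whose norm they determine. These are the theorem of Riesz and Fischer and the completeness of the
basis in L2, the latter obtained from the theorem of Stone and Weierstrass.

Uniqueness is a maximum principle. At a positive maximum of \<open>exp (- lam t) (u - v)\<close> in space and
time the spatial derivatives of \<open>u\<close> and \<open>v\<close> agree and \<open>u_xx \<le> v_xx\<close>, so the difference of the two
right-hand sides is at most a constant times \<open>u - v\<close>, which contradicts a large choice of \<open>lam\<close>
(\<open>solution_le\<close>).\<close>

section \<open>The Hartley basis of the torus\<close>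

text \<open>Since \<open>cos a + sin a\<close> satisfies \<open>cas a * cas b = cos (a - b) + sin (a + b)\<close>, these functions
(the Hartley kernel, normalised) form a real orthonormal system indexed by the integers, and
differentiation reflects the index and multiplies by it.\<close>

definition hartley :: "int \<Rightarrow> real \<Rightarrow> real" where
  "hartley k x = (cos (of_int k * x) + sin (of_int k * x)) / sqrt (2 * pi)"

definition torus :: "real measure" where
  "torus = restrict_space lborel {-pi..pi}"

definition ip :: "(real \<Rightarrow> real) \<Rightarrow> (real \<Rightarrow> real) \<Rightarrow> real" where
  "ip f g = (\<integral>x. f x * g x \<partial>torus)"

lemma space_torus [simp]: "space torus = {-pi..pi}"
  by (simp add: torus_def space_restrict_space)

lemma finite_measure_torus: "finite_measure torus"
  unfolding torus_def
  by (rule finite_measureI) (simp add: emeasure_restrict_space space_restrict_space)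

interpretation torus: finite_measure torus by (rule finite_measure_torus)

lemma measure_torus: "measure torus (space torus) = 2 * pi"
  unfolding torus_def by (simp add: measure_restrict_space space_restrict_space)

lemma borel_imp_torus [measurable (raw)]: "f \<in> borel_measurable borel \<Longrightarrow> f \<in> borel_measurable torus"
  unfolding torus_def by (rule measurable_restrict_space1) simp

lemma LBINT_eq_torus:
  fixes f :: "real \<Rightarrow> real"
  shows "(LBINT x:{-pi..pi}. f x) = (\<integral>x. f x \<partial>torus)"
  unfolding torus_def set_lebesgue_integral_def by (subst integral_restrict_space) auto

lemma set_integrable_eq_torus:
  fixes f :: "real \<Rightarrow> real"
  shows "set_integrable lborel {-pi..pi} f \<longleftrightarrow> integrable torus f"
  unfolding torus_def by (rule set_integrable_eq) simp

lemma integrable_torus_bounded: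
  fixes f :: "real \<Rightarrow> real"
  assumes "f \<in> borel_measurable borel" "\<And>x. x \<in> {-pi..pi} \<Longrightarrow> \<bar>f x\<bar> \<le> B"
  shows "integrable torus f"
  by (rule torus.integrable_const_bound[where B = B]) (use assms in \<open>auto intro!: AE_I2\<close>)

lemma integrable_torus_continuous:
  fixes f :: "real \<Rightarrow> real"
  assumes "continuous_on UNIV f"
  shows "integrable torus f"
  using borel_integrable_compact[of "{-pi..pi}" f] continuous_on_subset[OF assms subset_UNIV]
  unfolding set_integrable_eq_torus[symmetric] set_integrable_def by (simp add: mult.commute if_distrib)

lemma integral_torus_eq_HK:
  fixes f :: "real \<Rightarrow> real"
  assumes "continuous_on UNIV f"
  shows "(\<integral>x. f x \<partial>torus) = integral {-pi..pi} f"
  unfolding LBINT_eq_torus[symmetric]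
  by (rule set_borel_integral_eq_integral(2))
     (simp add: set_integrable_eq_torus integrable_torus_continuous assms)

text \<open>Integration by parts on the torus has no boundary terms; every later integration by parts
goes back to this.\<close>

lemma integral_torus_deriv_periodic:
  fixes F f :: "real \<Rightarrow> real"
  assumes "\<And>x. (F has_real_derivative f x) (at x)" "continuous_on UNIV f" "F pi = F (-pi)"
  shows "(\<integral>x. f x \<partial>torus) = 0"
proof -
  have "(f has_integral F pi - F (-pi)) {-pi..pi}"
    by (rule fundamental_theorem_of_calculus)
       (auto intro: has_field_derivative_at_within assms(1) simp flip: has_real_derivative_iff_has_vector_derivative)
  then show ?thesis
    by (simp add: integral_torus_eq_HK assms integral_unique)
qed

lemma continuous_on_hartley [continuous_intros]: "continuous_on A (hartley k)"
  unfolding hartley_def by (intro continuous_intros) auto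

lemma continuous_on_hartley_compose [continuous_intros]: "continuous_on A f \<Longrightarrow> continuous_on A (\<lambda>x. hartley k (f x))"
  using continuous_on_compose2[OF continuous_on_hartley] by auto

lemma hartley_measurable [measurable]: "hartley k \<in> borel_measurable borel"
  by (intro borel_measurable_continuous_onI continuous_on_hartley)

lemma abs_hartley_le: "\<bar>hartley k x\<bar> \<le> 1"
proof -
  have "\<bar>cos (of_int k * x) + sin (of_int k * x)\<bar> \<le> 2"
    using abs_cos_le_one[of "of_int k * x"] abs_sin_le_one[of "of_int k * x"] by linarith
  moreover have "2 \<le> sqrt (2 * pi)"
    using pi_gt3 by (intro real_le_rsqrt) auto
  ultimately show ?thesis by (simp add: hartley_def)
qed

lemma hartley_deriv: "(hartley k has_real_derivative of_int k * hartley (-k) x) (at x)"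
proof -
  have "((\<lambda>x. (cos (of_int k * x) + sin (of_int k * x)) / sqrt (2 * pi)) has_real_derivative
      (of_int k * (cos (of_int k * x) - sin (of_int k * x))) / sqrt (2 * pi)) (at x)"
    by (rule DERIV_cdivide) (auto intro!: derivative_eq_intros simp: algebra_simps)
  then show ?thesis by (simp add: hartley_def[abs_def])
qed

lemma hartley_periodic: "hartley k (x + 2 * pi) = hartley k x"
proof -
  have "of_int k * (x + 2 * pi) = of_int k * x + 2 * pi * of_int k" by (simp add: algebra_simps)
  moreover have "cos (y + 2 * pi * of_int k) = cos y" "sin (y + 2 * pi * of_int k) = sin y" for y
    by (simp_all add: sin_add cos_add)
  ultimately show ?thesis unfolding hartley_def by simp
qed

lemma integral_cos_sin:
  "(\<integral>x. cos (of_int k * x) \<partial>torus) = (if k = 0 then 2 * pi else 0)"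
  "(\<integral>x. sin (of_int k * x) \<partial>torus) = 0"
proof -
  have pp: "sin (of_int k * pi) = 0" "sin (of_int k * -pi) = 0" "cos (of_int k * -pi) = cos (of_int k * pi)"
    by (auto simp: mult.commute sin_npi_int)
  show "(\<integral>x. cos (of_int k * x) \<partial>torus) = (if k = 0 then 2 * pi else 0)"
  proof (cases "k = 0")
    case True
    then show ?thesis using measure_torus by simp
  next
    case False
    have "((\<lambda>x. sin (of_int k * x) / of_int k) has_real_derivative cos (of_int k * x)) (at x)" for x :: real
      using False by (auto intro!: derivative_eq_intros simp: field_simps)
    moreover have "continuous_on UNIV (\<lambda>x::real. cos (of_int k * x))" by (intro continuous_intros)
    ultimately have "(\<integral>x. cos (of_int k * x) \<partial>torus) = 0"
      by (rule integral_torus_deriv_periodic) (simp only: pp)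
    with False show ?thesis by simp
  qed
  show "(\<integral>x. sin (of_int k * x) \<partial>torus) = 0"
  proof (cases "k = 0")
    case False
    have "((\<lambda>x. - cos (of_int k * x) / of_int k) has_real_derivative sin (of_int k * x)) (at x)" for x :: real
      using False by (auto intro!: derivative_eq_intros simp: field_simps)
    moreover have "continuous_on UNIV (\<lambda>x::real. sin (of_int k * x))" by (intro continuous_intros)
    ultimately show ?thesis
      by (rule integral_torus_deriv_periodic) (simp only: pp)
  qed auto
qed

lemma hartley_mult: "hartley k x * hartley l x = (cos (of_int (k - l) * x) + sin (of_int (k + l) * x)) / (2 * pi)"
proof -
  have "of_int (k - l) * x = of_int k * x - of_int l * x" "of_int (k + l) * x = of_int k * x + of_int l * x"
    by (simp_all add: algebra_simps)
  then have "cos (of_int (k - l) * x) + sin (of_int (k + l) * x)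
      = (cos (of_int k * x) + sin (of_int k * x)) * (cos (of_int l * x) + sin (of_int l * x))"
    by (simp only: cos_diff sin_add) (simp add: algebra_simps)
  then show ?thesis unfolding hartley_def times_divide_times_eq by simp
qed

lemma ip_hartley_hartley: "ip (hartley k) (hartley l) = (if k = l then 1 else 0)"
proof -
  have "ip (hartley k) (hartley l) = (\<integral>x. (cos (of_int (k - l) * x) + sin (of_int (k + l) * x)) / (2 * pi) \<partial>torus)"
    unfolding ip_def hartley_mult ..
  also have "\<dots> = ((\<integral>x. cos (of_int (k - l) * x) \<partial>torus) + (\<integral>x. sin (of_int (k + l) * x) \<partial>torus)) / (2 * pi)"
    by (subst Bochner_Integration.integral_add[symmetric])
       (auto intro!: integrable_torus_continuous continuous_intros)
  also have "\<dots> = (if k = l then 1 else 0)"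
    by (subst integral_cos_sin, subst integral_cos_sin) auto
  finally show ?thesis .
qed

text \<open>The sign pattern \<open>+, +, -, -\<close> of the successive derivatives of \<open>cos + sin\<close>.\<close>

definition dsign :: "nat \<Rightarrow> real" where "dsign j = (if even (j div 2) then 1 else -1)"

lemma deriv_iter_hartley:
  "(deriv ^^ j) (hartley k) = (\<lambda>x. dsign j * of_int k ^ j * hartley (if even j then k else -k) x)"
proof (induction j)
  case (Suc j)
  have "deriv (\<lambda>x. dsign j * of_int k ^ j * hartley (if even j then k else -k) x) x
     = dsign j * of_int k ^ j * (of_int (if even j then k else -k) * hartley (- (if even j then k else -k)) x)" for x
    by (intro DERIV_imp_deriv DERIV_cmult hartley_deriv)
  moreover have "dsign (Suc j) = (if even j then dsign j else - dsign j)"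
    unfolding dsign_def by (cases "even j") (auto simp: even_Suc_div_two odd_Suc_div_two)
  ultimately show ?case unfolding funpow.simps comp_apply Suc fun_eq_iff
    by (cases "even j") (auto simp: algebra_simps)
qed (auto simp: dsign_def)

text \<open>Testing a weak derivative with the basis functions yields its coefficients, which determine
it almost everywhere.\<close>

lemma test_function_hartley: "torus_test_function (hartley k)"
  unfolding torus_test_function_def
proof (intro conjI allI)
  show "periodic_fun_simple (hartley k) (2 * pi)" by unfold_locales (rule hartley_periodic)
  show "(deriv ^^ n) (hartley k) differentiable (at x)" for n x
    unfolding deriv_iter_hartley
    by (intro differentiable_mult differentiable_const) (use hartley_deriv in \<open>auto simp: real_differentiable_def\<close>)
qed

section \<open>Square integrable functions on the torus\<close>

definition sq_integrable :: "(real \<Rightarrow> real) \<Rightarrow> bool" where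
  "sq_integrable f \<longleftrightarrow> f \<in> borel_measurable borel \<and> integrable torus (\<lambda>x. (f x)\<^sup>2)"

lemma L2_torus_iff: "f \<in> L2_torus \<longleftrightarrow> periodic_fun_simple f (2 * pi) \<and> sq_integrable f"
  by (auto simp: L2_torus_def sq_integrable_def set_integrable_eq_torus)

lemma L2_torus_norm_sq: "sq_integrable f \<Longrightarrow> (L2_torus_norm f)\<^sup>2 = ip f f"
  unfolding L2_torus_norm_def LBINT_eq_torus ip_def
  by (simp add: power2_eq_square)

lemma sq_integrable_measurable [dest]: "sq_integrable f \<Longrightarrow> f \<in> borel_measurable borel"
  by (simp add: sq_integrable_def)

lemma sq_integrable_mult_integrable:
  assumes "sq_integrable f" "sq_integrable g" shows "integrable torus (\<lambda>x. f x * g x)"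
proof (rule Bochner_Integration.integrable_bound)
  show "integrable torus (\<lambda>x. (f x)\<^sup>2 + (g x)\<^sup>2)"
    using assms by (auto simp: sq_integrable_def)
  have [measurable]: "f \<in> borel_measurable borel" "g \<in> borel_measurable borel" using assms by auto
  show "(\<lambda>x. f x * g x) \<in> borel_measurable torus" by measurable
  show "AE x in torus. norm (f x * g x) \<le> norm ((f x)\<^sup>2 + (g x)\<^sup>2)"
  proof (rule AE_I2)
    fix x
    have "2 * \<bar>f x\<bar> * \<bar>g x\<bar> \<le> (f x)\<^sup>2 + (g x)\<^sup>2"
      using sum_squares_bound[of "\<bar>f x\<bar>" "\<bar>g x\<bar>"] by simp
    then have "\<bar>f x * g x\<bar> \<le> (f x)\<^sup>2 + (g x)\<^sup>2"
      by (simp add: abs_mult) (use mult_nonneg_nonneg[of "\<bar>f x\<bar>" "\<bar>g x\<bar>"] in linarith)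
    then show "norm (f x * g x) \<le> norm ((f x)\<^sup>2 + (g x)\<^sup>2)" by simp
  qed
qed

lemma sq_integrable_continuous: "continuous_on UNIV f \<Longrightarrow> sq_integrable f"
  unfolding sq_integrable_def
  by (auto intro!: borel_measurable_continuous_onI integrable_torus_continuous continuous_intros)

lemma sq_integrable_hartley: "sq_integrable (hartley k)" by (intro sq_integrable_continuous continuous_on_hartley)

lemma sq_integrable_integrable: assumes "sq_integrable f" shows "integrable torus f"
  using sq_integrable_mult_integrable[OF assms sq_integrable_continuous[of "\<lambda>_. 1"]] by simp

lemma sq_integrable_cmult: assumes "sq_integrable f" shows "sq_integrable (\<lambda>x. c * f x)"
  using assms by (auto simp: sq_integrable_def power_mult_distrib)

lemma sq_integrable_add: assumes "sq_integrable f" "sq_integrable g" shows "sq_integrable (\<lambda>x. f x + g x)"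
proof -
  have "(f x + g x)\<^sup>2 = (f x)\<^sup>2 + (g x)\<^sup>2 + 2 * (f x * g x)" for x
    by (simp add: power2_sum)
  then show ?thesis
    using assms sq_integrable_mult_integrable[OF assms] by (auto simp: sq_integrable_def)
qed

lemma sq_integrable_diff: assumes "sq_integrable f" "sq_integrable g" shows "sq_integrable (\<lambda>x. f x - g x)"
  using sq_integrable_add[OF assms(1) sq_integrable_cmult[OF assms(2), of "-1"]] by simp

lemma sq_integrable_sum: "(\<And>k. k \<in> S \<Longrightarrow> sq_integrable (f k)) \<Longrightarrow> sq_integrable (\<lambda>x. \<Sum>k\<in>S. f k x)"
  by (induction S rule: infinite_finite_induct) (simp_all add: sq_integrable_add sq_integrable_continuous)

lemma ip_commute: "ip f g = ip g f"
  by (simp add: ip_def mult.commute)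

lemma ip_add_left: "sq_integrable f \<Longrightarrow> sq_integrable g \<Longrightarrow> sq_integrable k \<Longrightarrow> ip (\<lambda>x. f x + g x) k = ip f k + ip g k"
  by (simp add: ip_def distrib_right sq_integrable_mult_integrable)

lemma ip_diff_left: "sq_integrable f \<Longrightarrow> sq_integrable g \<Longrightarrow> sq_integrable k \<Longrightarrow> ip (\<lambda>x. f x - g x) k = ip f k - ip g k"
  by (simp add: ip_def left_diff_distrib sq_integrable_mult_integrable)

lemma ip_diff_right: "sq_integrable f \<Longrightarrow> sq_integrable g \<Longrightarrow> sq_integrable k \<Longrightarrow> ip k (\<lambda>x. f x - g x) = ip k f - ip k g"
  by (simp add: ip_commute[of k] ip_diff_left)

lemma ip_cmult_left: "ip (\<lambda>x. c * f x) g = c * ip f g"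
  by (simp add: ip_def mult.assoc)

lemma ip_cmult_right: "ip f (\<lambda>x. c * g x) = c * ip f g"
  by (simp add: ip_commute[of f] ip_cmult_left)

lemma ip_zero [simp]: "ip (\<lambda>x. 0) g = 0" "ip f (\<lambda>x. 0) = 0"
  by (auto simp: ip_def)

lemma ip_sum_left:
  "(\<And>k. k \<in> S \<Longrightarrow> sq_integrable (f k)) \<Longrightarrow> sq_integrable g \<Longrightarrow> ip (\<lambda>x. \<Sum>k\<in>S. f k x) g = (\<Sum>k\<in>S. ip (f k) g)"
  by (induction S rule: infinite_finite_induct) (auto simp: ip_add_left sq_integrable_sum)

lemma ip_self_nonneg: "ip f f \<ge> 0"
  by (simp add: ip_def)

text \<open>The square of \<open>d f - g\<close> has nonnegative integral.\<close>

lemma ip_Young: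
  assumes "sq_integrable f" "sq_integrable g" "d > 0"
  shows "2 * \<bar>ip f g\<bar> \<le> d * ip f f + ip g g / d"
proof -
  have *: "2 * ip f g \<le> d * ip f f + ip g g / d" if "sq_integrable f" "sq_integrable g" for f g
  proof -
    have "0 \<le> ip (\<lambda>x. d * f x - g x) (\<lambda>x. d * f x - g x)" by (rule ip_self_nonneg)
    also have "\<dots> = d * (d * ip f f) - 2 * d * ip f g + ip g g"
      using that by (simp add: ip_diff_left ip_diff_right sq_integrable_cmult sq_integrable_diff ip_cmult_left ip_cmult_right
          algebra_simps ip_commute[of g f])
    finally have "d * (2 * ip f g) \<le> d * (d * ip f f + ip g g / d)"
      using \<open>d > 0\<close> by (simp add: algebra_simps)
    then show ?thesis using \<open>d > 0\<close> by simp
  qed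
  have "ip (\<lambda>x. - g x) (\<lambda>x. - g x) = ip g g" "ip f (\<lambda>x. - g x) = - ip f g"
    by (simp_all add: ip_def)
  then show ?thesis using *[OF assms(1,2)] *[OF assms(1), of "\<lambda>x. - g x"] sq_integrable_cmult[OF assms(2), of "-1"]
    by auto
qed

lemma ip_Cauchy_Schwarz:
  assumes "sq_integrable f" "sq_integrable g"
  shows "\<bar>ip f g\<bar> \<le> sqrt (ip f f) * sqrt (ip g g)"
proof -
  define p A B where "p = \<bar>ip f g\<bar>" and "A = ip f f" and "B = ip g g"
  have AB: "A \<ge> 0" "B \<ge> 0" by (auto simp: A_def B_def ip_self_nonneg)
  have *: "p \<le> sqrt (A + s) * sqrt (B + s)" if s: "s > 0" for s
  proof -
    define a b where "a = sqrt (A + s)" and "b = sqrt (B + s)"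
    have ab: "a > 0" "b > 0" "A + s = a * a" "B + s = b * b"
      using AB s by (auto simp: a_def b_def)
    have "2 * p \<le> (b / a) * A + B / (b / a)"
      using ip_Young[OF assms, of "b / a"] ab unfolding p_def A_def B_def by simp
    also have "\<dots> \<le> (b / a) * (A + s) + (B + s) / (b / a)"
      using ab s by (intro add_mono mult_left_mono divide_right_mono) auto
    also have "\<dots> = 2 * (a * b)" unfolding ab(3,4) using ab(1,2) by simp
    finally show ?thesis by (simp add: a_def b_def)
  qed
  \<comment> \<open>The shift by \<open>s\<close> keeps the weight \<open>b / a\<close> of the Young inequality defined if \<open>f\<close> or \<open>g\<close> vanishes.\<close>
  have "((\<lambda>s. sqrt (A + s) * sqrt (B + s)) \<longlongrightarrow> sqrt (A + 0) * sqrt (B + 0)) (at_right 0)"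
    by (intro tendsto_intros)
  then have "p \<le> sqrt (A + 0) * sqrt (B + 0)"
    by (rule tendsto_lowerbound) (auto simp: eventually_at_right_field intro!: exI[of _ 1] *)
  then show ?thesis by (simp add: p_def A_def B_def)
qed

definition trig_sum :: "int set \<Rightarrow> (int \<Rightarrow> real) \<Rightarrow> real \<Rightarrow> real" where
  "trig_sum S c x = (\<Sum>k\<in>S. c k * hartley k x)"

lemma continuous_on_trig_sum [continuous_intros]: "continuous_on A (trig_sum S c)"
  unfolding trig_sum_def by (intro continuous_intros)

lemma trig_sum_measurable [measurable]: "trig_sum S c \<in> borel_measurable borel"
  by (intro borel_measurable_continuous_onI continuous_on_trig_sum)

lemma sq_integrable_trig_sum: "sq_integrable (trig_sum S c)" by (intro sq_integrable_continuous continuous_on_trig_sum)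

lemma ip_trig_sum_left: 
  assumes "sq_integrable f" shows "ip (trig_sum S c) f = (\<Sum>k\<in>S. c k * ip f (hartley k))"
proof -
  have "ip (trig_sum S c) f = ip (\<lambda>x. \<Sum>k\<in>S. (\<lambda>x. c k * hartley k x) x) f"
    by (simp add: trig_sum_def[abs_def])
  also have "\<dots> = (\<Sum>k\<in>S. ip (\<lambda>x. c k * hartley k x) f)"
    by (rule ip_sum_left) (auto intro: sq_integrable_cmult sq_integrable_hartley assms)
  finally show ?thesis by (simp add: ip_cmult_left ip_commute[of f])
qed

lemma ip_trig_sum_hartley: assumes "finite S" shows "ip (trig_sum S c) (hartley k) = (if k \<in> S then c k else 0)"
  using assms by (simp add: ip_trig_sum_left sq_integrable_hartley ip_hartley_hartley if_distrib cong: if_cong)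

lemma ip_trig_sum_trig_sum: assumes "finite S" shows "ip (trig_sum S c) (trig_sum S c) = (\<Sum>k\<in>S. (c k)\<^sup>2)"
  by (subst ip_trig_sum_left) (auto intro!: sum.cong simp: sq_integrable_trig_sum ip_trig_sum_hartley assms power2_eq_square)

lemma Bessel:
  assumes "sq_integrable f" "finite S"
  shows "(\<Sum>k\<in>S. (ip f (hartley k))\<^sup>2) \<le> ip f f"
proof -
  let ?p = "trig_sum S (\<lambda>k. ip f (hartley k))"
  have "0 \<le> ip (\<lambda>x. f x - ?p x) (\<lambda>x. f x - ?p x)" by (rule ip_self_nonneg)
  also have "\<dots> = ip f f - 2 * ip ?p f + ip ?p ?p"
    using assms by (simp add: ip_diff_left ip_diff_right sq_integrable_diff sq_integrable_trig_sum ip_commute[of f ?p])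
  also have "\<dots> = ip f f - (\<Sum>k\<in>S. (ip f (hartley k))\<^sup>2)"
    using assms by (simp add: ip_trig_sum_trig_sum) (simp add: ip_trig_sum_left power2_eq_square)
  finally show ?thesis by simp
qed

text \<open>Lower semicontinuity of the L2 norm under convergence almost everywhere, from the lemma of
Fatou.\<close>

lemma fatou_sq:
  assumes "\<And>j. sq_integrable (u j)" "AE x in torus. (\<lambda>j. u j x) \<longlonglongrightarrow> v x" "v \<in> borel_measurable borel"
    and "eventually (\<lambda>j. ip (u j) (u j) \<le> B) sequentially"
  shows "sq_integrable v \<and> ip v v \<le> B"
proof -
  have m [measurable]: "u j \<in> borel_measurable torus" "v \<in> borel_measurable torus" for j
    using assms borel_imp_torus by blast+
  have B: "B \<ge> 0" using assms(4) ip_self_nonneg unfolding eventually_sequentially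
    by (meson order_trans le_refl)
  have "(\<integral>\<^sup>+x. ennreal ((v x)\<^sup>2) \<partial>torus) = (\<integral>\<^sup>+x. liminf (\<lambda>j. ennreal ((u j x)\<^sup>2)) \<partial>torus)"
  proof (rule nn_integral_cong_AE)
    show "AE x in torus. ennreal ((v x)\<^sup>2) = liminf (\<lambda>j. ennreal ((u j x)\<^sup>2))"
      using assms(2)
    proof eventually_elim
      case (elim x)
      then have "(\<lambda>j. ennreal ((u j x)\<^sup>2)) \<longlonglongrightarrow> ennreal ((v x)\<^sup>2)"
        by (intro tendsto_ennrealI tendsto_intros)
      then show ?case by (rule lim_imp_Liminf[OF trivial_limit_sequentially, symmetric])
    qed
  qed
  also have "\<dots> \<le> liminf (\<lambda>j. \<integral>\<^sup>+x. ennreal ((u j x)\<^sup>2) \<partial>torus)"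
    by (rule nn_integral_liminf) measurable
  also have "\<dots> \<le> limsup (\<lambda>j. \<integral>\<^sup>+x. ennreal ((u j x)\<^sup>2) \<partial>torus)"
    by (rule Liminf_le_Limsup) simp
  also have "\<dots> \<le> ennreal B"
  proof (rule Limsup_bounded)
    show "eventually (\<lambda>j. (\<integral>\<^sup>+x. ennreal ((u j x)\<^sup>2) \<partial>torus) \<le> ennreal B) sequentially"
      using assms(4)
    proof eventually_elim
      case (elim j)
      have "(\<integral>\<^sup>+x. ennreal ((u j x)\<^sup>2) \<partial>torus) = ennreal (\<integral>x. (u j x)\<^sup>2 \<partial>torus)"
        using assms(1)[of j] by (intro nn_integral_eq_integral) (auto simp: sq_integrable_def)
      then show ?case using elim by (simp add: ip_def power2_eq_square ennreal_leI)
    qed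
  qed
  finally have le: "(\<integral>\<^sup>+x. ennreal ((v x)\<^sup>2) \<partial>torus) \<le> ennreal B" .
  have int: "integrable torus (\<lambda>x. (v x)\<^sup>2)"
    by (rule integrableI_bounded) (use le_less_trans[OF le ennreal_less_top] in auto)
  have "ennreal (\<integral>x. (v x)\<^sup>2 \<partial>torus) \<le> ennreal B"
    using le nn_integral_eq_integral[OF int] by simp
  then show ?thesis using int assms(3) B by (auto simp: sq_integrable_def ip_def power2_eq_square)
qed

text \<open>The sum of the absolute values is integrable by monotone convergence, hence finite almost
everywhere.\<close>

lemma L1_AE_summable:
  fixes d :: "nat \<Rightarrow> real \<Rightarrow> real"
  assumes [measurable]: "\<And>j. d j \<in> borel_measurable torus"
    and "\<And>j. integrable torus (d j)" "\<And>j. (\<integral>x. \<bar>d j x\<bar> \<partial>torus) \<le> b j" "summable b"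
  shows "AE x in torus. summable (\<lambda>j. d j x)"
proof -
  have b0: "b j \<ge> 0" for j
    using order_trans[OF Bochner_Integration.integral_nonneg assms(3)] by simp
  have "(\<integral>\<^sup>+x. (\<Sum>j. ennreal \<bar>d j x\<bar>) \<partial>torus) = (\<Sum>j. \<integral>\<^sup>+x. ennreal \<bar>d j x\<bar> \<partial>torus)"
    by (rule nn_integral_suminf) measurable
  also have "\<dots> \<le> (\<Sum>j. ennreal (b j))"
  proof (rule suminf_le)
    fix j
    have "(\<integral>\<^sup>+x. ennreal \<bar>d j x\<bar> \<partial>torus) = ennreal (\<integral>x. \<bar>d j x\<bar> \<partial>torus)"
      by (rule nn_integral_eq_integral) (use assms(2)[of j] in auto)
    then show "(\<integral>\<^sup>+x. ennreal \<bar>d j x\<bar> \<partial>torus) \<le> ennreal (b j)"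
      using assms(3) by (simp add: ennreal_leI)
  qed auto
  also have "\<dots> = ennreal (\<Sum>j. b j)"
    by (rule suminf_ennreal2) (use b0 assms(4) in auto)
  finally have "(\<integral>\<^sup>+x. (\<Sum>j. ennreal \<bar>d j x\<bar>) \<partial>torus) \<noteq> \<infinity>"
    by (metis ennreal_neq_top infinity_ennreal_def neq_top_trans)
  then have "AE x in torus. (\<Sum>j. ennreal \<bar>d j x\<bar>) \<noteq> \<infinity>"
    by (intro nn_integral_PInf_AE) measurable
  then show ?thesis
  proof eventually_elim
    case (elim x)
    then have "summable (\<lambda>j. \<bar>d j x\<bar>)" by (intro summable_suminf_not_top) auto
    then show ?case by (rule summable_rabs_cancel)
  qed
qed

abbreviation modes :: "nat \<Rightarrow> int set" where "modes n \<equiv> {- int n..int n}"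

lemma modes_mono: "n \<le> m \<Longrightarrow> modes n \<subseteq> modes m"
  by auto

lemma finite_subset_modes:
  fixes X :: "int set"
  assumes "finite X"
  obtains n where "X \<subseteq> modes n"
proof -
  have "\<forall>k\<in>X. nat \<bar>k\<bar> \<le> (\<Sum>k\<in>X. nat \<bar>k\<bar>)" using assms by (auto intro: member_le_sum)
  then have "k \<in> modes (\<Sum>k\<in>X. nat \<bar>k\<bar>)" if "k \<in> X" for k
    using that by (auto simp: nat_le_iff simp del: of_nat_sum)
  then show ?thesis using that by blast
qed

lemma tail_small:
  fixes a :: "int \<Rightarrow> real"
  assumes "\<And>k. a k \<ge> 0" "a summable_on UNIV" "e > 0"
  obtains n where "\<And>F. finite F \<Longrightarrow> F \<inter> modes n = {} \<Longrightarrow> sum a F < e"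
proof -
  have "(a has_sum infsum a UNIV) UNIV" using assms by simp
  then have "\<forall>\<^sub>F F in finite_subsets_at_top UNIV. dist (sum a F) (infsum a UNIV) < e"
    using assms(3) by (auto simp: has_sum_def tendsto_iff)
  then obtain X where X: "finite X" "\<And>Y. finite Y \<Longrightarrow> X \<subseteq> Y \<Longrightarrow> dist (sum a Y) (infsum a UNIV) < e"
    by (auto simp: eventually_finite_subsets_at_top)
  obtain n where n: "X \<subseteq> modes n" using finite_subset_modes[OF X(1)] .
  show ?thesis
  proof (rule that[of n])
    fix F :: "int set" assume F: "finite F" "F \<inter> modes n = {}"
    have "sum a (X \<union> F) = sum a X + sum a F"
      by (rule sum.union_disjoint) (use F X(1) n in auto)
    moreover have "sum a (X \<union> F) \<le> infsum a UNIV"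
      using X(1) F assms by (intro finite_sum_le_infsum) auto
    moreover have "infsum a UNIV - sum a X < e"
      using X(2)[of X] X(1) by (auto simp: dist_real_def)
    ultimately show "sum a F < e" by linarith
  qed
qed

lemma trig_sum_diff_modes: "n \<le> m \<Longrightarrow> trig_sum (modes m) e x - trig_sum (modes n) e x = trig_sum (modes m - modes n) e x"
  unfolding trig_sum_def by (subst sum_diff) auto

text \<open>The partial sums are Cauchy in L2. Along a subsequence with geometrically small increments
they converge almost everywhere, by \<open>L1_AE_summable\<close>, and Fatou turns the Cauchy property into
convergence in L2 to the pointwise limit. The limit is a function on the line that is periodic
because every partial sum is.\<close>

lemma Riesz_Fischer:
  assumes A: "\<And>S. finite S \<Longrightarrow> (\<Sum>k\<in>S. (e k)\<^sup>2) \<le> A"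
  obtains G where "G \<in> L2_torus" "\<And>k. ip G (hartley k) = e k" "ip G G \<le> A"
    "(\<lambda>n. ip (\<lambda>x. G x - trig_sum (modes n) e x) (\<lambda>x. G x - trig_sum (modes n) e x)) \<longlonglongrightarrow> 0"
proof -
  have summ: "(\<lambda>k. (e k)\<^sup>2) summable_on UNIV"
    by (rule nonneg_bdd_above_summable_on) (auto intro!: bdd_aboveI2 A)
  have "\<exists>n. \<forall>F. finite F \<longrightarrow> F \<inter> modes n = {} \<longrightarrow> (\<Sum>k\<in>F. (e k)\<^sup>2) < (1/4)^j" for j :: nat
  proof -
    obtain n where "\<And>F. finite F \<Longrightarrow> F \<inter> modes n = {} \<Longrightarrow> (\<Sum>k\<in>F. (e k)\<^sup>2) < (1/4)^j"
      by (rule tail_small[OF _ summ, of "(1/4)^j"]) auto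
    then show ?thesis by blast
  qed
  then obtain f where f: "\<And>j F. finite F \<Longrightarrow> F \<inter> modes (f j) = {} \<Longrightarrow> (\<Sum>k\<in>F. (e k)\<^sup>2) < (1/4)^j"
    by metis
  \<comment> \<open>Cumulative sums make \<open>N\<close> increasing; the summand 1 gives \<open>N j \<ge> j\<close>.\<close>
  define N where "N j = (\<Sum>i\<le>j. f i + 1)" for j
  have N_Suc: "N j \<le> N (Suc j)" for j by (simp add: N_def)
  have N_f: "f j \<le> N j" for j
    using member_le_sum[of j "{..j}" "\<lambda>i. f i + 1"] by (simp add: N_def)
  have N_ge: "j \<le> N j" for j
    unfolding N_def using sum_mono[of "{..j}" "\<lambda>_. 1" "\<lambda>i. f i + 1"] by simp
  define u d where "u j = trig_sum (modes (N j)) e" and "d j = trig_sum (modes (N (Suc j)) - modes (N j)) e" for j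
  have d_int: "(\<integral>x. \<bar>d j x\<bar> \<partial>torus) \<le> (1 + 2 * pi) / 2 * (1/2)^j" for j
  proof -
    have i: "integrable torus (\<lambda>x. (d j x)\<^sup>2)" using sq_integrable_trig_sum by (simp add: d_def sq_integrable_def)
    have "2 * \<bar>d j x\<bar> \<le> 2^j * (d j x)\<^sup>2 + (1/2)^j" for x
    proof -
      have "0 \<le> (2^j * \<bar>d j x\<bar> - 1)\<^sup>2 * (1/2)^j" by simp
      also have "\<dots> = 2^j * (d j x)\<^sup>2 + (1/2)^j - 2 * \<bar>d j x\<bar>"
        by (simp add: power2_eq_square power_one_over field_simps)
      finally show ?thesis by simp
    qed
    then have "(\<integral>x. 2 * \<bar>d j x\<bar> \<partial>torus) \<le> (\<integral>x. 2^j * (d j x)\<^sup>2 + (1/2)^j \<partial>torus)"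
      using i sq_integrable_integrable[OF sq_integrable_trig_sum]
      by (intro integral_mono) (auto simp: d_def)
    also have "\<dots> = 2^j * ip (d j) (d j) + (1/2)^j * (2 * pi)"
      using i measure_torus by (simp add: ip_def power2_eq_square)
    also have "ip (d j) (d j) \<le> (1/4)^j"
    proof -
      have "(\<Sum>k\<in>modes (N (Suc j)) - modes (N j). (e k)\<^sup>2) < (1/4)^j"
        using modes_mono[OF N_f[of j]] by (intro f) auto
      then show ?thesis by (simp add: d_def ip_trig_sum_trig_sum)
    qed
    finally have "(\<integral>x. 2 * \<bar>d j x\<bar> \<partial>torus) \<le> 2^j * (1/4)^j + (1/2)^j * (2 * pi)"
      by simp
    also have "(2::real)^j * (1/4)^j = (1/2)^j" by (simp flip: power_mult_distrib)
    finally show ?thesis by (simp add: algebra_simps)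
  qed
  have ae: "AE x in torus. summable (\<lambda>j. d j x)"
  proof (rule L1_AE_summable[where b = "\<lambda>j. (1 + 2 * pi) / 2 * (1/2)^j"])
    show "d j \<in> borel_measurable torus" for j unfolding d_def by measurable
    show "integrable torus (d j)" for j unfolding d_def by (rule sq_integrable_integrable[OF sq_integrable_trig_sum])
    show "summable (\<lambda>j. (1 + 2 * pi) / 2 * (1 / 2 :: real) ^ j)"
      by (intro summable_mult summable_geometric) simp
  qed (rule d_int)
  have u_eq: "u j x = u 0 x + (\<Sum>i<j. d i x)" for j x
  proof (induction j)
    case (Suc j)
    have "u (Suc j) x - u j x = d j x"
      unfolding u_def d_def by (rule trig_sum_diff_modes[OF N_Suc])
    with Suc show ?case by simp
  qed simp
  \<comment> \<open>Where the sequence diverges, \<open>lim\<close> is an unspecified value, but it depends on the sequence only and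
  so does not destroy periodicity.\<close>
  define G where "G x = lim (\<lambda>j. u j x)" for x
  have G_lim: "AE x in torus. (\<lambda>j. u j x) \<longlonglongrightarrow> G x"
    using ae
  proof eventually_elim
    case (elim x)
    then have "(\<lambda>j. u 0 x + (\<Sum>i<j. d i x)) \<longlonglongrightarrow> u 0 x + (\<Sum>j. d j x)"
      by (intro tendsto_intros summable_LIMSEQ)
    then have "(\<lambda>j. u j x) \<longlonglongrightarrow> u 0 x + (\<Sum>j. d j x)" unfolding u_eq[symmetric] .
    then have "convergent (\<lambda>j. u j x)" by (rule convergentI)
    then show ?case unfolding G_def by (simp add: convergent_LIMSEQ_iff)
  qed
  have G_meas [measurable]: "G \<in> borel_measurable borel"
    unfolding G_def[abs_def] u_def by measurable
  have sq_integrable_u: "sq_integrable (u j)" for j by (simp add: u_def sq_integrable_trig_sum)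
  have "sq_integrable G \<and> ip G G \<le> A"
    by (rule fatou_sq[OF sq_integrable_u G_lim G_meas]) (auto simp: u_def ip_trig_sum_trig_sum A)
  then have G: "sq_integrable G" "ip G G \<le> A" by auto
  define r where "r n = ip (\<lambda>x. G x - trig_sum (modes n) e x) (\<lambda>x. G x - trig_sum (modes n) e x)" for n
  have r_le: "r n \<le> B" if B: "\<And>F. finite F \<Longrightarrow> F \<inter> modes n = {} \<Longrightarrow> (\<Sum>k\<in>F. (e k)\<^sup>2) < B" for n B
  proof -
    have "sq_integrable (\<lambda>x. G x - trig_sum (modes n) e x) \<and> r n \<le> B"
      unfolding r_def
    proof (rule fatou_sq[where u = "\<lambda>j x. u j x - trig_sum (modes n) e x"])
      show "AE x in torus. (\<lambda>j. u j x - trig_sum (modes n) e x) \<longlonglongrightarrow> G x - trig_sum (modes n) e x"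
        using G_lim by eventually_elim (intro tendsto_intros)
      have "ip (\<lambda>x. u j x - trig_sum (modes n) e x) (\<lambda>x. u j x - trig_sum (modes n) e x) \<le> B" if "j \<ge> n" for j
      proof -
        have "n \<le> N j" using that N_ge le_trans by blast
        then have "ip (\<lambda>x. u j x - trig_sum (modes n) e x) (\<lambda>x. u j x - trig_sum (modes n) e x)
           = (\<Sum>k\<in>modes (N j) - modes n. (e k)\<^sup>2)"
          unfolding u_def trig_sum_diff_modes[OF \<open>n \<le> N j\<close>] by (simp add: ip_trig_sum_trig_sum)
        also have "\<dots> \<le> B" by (rule less_imp_le, rule B) auto
        finally show ?thesis .
      qed
      then show "\<forall>\<^sub>F j in sequentially. ip (\<lambda>x. u j x - trig_sum (modes n) e x) (\<lambda>x. u j x - trig_sum (modes n) e x) \<le> B"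
        by (rule eventually_sequentiallyI)
      show "(\<lambda>x. G x - trig_sum (modes n) e x) \<in> borel_measurable borel" by measurable
    qed (intro sq_integrable_diff sq_integrable_u sq_integrable_trig_sum)
    then show ?thesis by simp
  qed
  have r0: "r \<longlonglongrightarrow> 0"
  proof (rule LIMSEQ_I)
    fix s :: real assume "s > 0"
    then obtain n where n: "\<And>F. finite F \<Longrightarrow> F \<inter> modes n = {} \<Longrightarrow> (\<Sum>k\<in>F. (e k)\<^sup>2) < s / 2"
      using tail_small[OF _ summ, of "s / 2"] by (metis half_gt_zero zero_le_power2)
    have "norm (r m - 0) < s" if "m \<ge> n" for m
    proof -
      have "r m \<le> s / 2"
        by (rule r_le, rule n) (use modes_mono[OF that] in auto)
      moreover have "r m \<ge> 0" by (simp add: r_def ip_self_nonneg)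
      ultimately show ?thesis using \<open>s > 0\<close> by simp
    qed
    then show "\<exists>no. \<forall>n\<ge>no. norm (r n - 0) < s" by blast
  qed
  have coef: "ip G (hartley k) = e k" for k
  proof -
    have le: "\<bar>ip G (hartley k) - e k\<bar> \<le> sqrt (r n)" if "n \<ge> nat \<bar>k\<bar>" for n
    proof -
      have "ip (\<lambda>x. G x - trig_sum (modes n) e x) (hartley k) = ip G (hartley k) - e k"
        using that G(1) by (simp add: ip_diff_left sq_integrable_trig_sum sq_integrable_hartley ip_trig_sum_hartley) linarith
      then show ?thesis
        using ip_Cauchy_Schwarz[of "\<lambda>x. G x - trig_sum (modes n) e x" "hartley k"] G(1)
        by (simp add: sq_integrable_diff sq_integrable_trig_sum sq_integrable_hartley ip_hartley_hartley r_def)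
    qed
    have "(\<lambda>n. sqrt (r n)) \<longlonglongrightarrow> sqrt 0" by (intro tendsto_intros r0)
    then have "\<bar>ip G (hartley k) - e k\<bar> \<le> sqrt 0"
      by (rule tendsto_lowerbound) (auto intro!: eventually_sequentiallyI le)
    then show ?thesis by simp
  qed
  have "periodic_fun_simple G (2 * pi)"
    by unfold_locales (simp add: G_def u_def trig_sum_def hartley_periodic)
  then have "G \<in> L2_torus" using G by (simp add: L2_torus_iff)
  with coef G(2) r0 show ?thesis unfolding r_def by (intro that)
qed

text \<open>An inductive description of the span of the basis is convenient because the closure under
products, needed for Stone and Weierstrass, is then an induction that never mentions coefficients.\<close>

inductive trig_poly :: "(real \<Rightarrow> real) \<Rightarrow> bool" where
  zero: "trig_poly (\<lambda>x. 0)"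
| add_hartley: "trig_poly f \<Longrightarrow> trig_poly (\<lambda>x. f x + c * hartley k x)"

lemma trig_poly_add: assumes "trig_poly f" "trig_poly g" shows "trig_poly (\<lambda>x. f x + g x)"
  using assms(2)
proof induction
  case zero
  then show ?case using assms(1) by simp
next
  case (add_hartley g c k)
  from trig_poly.add_hartley[OF add_hartley(2), of c k] show ?case by (simp add: add.assoc)
qed

lemma trig_poly_hartley: "trig_poly (\<lambda>x. c * hartley k x)"
  using trig_poly.add_hartley[OF trig_poly.zero, of c k] by simp

lemma trig_poly_cos: "trig_poly (\<lambda>x. c * cos (of_int k * x))"
  and trig_poly_sin: "trig_poly (\<lambda>x. c * sin (of_int k * x))"
proof -
  have "c * cos (of_int k * x) = (c * sqrt (2*pi) / 2) * hartley k x + (c * sqrt (2*pi) / 2) * hartley (-k) x"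
       "c * sin (of_int k * x) = (c * sqrt (2*pi) / 2) * hartley k x + (- c * sqrt (2*pi) / 2) * hartley (-k) x" for x
    by (simp_all add: hartley_def field_simps)
  then show "trig_poly (\<lambda>x. c * cos (of_int k * x))" "trig_poly (\<lambda>x. c * sin (of_int k * x))"
    by (simp_all only:) (intro trig_poly_add trig_poly_hartley)+
qed

lemma trig_poly_mult_hartley: assumes "trig_poly f" shows "trig_poly (\<lambda>x. f x * (c * hartley l x))"
  using assms
proof induction
  case zero
  then show ?case by (simp add: trig_poly.zero)
next
  case (add_hartley f b k)
  have "(f x + b * hartley k x) * (c * hartley l x) = f x * (c * hartley l x)
     + (b * c / (2 * pi) * cos (of_int (k - l) * x) + b * c / (2 * pi) * sin (of_int (k + l) * x))" for x
  proof -
    have "(b * hartley k x) * (c * hartley l x) = b * c * (hartley k x * hartley l x)" by simp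
    also have "\<dots> = b * c / (2 * pi) * cos (of_int (k - l) * x) + b * c / (2 * pi) * sin (of_int (k + l) * x)"
      unfolding hartley_mult by (simp add: field_simps)
    finally show ?thesis by (simp add: distrib_right)
  qed
  then show ?case
    by (simp only:) (intro trig_poly_add add_hartley trig_poly_sin trig_poly_cos)
qed

lemma trig_poly_mult: assumes "trig_poly f" "trig_poly g" shows "trig_poly (\<lambda>x. f x * g x)"
  using assms(2)
proof induction
  case zero
  then show ?case by (simp add: trig_poly.zero)
next
  case (add_hartley g c k)
  then show ?case
    using trig_poly_add[OF add_hartley(2) trig_poly_mult_hartley[OF assms(1)]] by (simp add: distrib_left)
qed

lemma trig_poly_continuous: "trig_poly f \<Longrightarrow> continuous_on UNIV f"
  by (induction rule: trig_poly.induct) (intro continuous_intros | assumption)+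

lemma cis_fibre:
  assumes "x \<in> {-pi..pi}" "y \<in> {-pi..pi}" "cis x = cis y"
  shows "x = y \<or> {x, y} = {-pi, pi}"
proof -
  have c: "cos x = cos y" and s: "sin x = sin y" using assms(3) by (auto simp: complex_eq_iff)
  have "cos \<bar>x\<bar> = cos \<bar>y\<bar>" using c by (simp add: abs_if)
  then have "\<bar>x\<bar> = \<bar>y\<bar>" using assms(1,2) by (intro cos_inj_pi[OF _ _ _ _ \<open>cos \<bar>x\<bar> = cos \<bar>y\<bar>\<close>]) auto
  then consider "x = y" | "x = - y" by linarith
  then show ?thesis
  proof cases
    case 2
    then have "sin y = 0" using s by simp
    then have "sin \<bar>y\<bar> = 0" by (simp add: abs_if)
    then have "\<bar>y\<bar> = 0 \<or> \<bar>y\<bar> = pi"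
      using sin_gt_zero[of "\<bar>y\<bar>"] assms(2) by (cases "y \<ge> 0"; simp; linarith)
    then show ?thesis using 2 by auto
  qed auto
qed

text \<open>The map \<open>cis\<close> identifies the end points of the period, so it is a quotient map onto the unit
circle and \<open>f\<close> factors through it. On the circle the trigonometric polynomials contain the
coordinate functions and therefore separate points.\<close>

lemma trig_poly_dense:
  assumes "continuous_on {-pi..pi} f" "f (-pi) = f pi" "e > 0"
  obtains g where "trig_poly g" "\<And>x. x \<in> {-pi..pi} \<Longrightarrow> \<bar>f x - g x\<bar> < e"
proof -
  let ?C = "sphere 0 1 :: complex set"
  have q: "quotient_map (top_of_set {-pi..pi}) (top_of_set ?C) cis"
  proof (rule T1_Spaces.continuous_imp_quotient_map)
    show "continuous_map (top_of_set {- pi..pi}) (top_of_set ?C) cis"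
      by (auto simp: continuous_map_in_subtopology intro!: continuous_intros)
    show "cis ` topspace (top_of_set {- pi..pi}) = topspace (top_of_set ?C)"
    proof -
      have "z \<in> cis ` {-pi..pi}" if "norm z = 1" for z
      proof -
        have "z \<noteq> 0" using that by auto
        then have "cis (Arg z) = z" using cis_Arg[of z] that by (simp add: sgn_div_norm)
        then show ?thesis using Arg_bounded[of z] by (metis atLeastAtMost_iff image_eqI less_eq_real_def)
      qed
      then show ?thesis by auto
    qed
  qed (auto simp: compact_space_subtopology Hausdorff_space_subtopology)
  have "continuous_map (top_of_set {- pi..pi}) euclideanreal f" using assms(1) by simp
  moreover have "f x = f y" if "x \<in> topspace (top_of_set {-pi..pi})" "y \<in> topspace (top_of_set {-pi..pi})"
      "cis x = cis y" for x y
    using cis_fibre[of x y] that assms(2) by (auto simp: doubleton_eq_iff)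
  ultimately have "\<exists>F. continuous_map (top_of_set ?C) euclideanreal F \<and>
      (\<forall>x\<in>topspace (top_of_set {-pi..pi}). F (cis x) = f x)"
    by (rule quotient_map_lift_exists[OF q]) blast+
  then obtain F where F: "continuous_map (top_of_set ?C) euclideanreal F"
      "\<And>x. x \<in> topspace (top_of_set {-pi..pi}) \<Longrightarrow> F (cis x) = f x"
    by blast
  let ?P = "\<lambda>G. continuous_on ?C G \<and> trig_poly (\<lambda>x. G (cis x))"
  have "\<exists>G. ?P G \<and> (\<forall>z\<in>?C. \<bar>F z - G z\<bar> < e)"
  proof (rule Stone_Weierstrass_HOL)
    show "?P (\<lambda>z. c)" for c
      using trig_poly_cos[of c 0] by simp
    show "\<exists>f. ?P f \<and> f x \<noteq> f y" if "x \<in> ?C \<and> y \<in> ?C \<and> x \<noteq> y" for x y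
    proof -
      have "?P Re" "?P Im"
        using trig_poly_cos[of 1 1] trig_poly_sin[of 1 1] by (auto intro!: continuous_intros)
      moreover have "Re x \<noteq> Re y \<or> Im x \<noteq> Im y" using that by (auto simp: complex_eq_iff)
      ultimately show ?thesis by blast
    qed
  qed (use F assms(3) in \<open>auto intro!: continuous_intros trig_poly_add trig_poly_mult\<close>)
  then obtain G where G: "trig_poly (\<lambda>x. G (cis x))" "\<And>z. norm z = 1 \<Longrightarrow> \<bar>F z - G z\<bar> < e"
    by auto
  show ?thesis
  proof (rule that[OF G(1)])
    show "\<bar>f x - G (cis x)\<bar> < e" if "x \<in> {-pi..pi}" for x
      using G(2)[of "cis x"] F(2)[of x] that by simp
  qed
qed

text \<open>An L2 function on a bounded interval is integrable, so uniform approximation of \<open>f\<close> by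
trigonometric polynomials suffices.\<close>

lemma orthogonal_continuous:
  assumes "sq_integrable g" "\<And>k. ip g (hartley k) = 0" "continuous_on {-pi..pi} f" "f (-pi) = f pi"
    and [measurable]: "f \<in> borel_measurable borel"
  shows "(\<integral>x. g x * f x \<partial>torus) = 0"
proof -
  define C where "C = (\<integral>x. \<bar>g x\<bar> \<partial>torus)"
  have C: "C \<ge> 0" by (simp add: C_def)
  have gi: "integrable torus g" using assms(1) by (rule sq_integrable_integrable)
  obtain B where "\<forall>x\<in>{-pi..pi}. \<bar>f x\<bar> \<le> B"
    using compact_imp_bounded[OF compact_continuous_image[OF assms(3)]]
    unfolding bounded_iff by auto
  then have B: "\<bar>f x\<bar> \<le> B" if "x \<in> {-pi..pi}" for x using that by blast
  have "sq_integrable f" unfolding sq_integrable_def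
  proof (intro conjI integrable_torus_bounded[where B = "B\<^sup>2"])
    show "\<bar>(f x)\<^sup>2\<bar> \<le> B\<^sup>2" if "x \<in> {-pi..pi}" for x
      using power_mono[OF B[OF that], of 2] by simp
  qed measurable
  have *: "\<bar>ip g f\<bar> \<le> e * C" if "e > 0" for e
  proof -
    obtain t where t: "trig_poly t" "\<And>x. x \<in> {-pi..pi} \<Longrightarrow> \<bar>f x - t x\<bar> < e"
      using trig_poly_dense[OF assms(3,4) \<open>e > 0\<close>] by blast
    have "sq_integrable t" by (intro sq_integrable_continuous trig_poly_continuous t)
    have "ip g t = 0" using t(1)
    proof induction
      case (add_hartley f c k)
      have "sq_integrable f" by (intro sq_integrable_continuous trig_poly_continuous add_hartley)
      have "ip g (\<lambda>x. f x + c * hartley k x) = ip (\<lambda>x. f x + c * hartley k x) g" by (rule ip_commute)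
      also have "\<dots> = ip f g + c * ip (hartley k) g"
        using \<open>sq_integrable f\<close> assms(1) by (simp add: ip_add_left sq_integrable_cmult sq_integrable_hartley ip_cmult_left)
      finally show ?case using add_hartley assms(2)[of k] by (simp add: ip_commute[of f] ip_commute[of "hartley k"])
    qed simp
    then have "\<bar>ip g f\<bar> = \<bar>ip g (\<lambda>x. f x - t x)\<bar>"
      using \<open>sq_integrable t\<close> \<open>sq_integrable f\<close> assms(1) by (simp add: ip_diff_right)
    also have "\<dots> \<le> (\<integral>x. \<bar>g x * (f x - t x)\<bar> \<partial>torus)"
      unfolding ip_def by (rule integral_abs_bound)
    also have "\<dots> \<le> (\<integral>x. e * \<bar>g x\<bar> \<partial>torus)"
    proof (rule integral_mono)
      show "integrable torus (\<lambda>x. \<bar>g x * (f x - t x)\<bar>)"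
        using sq_integrable_mult_integrable[OF assms(1) sq_integrable_diff[OF \<open>sq_integrable f\<close> \<open>sq_integrable t\<close>]] by simp
      show "integrable torus (\<lambda>x. e * \<bar>g x\<bar>)" using gi by simp
      show "\<bar>g x * (f x - t x)\<bar> \<le> e * \<bar>g x\<bar>" if "x \<in> space torus" for x
        using mult_left_mono[of "\<bar>f x - t x\<bar>" e "\<bar>g x\<bar>"] t(2)[of x] that by (auto simp: abs_mult mult.commute)
    qed
    also have "\<dots> = e * C" by (simp add: C_def)
    finally show ?thesis by simp
  qed
  then have "\<bar>ip g f\<bar> \<le> 0 + e" if "e > 0" for e
  proof -
    have "\<bar>ip g f\<bar> \<le> 0 + e / (C + 1) * C" using *[of "e / (C + 1)"] that C by simp
    also have "e / (C + 1) * C \<le> e" using that C by (simp add: field_simps)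
    finally show ?thesis by simp
  qed
  then have "\<bar>ip g f\<bar> \<le> 0" by (rule field_le_epsilon)
  then show ?thesis by (simp add: ip_def)
qed

lemma periodic_range:
  assumes "\<And>x::real. f (x + 2 * pi) = f x"
  shows "\<exists>y\<in>{-pi..pi}. f y = f x"
proof -
  interpret periodic_fun_simple f "2 * pi" by unfold_locales (rule assms)
  define n where "n = \<lfloor>(x + pi) / (2 * pi)\<rfloor>"
  have "of_int n \<le> (x + pi) / (2 * pi)" "(x + pi) / (2 * pi) < of_int n + 1"
    unfolding n_def by linarith+
  then have "x - of_int n * (2 * pi) \<in> {-pi..pi}" by (auto simp: field_simps)
  moreover have "f (x - of_int n * (2 * pi)) = f x" by (rule minus_of_int)
  ultimately show ?thesis by blast
qed

lemma continuous_coef_zero: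
  assumes "continuous_on UNIV f" "\<And>x. f (x + 2 * pi) = f x" "\<And>k. ip f (hartley k) = 0"
  shows "f x = 0"
proof -
  have per: "f (-pi) = f pi" using assms(2)[of "-pi"] by simp
  have "(\<integral>x. f x * f x \<partial>torus) = 0"
    using assms per by (intro orthogonal_continuous)
      (auto intro: sq_integrable_continuous continuous_on_subset borel_measurable_continuous_onI)
  then have 0: "integral (cbox (-pi) pi) (\<lambda>x. f x * f x) = 0"
    by (subst (asm) integral_torus_eq_HK) (auto intro!: continuous_intros assms)
  have *: "f x = 0" if "x \<in> {-pi..pi}" for x
  proof -
    have "f x * f x = 0"
      using that 0
      by (intro integral_eq_0_iff[THEN iffD1, rule_format, of "-pi" pi "\<lambda>x. f x * f x", unfolded box_real])
         (auto intro!: continuous_intros continuous_on_subset[OF assms(1)])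
    then show ?thesis by simp
  qed
  obtain y where "y \<in> {-pi..pi}" "f y = f x" using periodic_range[of f x] assms(2) by blast
  then show ?thesis using *[of y] by simp
qed

text \<open>The function \<open>sgn g\<close> is an almost everywhere limit of continuous functions. After clamping to
\<open>[-1, 1]\<close> and cutting off near the end points of the period these are admissible in
\<open>orthogonal_continuous\<close>, and in the limit the integral of \<open>|g|\<close> vanishes.\<close>

lemma L2_complete:
  assumes "sq_integrable g" "\<And>k. ip g (hartley k) = 0"
  shows "AE x in torus. g x = 0"
proof -
  have [measurable]: "g \<in> borel_measurable borel" using assms by auto
  have gi: "integrable torus g" using assms(1) by (rule sq_integrable_integrable)
  have "(\<lambda>x. sgn (g x)) \<in> borel_measurable borel" by measurable
  then have "(\<lambda>x. sgn (g x)) \<in> borel_measurable lebesgue"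
    by (intro measurable_completion) simp
  then have "(\<lambda>x. sgn (g x)) measurable_on UNIV"
    by (intro lebesgue_measurable_imp_measurable_on_real) auto
  then obtain N \<phi> where N: "negligible N" "\<And>n::nat. continuous_on UNIV (\<phi> n)"
      "\<And>x. x \<notin> N \<Longrightarrow> (\<lambda>n. \<phi> n x) \<longlonglongrightarrow> sgn (g x)"
    unfolding measurable_on_def by auto
  define \<psi> where "\<psi> n x = max (-1) (min 1 (\<phi> n x)) * max 0 (min 1 (real n * (pi - \<bar>x\<bar>)))" for n x
  have \<psi>_cont: "continuous_on A (\<psi> n)" for n A
    unfolding \<psi>_def using continuous_on_subset[OF N(2) subset_UNIV]
    by (intro continuous_intros)
  have [measurable]: "\<psi> n \<in> borel_measurable borel" for n
    by (intro borel_measurable_continuous_onI \<psi>_cont)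
  have \<psi>_le: "\<bar>\<psi> n x\<bar> \<le> 1" for n x
  proof -
    have "\<bar>max (-1) (min 1 (\<phi> n x))\<bar> \<le> 1" "\<bar>max 0 (min 1 (real n * (pi - \<bar>x\<bar>)))\<bar> \<le> 1" by auto
    then show ?thesis unfolding \<psi>_def abs_mult by (intro mult_le_one) auto
  qed
  have \<psi>_lim: "(\<lambda>n. \<psi> n x) \<longlonglongrightarrow> sgn (g x)" if "x \<notin> N" "\<bar>x\<bar> < pi" for x
  proof -
    have "(\<lambda>n. max (-1) (min 1 (\<phi> n x))) \<longlonglongrightarrow> max (-1) (min 1 (sgn (g x)))"
      using N(3)[OF that(1)] by (intro tendsto_intros)
    also have "max (-1) (min 1 (sgn (g x))) = sgn (g x)" by (simp add: sgn_if)
    finally have 1: "(\<lambda>n. max (-1) (min 1 (\<phi> n x))) \<longlonglongrightarrow> sgn (g x)" .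
    have "max 0 (min 1 (real n * (pi - \<bar>x\<bar>))) = 1" if "n \<ge> nat \<lceil>1 / (pi - \<bar>x\<bar>)\<rceil>" for n
    proof -
      have "1 / (pi - \<bar>x\<bar>) \<le> real n" using that by linarith
      then have "1 \<le> real n * (pi - \<bar>x\<bar>)" using \<open>\<bar>x\<bar> < pi\<close> by (simp add: field_simps)
      then show ?thesis by simp
    qed
    then have 2: "(\<lambda>n. max 0 (min 1 (real n * (pi - \<bar>x\<bar>)))) \<longlonglongrightarrow> 1"
      by (intro tendsto_eventually eventually_sequentiallyI)
    show ?thesis unfolding \<psi>_def using tendsto_mult[OF 1 2] by simp
  qed
  have N_AE: "AE x in torus. x \<notin> N \<and> \<bar>x\<bar> < pi"
  proof -
    have "negligible (N \<union> {-pi, pi})" using N(1) by simp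
    then have "AE x in lebesgue. x \<notin> N \<union> {-pi, pi}"
      by (intro AE_not_in) (simp add: negligible_iff_null_sets)
    then have "AE x in lborel. x \<notin> N \<union> {-pi, pi}" by (simp only: AE_completion_iff)
    then have "AE x in lborel. x \<in> {-pi..pi} \<longrightarrow> x \<notin> N \<and> \<bar>x\<bar> < pi"
      by (rule eventually_mono) auto
    then show ?thesis unfolding torus_def
      by (subst AE_restrict_space_iff) simp_all
  qed
  have "(\<lambda>n. \<integral>x. g x * \<psi> n x \<partial>torus) \<longlonglongrightarrow> (\<integral>x. g x * sgn (g x) \<partial>torus)"
  proof (rule integral_dominated_convergence)
    show "integrable torus (\<lambda>x. \<bar>g x\<bar>)" using gi by simp
    show "AE x in torus. (\<lambda>n. g x * \<psi> n x) \<longlonglongrightarrow> g x * sgn (g x)"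
      using N_AE by eventually_elim (intro tendsto_intros \<psi>_lim, auto)
    show "AE x in torus. norm (g x * \<psi> n x) \<le> \<bar>g x\<bar>" for n
      using mult_left_mono[OF \<psi>_le[of n], of "\<bar>g _\<bar>"] by (intro AE_I2) (auto simp: abs_mult)
  qed measurable
  moreover have "(\<integral>x. g x * \<psi> n x \<partial>torus) = 0" for n
  proof (rule orthogonal_continuous[OF assms \<psi>_cont])
    show "\<psi> n (-pi) = \<psi> n pi" by (simp add: \<psi>_def)
  qed measurable
  ultimately have "(\<integral>x. g x * sgn (g x) \<partial>torus) = 0"
    by (simp add: LIMSEQ_const_iff)
  then have "(\<integral>x. \<bar>g x\<bar> \<partial>torus) = 0" by (simp add: abs_sgn)
  then have "AE x in torus. \<bar>g x\<bar> = 0"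
    using gi by (subst (asm) integral_nonneg_eq_0_iff_AE) auto
  then show ?thesis by simp
qed

lemma ip_eq_of_coef_eq:
  assumes "sq_integrable f" "sq_integrable g" "\<And>k. ip f (hartley k) = ip g (hartley k)"
  shows "ip f f = ip g g"
proof -
  have "AE x in torus. f x - g x = 0"
    by (rule L2_complete) (use assms in \<open>auto intro!: sq_integrable_diff simp: ip_diff_left sq_integrable_hartley\<close>)
  then show ?thesis
    unfolding ip_def using assms(1,2) by (intro integral_cong_AE) (auto elim!: eventually_mono)
qed

section \<open>Absolutely convergent Hartley series\<close>

lemma summable_weight: "(\<lambda>k::int. 1 / (1 + (of_int k)\<^sup>2) :: real) summable_on UNIV"
proof -
  have s: "summable (\<lambda>n. 1 / (1 + (real n)\<^sup>2))"
  proof (rule summable_comparison_test')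
    show "summable (\<lambda>n. inverse ((real n)\<^sup>2))" using inverse_power_summable[of 2] by simp
    show "norm (1 / (1 + (real n)\<^sup>2)) \<le> inverse ((real n)\<^sup>2)" if "n \<ge> 1" for n
      using that by (simp add: inverse_eq_divide frac_le)
  qed
  have 1: "(\<lambda>n. 1 / (1 + (real n)\<^sup>2)) summable_on UNIV"
    using s by (intro norm_summable_imp_summable_on) simp
  have 2: "(\<lambda>k::int. 1 / (1 + (of_int k)\<^sup>2) :: real) summable_on range int"
    using 1 by (subst summable_on_reindex) (auto simp: o_def)
  have "(\<lambda>k::int. 1 / (1 + (of_int k)\<^sup>2) :: real) summable_on range (\<lambda>n. - int n)"
    using 1 by (subst summable_on_reindex) (auto simp: o_def inj_on_def)
  then have 3: "(\<lambda>k::int. 1 / (1 + (of_int k)\<^sup>2) :: real) summable_on {..<0}"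
  proof (rule summable_on_subset_banach)
    show "{..<0} \<subseteq> range (\<lambda>n. - int n)"
    proof
      fix k :: int assume "k \<in> {..<0}"
      then have "k = - int (nat (- k))" by simp
      then show "k \<in> range (\<lambda>n. - int n)" by blast
    qed
  qed
  have 4: "(\<lambda>k::int. 1 / (1 + (of_int k)\<^sup>2) :: real) summable_on {0..}"
    using 2
  proof (rule summable_on_subset_banach)
    show "{0..} \<subseteq> range int"
    proof
      fix k :: int assume "k \<in> {0..}"
      then have "k = int (nat k)" by simp
      then show "k \<in> range int" by blast
    qed
  qed
  have "(\<lambda>k::int. 1 / (1 + (of_int k)\<^sup>2) :: real) summable_on {0..} \<union> {..<0}"
    by (rule summable_on_Un_disjoint[OF 4 3]) auto
  moreover have "{0..} \<union> {..<0::int} = UNIV" by auto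
  ultimately show ?thesis by simp
qed

definition weight_sum :: real where "weight_sum = (\<Sum>\<^sub>\<infinity>k::int. 1 / (1 + (of_int k)\<^sup>2))"

lemma sum_weight_le: "finite F \<Longrightarrow> (\<Sum>k\<in>F. 1 / (1 + (of_int k)\<^sup>2)) \<le> weight_sum"
  unfolding weight_sum_def by (rule finite_sum_le_infsum[OF summable_weight]) auto

lemma weight_sum_nonneg: "weight_sum \<ge> 0" using sum_weight_le[of "{}"] by simp

definition l1 :: "(int \<Rightarrow> real) \<Rightarrow> bool" where
  "l1 c \<longleftrightarrow> (\<lambda>k. \<bar>c k\<bar>) summable_on UNIV"

definition hseries :: "(int \<Rightarrow> real) \<Rightarrow> real \<Rightarrow> real" where
  "hseries c x = (\<Sum>\<^sub>\<infinity>k. c k * hartley k x)"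

text \<open>Differentiation on the level of coefficients: the derivative of the series of \<open>c\<close> is the
series of \<open>D c\<close>.\<close>

definition D :: "(int \<Rightarrow> real) \<Rightarrow> int \<Rightarrow> real" where
  "D c k = - of_int k * c (- k)"

lemma abs_hartley_mult_le: "\<bar>c * hartley k x\<bar> \<le> \<bar>c\<bar>"
  using mult_left_mono[OF abs_hartley_le, of "\<bar>c\<bar>"] by (simp add: abs_mult)

lemma l1_comparison:
  assumes "g summable_on UNIV" "\<And>k. \<bar>c k\<bar> \<le> g k"
  shows "l1 c"
  unfolding l1_def by (rule summable_on_comparison_test[OF assms(1)]) (use assms(2) in auto)

lemma hseries_summable: "l1 c \<Longrightarrow> (\<lambda>k. c k * hartley k x) summable_on UNIV"
  unfolding l1_def
  by (rule abs_summable_summable, rule summable_on_comparison_test) (auto simp: abs_hartley_mult_le)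

text \<open>Dominated convergence for sums, along an arbitrary filter. Restricting the bound to a set
\<open>S\<close> allows limits at points of a time interval.\<close>

lemma infsum_tannery:
  fixes a :: "'k \<Rightarrow> 'p \<Rightarrow> real"
  assumes lim: "\<And>k. ((\<lambda>p. a k p) \<longlongrightarrow> b k) F" and bd: "\<And>k p. p \<in> S \<Longrightarrow> \<bar>a k p\<bar> \<le> M k"
    and ev: "eventually (\<lambda>p. p \<in> S) F" and M: "M summable_on UNIV"
  shows "((\<lambda>p. \<Sum>\<^sub>\<infinity>k. a k p) \<longlongrightarrow> (\<Sum>\<^sub>\<infinity>k. b k)) F"
proof (cases "F = bot")
  case False
  have bM: "\<bar>b k\<bar> \<le> M k" for k
    by (rule tendsto_upperbound[OF tendsto_rabs[OF lim] _ False])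
       (rule eventually_mono[OF ev], rule bd)
  have "(\<lambda>k. \<bar>b k\<bar>) summable_on UNIV"
    by (rule summable_on_comparison_test[OF M]) (use bM in auto)
  then have b: "b summable_on UNIV" using abs_summable_summable[of b UNIV] by simp
  show ?thesis
  proof (rule tendstoI)
    fix e :: real assume "e > 0"
    have u: "uniform_limit S (\<lambda>X p. \<Sum>k\<in>X. a k p) (\<lambda>p. \<Sum>\<^sub>\<infinity>k. a k p) (finite_subsets_at_top UNIV)"
      by (rule Weierstrass_m_test_general[OF _ M]) (use bd in auto)
    have "((\<lambda>X. \<Sum>k\<in>X. b k) \<longlongrightarrow> (\<Sum>\<^sub>\<infinity>k. b k)) (finite_subsets_at_top UNIV)"
      using has_sum_infsum[OF b] by (simp add: has_sum_def)
    then have "\<forall>\<^sub>F X in finite_subsets_at_top UNIV. dist (\<Sum>k\<in>X. b k) (\<Sum>\<^sub>\<infinity>k. b k) < e / 3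
        \<and> (\<forall>p\<in>S. dist (\<Sum>k\<in>X. a k p) (\<Sum>\<^sub>\<infinity>k. a k p) < e / 3)"
      using \<open>e > 0\<close> by (intro eventually_conj uniform_limitD[OF u] tendstoD) auto
    then obtain X where X: "dist (\<Sum>k\<in>X. b k) (\<Sum>\<^sub>\<infinity>k. b k) < e / 3"
        "\<And>p. p \<in> S \<Longrightarrow> dist (\<Sum>k\<in>X. a k p) (\<Sum>\<^sub>\<infinity>k. a k p) < e / 3"
      using eventually_happens'[OF finite_subsets_at_top_neq_bot] by blast
    have "((\<lambda>p. \<Sum>k\<in>X. a k p) \<longlongrightarrow> (\<Sum>k\<in>X. b k)) F" by (intro tendsto_sum lim)
    then have "\<forall>\<^sub>F p in F. dist (\<Sum>k\<in>X. a k p) (\<Sum>k\<in>X. b k) < e / 3"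
      using \<open>e > 0\<close> by (intro tendstoD) auto
    then show "\<forall>\<^sub>F p in F. dist (\<Sum>\<^sub>\<infinity>k. a k p) (\<Sum>\<^sub>\<infinity>k. b k) < e"
      using ev by eventually_elim (use X in \<open>force simp: dist_real_def abs_if split: if_splits\<close>)
  qed
qed simp

lemma hseries_tendsto:
  assumes "\<And>k. ((\<lambda>p. c p k) \<longlongrightarrow> d k) F" "(X \<longlongrightarrow> x) F" "\<And>p k. p \<in> S \<Longrightarrow> \<bar>c p k\<bar> \<le> M k"
    "eventually (\<lambda>p. p \<in> S) F" "M summable_on UNIV"
  shows "((\<lambda>p. hseries (c p) (X p)) \<longlongrightarrow> hseries d x) F"
  unfolding hseries_def
proof (rule infsum_tannery)
  have "isCont (hartley k) x" for k by (rule DERIV_isCont[OF hartley_deriv])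
  then show "((\<lambda>p. c p k * hartley k (X p)) \<longlongrightarrow> d k * hartley k x) F" for k
    by (intro tendsto_mult assms(1) isCont_tendsto_compose[OF _ assms(2)])
  show "\<bar>c p k * hartley k (X p)\<bar> \<le> M k" if "p \<in> S" for k p
    using abs_hartley_mult_le assms(3)[OF that] by (rule order_trans)
qed (use assms in auto)

lemma continuous_on_hseries: assumes "l1 c" shows "continuous_on A (hseries c)"
  unfolding continuous_on_def
  by (intro ballI hseries_tendsto[where S = UNIV and M = "\<lambda>k. \<bar>c k\<bar>"]) (use assms in \<open>auto simp: l1_def\<close>)

lemma sq_integrable_hseries: "l1 c \<Longrightarrow> sq_integrable (hseries c)" by (intro sq_integrable_continuous continuous_on_hseries)

lemma hseries_periodic: "hseries c (x + 2 * pi) = hseries c x"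
  by (simp add: hseries_def hartley_periodic)

lemma abs_hseries_le:
  assumes "l1 c" "\<And>F. finite F \<Longrightarrow> (\<Sum>k\<in>F. \<bar>c k\<bar>) \<le> B"
  shows "\<bar>hseries c x\<bar> \<le> B"
proof -
  have s: "(\<lambda>k. \<bar>c k * hartley k x\<bar>) summable_on UNIV"
    by (rule summable_on_comparison_test[OF assms(1)[unfolded l1_def]]) (auto simp: abs_hartley_mult_le)
  have "\<bar>hseries c x\<bar> \<le> (\<Sum>\<^sub>\<infinity>k. \<bar>c k * hartley k x\<bar>)"
    unfolding hseries_def using norm_infsum_bound[of "\<lambda>k. c k * hartley k x" UNIV] s by simp
  also have "\<dots> \<le> B"
    by (rule infsum_le_finite_sums[OF s])
       (rule order_trans[OF sum_mono assms(2)], auto simp: abs_hartley_mult_le)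
  finally show ?thesis .
qed

lemma hseries_diff: assumes "l1 c" "l1 d" shows "hseries (\<lambda>k. c k - d k) x = hseries c x - hseries d x"
proof -
  have "(\<lambda>k. d k * hartley k x * (-1)) summable_on UNIV"
    by (intro summable_on_cmult_left hseries_summable assms)
  then have "(\<Sum>\<^sub>\<infinity>k. c k * hartley k x + d k * hartley k x * (-1)) = hseries c x + (\<Sum>\<^sub>\<infinity>k. d k * hartley k x * (-1))"
    unfolding hseries_def by (intro infsum_add hseries_summable assms)
  also have "(\<Sum>\<^sub>\<infinity>k. d k * hartley k x * (-1)) = hseries d x * (-1)"
    unfolding hseries_def by (rule infsum_cmult_left) (use hseries_summable assms in auto)
  finally show ?thesis by (simp add: hseries_def algebra_simps)
qed

lemma l1_diff: assumes "l1 c" "l1 d" shows "l1 (\<lambda>k. c k - d k)"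
proof (rule l1_comparison)
  show "(\<lambda>k. \<bar>c k\<bar> + \<bar>d k\<bar>) summable_on UNIV"
    using assms unfolding l1_def by (rule summable_on_add)
qed auto

lemma hseries_finite: assumes "finite S" "\<And>k. k \<notin> S \<Longrightarrow> c k = 0" shows "hseries c x = trig_sum S c x"
proof -
  have "hseries c x = (\<Sum>\<^sub>\<infinity>k\<in>S. c k * hartley k x)"
    unfolding hseries_def by (rule infsum_cong_neutral) (use assms in auto)
  then show ?thesis using assms(1) by (simp add: trig_sum_def)
qed

lemma l1_finite: assumes "finite S" "\<And>k. k \<notin> S \<Longrightarrow> c k = 0" shows "l1 c"
  unfolding l1_def
  by (rule summable_on_cong_neutral[THEN iffD1, OF _ _ _ summable_on_finite[OF assms(1)]]) (use assms in auto)

lemma filterlim_modes: "filterlim modes (finite_subsets_at_top UNIV) sequentially"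
  unfolding filterlim_finite_subsets_at_top
proof (intro allI impI, elim conjE)
  fix X :: "int set" assume X: "finite X"
  obtain m where m: "X \<subseteq> modes m" using finite_subset_modes[OF X] .
  show "\<forall>\<^sub>F n in sequentially. finite (modes n) \<and> X \<subseteq> modes n \<and> modes n \<subseteq> UNIV"
  proof (rule eventually_sequentiallyI)
    fix n assume "m \<le> n"
    with m modes_mono show "finite (modes n) \<and> X \<subseteq> modes n \<and> modes n \<subseteq> UNIV" by blast
  qed
qed

lemma uniform_limit_trig_sum: assumes "l1 c" shows "uniform_limit UNIV (\<lambda>n. trig_sum (modes n) c) (hseries c) sequentially"
proof -
  have "uniform_limit UNIV (\<lambda>X x. \<Sum>k\<in>X. c k * hartley k x) (\<lambda>x. \<Sum>\<^sub>\<infinity>k. c k * hartley k x) (finite_subsets_at_top UNIV)"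
    by (rule Weierstrass_m_test_general[OF _ assms[unfolded l1_def]]) (auto simp: abs_hartley_mult_le)
  then show ?thesis
    unfolding hseries_def[abs_def] trig_sum_def[abs_def]
    by (rule filterlim_compose[OF _ filterlim_modes])
qed

lemma trig_sum_deriv: "(trig_sum (modes n) c has_real_derivative trig_sum (modes n) (D c) x) (at x)"
proof -
  have "(trig_sum (modes n) c has_real_derivative (\<Sum>k\<in>modes n. c k * (of_int k * hartley (-k) x))) (at x)"
    unfolding trig_sum_def[abs_def] by (intro DERIV_sum DERIV_cmult hartley_deriv)
  also have "(\<Sum>k\<in>modes n. c k * (of_int k * hartley (-k) x)) = trig_sum (modes n) (D c) x"
    unfolding trig_sum_def by (rule sum.reindex_bij_witness[of _ uminus uminus]) (auto simp: D_def)
  finally show ?thesis .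
qed

text \<open>The partial sums and their derivatives converge uniformly.\<close>

lemma hseries_deriv:
  assumes "l1 c" "l1 (D c)"
  shows "(hseries c has_real_derivative hseries (D c) x) (at x)"
proof -
  have u: "uniform_limit UNIV (\<lambda>n. trig_sum (modes n) (D c)) (hseries (D c)) sequentially"
    by (rule uniform_limit_trig_sum[OF assms(2)])
  have lim: "(\<lambda>n. trig_sum (modes n) c y) \<longlonglongrightarrow> hseries c y" for y
    using uniform_limit_trig_sum[OF assms(1)] by (rule tendsto_uniform_limitI) simp
  have "\<exists>g. \<forall>x\<in>UNIV. (\<lambda>n. trig_sum (modes n) c x) \<longlonglongrightarrow> g x \<and> (g has_derivative (\<lambda>y. hseries (D c) x * y)) (at x within UNIV)"
  proof (rule has_derivative_sequence[where ?x0.0 = 0 and f' = "\<lambda>n x y. trig_sum (modes n) (D c) x * y"])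
    show "(trig_sum (modes n) c has_derivative (*) (trig_sum (modes n) (D c) x)) (at x within UNIV)" for n x
      using trig_sum_deriv[of n c x] by (simp add: has_field_derivative_def)
    show "\<forall>\<^sub>F n in sequentially. \<forall>x\<in>UNIV. \<forall>y. norm (trig_sum (modes n) (D c) x * y - hseries (D c) x * y) \<le> e * norm y"
      if "e > 0" for e
      using uniform_limitD[OF u that]
    proof eventually_elim
      case (elim n)
      have "norm (trig_sum (modes n) (D c) x * y - hseries (D c) x * y) \<le> e * norm y" for x y
      proof -
        have "norm (trig_sum (modes n) (D c) x * y - hseries (D c) x * y) = \<bar>trig_sum (modes n) (D c) x - hseries (D c) x\<bar> * \<bar>y\<bar>"
          by (simp add: abs_mult flip: left_diff_distrib)
        also have "\<dots> \<le> e * \<bar>y\<bar>"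
          using elim by (intro mult_right_mono) (auto simp: dist_real_def intro: less_imp_le)
        finally show ?thesis by simp
      qed
      then show ?case by blast
    qed
  qed (use lim in auto)
  then obtain g where g: "\<And>x. (\<lambda>n. trig_sum (modes n) c x) \<longlonglongrightarrow> g x" "\<And>x. (g has_real_derivative hseries (D c) x) (at x)"
    by (auto simp: has_field_derivative_def)
  have "g = hseries c" using LIMSEQ_unique[OF g(1) lim] by auto
  with g(2) show ?thesis by simp
qed

lemma ip_hseries_hartley: assumes "l1 c" shows "ip (hseries c) (hartley k) = c k"
proof -
  have "(\<lambda>n. ip (trig_sum (modes n) c) (hartley k)) \<longlonglongrightarrow> ip (hseries c) (hartley k)"
    unfolding ip_def
  proof (rule integral_dominated_convergence)
    show "integrable torus (\<lambda>x. (\<Sum>\<^sub>\<infinity>k. \<bar>c k\<bar>))" by simp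
    show "AE x in torus. (\<lambda>n. trig_sum (modes n) c x * hartley k x) \<longlonglongrightarrow> hseries c x * hartley k x"
      by (intro AE_I2 tendsto_intros tendsto_uniform_limitI[OF uniform_limit_trig_sum[OF assms]]) auto
    show "AE x in torus. norm (trig_sum (modes n) c x * hartley k x) \<le> (\<Sum>\<^sub>\<infinity>k. \<bar>c k\<bar>)" for n
    proof (rule AE_I2)
      fix x
      have "norm (trig_sum (modes n) c x * hartley k x) \<le> \<bar>trig_sum (modes n) c x\<bar>" using abs_hartley_mult_le by simp
      also have "\<dots> \<le> (\<Sum>k\<in>modes n. \<bar>c k\<bar>)"
        unfolding trig_sum_def by (rule order_trans[OF sum_abs sum_mono]) (rule abs_hartley_mult_le)
      also have "\<dots> \<le> (\<Sum>\<^sub>\<infinity>k. \<bar>c k\<bar>)"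
        using assms unfolding l1_def by (intro finite_sum_le_infsum) auto
      finally show "norm (trig_sum (modes n) c x * hartley k x) \<le> (\<Sum>\<^sub>\<infinity>k. \<bar>c k\<bar>)" .
    qed
  next
    have [measurable]: "hseries c \<in> borel_measurable borel" using sq_integrable_hseries[OF assms] by auto
    show "(\<lambda>x. hseries c x * hartley k x) \<in> borel_measurable torus" by measurable
  qed measurable
  moreover have "(\<lambda>n. ip (trig_sum (modes n) c) (hartley k)) \<longlonglongrightarrow> c k"
    by (rule tendsto_eventually, rule eventually_sequentiallyI[of "nat \<bar>k\<bar>"]) (auto simp: ip_trig_sum_hartley)
  ultimately show ?thesis by (rule LIMSEQ_unique)
qed

lemma hseries_ip_eq:
  assumes "continuous_on UNIV f" "\<And>x. f (x + 2 * pi) = f x" "l1 (\<lambda>k. ip f (hartley k))"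
  shows "f x = hseries (\<lambda>k. ip f (hartley k)) x"
proof -
  let ?g = "\<lambda>x. f x - hseries (\<lambda>k. ip f (hartley k)) x"
  have "?g x = 0"
  proof (rule continuous_coef_zero[of ?g])
    show "continuous_on UNIV ?g" by (intro continuous_intros assms continuous_on_hseries)
    show "?g (x + 2 * pi) = ?g x" for x by (simp only: assms(2) hseries_periodic)
    show "ip ?g (hartley k) = 0" for k
      using assms by (simp add: ip_diff_left sq_integrable_continuous sq_integrable_hseries sq_integrable_hartley ip_hseries_hartley)
  qed
  then show ?thesis by simp
qed

section \<open>The space H3 in terms of Hartley coefficients\<close>

text \<open>Up to constant factors, a bound of the squared H3 norm. Quantifying over finite sets avoids any separate statement of
summability, and the bound passes to coefficientwise limits.\<close>

definition h3_ball :: "real \<Rightarrow> (int \<Rightarrow> real) \<Rightarrow> bool" where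
  "h3_ball K c \<longleftrightarrow> (\<forall>F. finite F \<longrightarrow> (\<Sum>k\<in>F. (1 + of_int k ^ 6) * (c k)\<^sup>2) \<le> K)"

lemma h3_ballD: "h3_ball K c \<Longrightarrow> finite F \<Longrightarrow> (\<Sum>k\<in>F. (1 + of_int k ^ 6) * (c k)\<^sup>2) \<le> K"
  by (simp add: h3_ball_def)

lemma h3_ball_mono: "h3_ball K c \<Longrightarrow> K \<le> L \<Longrightarrow> h3_ball L c"
  unfolding h3_ball_def by (meson order_trans)

lemma h3_ball_nonneg: "h3_ball K c \<Longrightarrow> K \<ge> 0"
  using h3_ballD[of K c "{}"] by simp

lemma h3_ball_diff: assumes "h3_ball K c" "h3_ball L d" shows "h3_ball (2 * (K + L)) (\<lambda>k. c k - d k)"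
  unfolding h3_ball_def
proof (intro allI impI)
  fix F :: "int set" assume F: "finite F"
  have "(\<Sum>k\<in>F. (1 + of_int k ^ 6) * (c k - d k)\<^sup>2)
     \<le> (\<Sum>k\<in>F. 2 * ((1 + of_int k ^ 6) * (c k)\<^sup>2) + 2 * ((1 + of_int k ^ 6) * (d k)\<^sup>2))"
  proof (rule sum_mono)
    fix k
    have "(c k - d k)\<^sup>2 \<le> 2 * (c k)\<^sup>2 + 2 * (d k)\<^sup>2"
      using zero_le_power2[of "c k + d k"] by (simp add: power2_sum power2_diff)
    then have "(1 + real_of_int k ^ 6) * (c k - d k)\<^sup>2 \<le> (1 + of_int k ^ 6) * (2 * (c k)\<^sup>2 + 2 * (d k)\<^sup>2)"
      by (intro mult_left_mono) auto
    then show "(1 + real_of_int k ^ 6) * (c k - d k)\<^sup>2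
      \<le> 2 * ((1 + of_int k ^ 6) * (c k)\<^sup>2) + 2 * ((1 + of_int k ^ 6) * (d k)\<^sup>2)"
      by (simp add: algebra_simps)
  qed
  also have "\<dots> = 2 * (\<Sum>k\<in>F. (1 + of_int k ^ 6) * (c k)\<^sup>2) + 2 * (\<Sum>k\<in>F. (1 + of_int k ^ 6) * (d k)\<^sup>2)"
    by (simp add: sum.distrib sum_distrib_left)
  also have "\<dots> \<le> 2 * (K + L)"
    using h3_ballD[OF assms(1) F] h3_ballD[OF assms(2) F] by simp
  finally show "(\<Sum>k\<in>F. (1 + of_int k ^ 6) * (c k - d k)\<^sup>2) \<le> 2 * (K + L)" .
qed

lemma int_abs_cases: fixes k :: int obtains "k = 0" | "1 \<le> \<bar>real_of_int k\<bar>"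
  by linarith

text \<open>For \<open>|k| \<ge> 1\<close> the left-hand side times \<open>1 + k\<^sup>2\<close> is at most
\<open>(2 |k|)^4 * 2 k\<^sup>2 = 32 k^6\<close>.\<close>

lemma weight_bound4: "(1 + \<bar>real_of_int k\<bar>)^4 \<le> 32 * (1 + of_int k ^ 6) / (1 + (of_int k)\<^sup>2)"
proof -
  define a where "a = \<bar>real_of_int k\<bar>"
  have "(1 + a)^4 * (1 + a\<^sup>2) \<le> 32 * (1 + a^6)"
  proof (cases k rule: int_abs_cases)
    case 1 then show ?thesis by (simp add: a_def)
  next
    case 2
    then have a: "1 \<le> a" by (simp add: a_def)
    have "(1 + a)^4 * (1 + a\<^sup>2) \<le> (2 * a)^4 * (2 * a\<^sup>2)"
      using a by (intro mult_mono power_mono) (auto simp: one_le_power)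
    also have "\<dots> = 32 * a^6" by (simp add: power_mult_distrib)
    finally show ?thesis by simp
  qed
  moreover have "a^6 = of_int k ^ 6" "a\<^sup>2 = (of_int k)\<^sup>2" by (simp_all add: a_def power_even_abs)
  moreover have "1 + (real_of_int k)\<^sup>2 > 0" by (simp add: add_pos_nonneg)
  ultimately show ?thesis unfolding a_def[symmetric] by (simp add: field_simps)
qed

definition sup_const :: real where "sup_const = sqrt (32 * weight_sum)"

lemma sup_const_nonneg: "sup_const \<ge> 0" by (simp add: sup_const_def weight_sum_nonneg)

text \<open>Cauchy and Schwarz with the weights \<open>1 + k^6\<close>: the quotient of the weights is summable because
in one dimension H3 has half a derivative to spare over C2.\<close>

lemma h3_ball_sum:
  assumes "h3_ball K c" "finite F"
  shows "(\<Sum>k\<in>F. (1 + \<bar>of_int k\<bar>)\<^sup>2 * \<bar>c k\<bar>) \<le> sup_const * sqrt K"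
proof -
  let ?w = "\<lambda>k::int. sqrt (1 + of_int k ^ 6) :: real"
  have pos: "?w k > 0" for k by (simp add: add_pos_nonneg)
  have "(\<Sum>k\<in>F. (1 + \<bar>of_int k\<bar>)\<^sup>2 * \<bar>c k\<bar>)\<^sup>2
      = (\<Sum>k\<in>F. ((1 + \<bar>of_int k\<bar>)\<^sup>2 / ?w k) * (?w k * \<bar>c k\<bar>))\<^sup>2"
  proof -
    have "(1 + \<bar>of_int k\<bar>)\<^sup>2 * \<bar>c k\<bar> = ((1 + \<bar>of_int k\<bar>)\<^sup>2 / ?w k) * (?w k * \<bar>c k\<bar>)" for k
      using pos[of k] by simp
    then show ?thesis by presburger
  qed
  also have "\<dots> \<le> (\<Sum>k\<in>F. ((1 + \<bar>of_int k\<bar>)\<^sup>2 / ?w k)\<^sup>2) * (\<Sum>k\<in>F. (?w k * \<bar>c k\<bar>)\<^sup>2)"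
    by (rule Cauchy_Schwarz_ineq_sum)
  also have "\<dots> \<le> (32 * weight_sum) * K"
  proof (rule mult_mono)
    have "(\<Sum>k\<in>F. ((1 + \<bar>real_of_int k\<bar>)\<^sup>2 / ?w k)\<^sup>2) \<le> (\<Sum>k\<in>F. 32 * (1 / (1 + (of_int k)\<^sup>2)))"
    proof (rule sum_mono)
      fix k
      have "((1 + \<bar>real_of_int k\<bar>)\<^sup>2 / ?w k)\<^sup>2 = (1 + \<bar>real_of_int k\<bar>)^4 / (1 + of_int k ^ 6)"
        by (simp add: power_divide add_nonneg_nonneg flip: power_mult)
      also have "\<dots> \<le> 32 * (1 + of_int k ^ 6) / (1 + (of_int k)\<^sup>2) / (1 + of_int k ^ 6)"
        by (intro divide_right_mono weight_bound4) (simp add: add_nonneg_nonneg)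
      also have "\<dots> = 32 * (1 / (1 + (of_int k)\<^sup>2))"
      proof -
        have "1 + real_of_int k ^ 6 \<noteq> 0" using pos[of k] by auto
        moreover have "32 * p / q / p = 32 * (1 / q)" if "p \<noteq> 0" for p q :: real using that by simp
        ultimately show ?thesis by blast
      qed
      finally show "((1 + \<bar>real_of_int k\<bar>)\<^sup>2 / ?w k)\<^sup>2 \<le> 32 * (1 / (1 + (of_int k)\<^sup>2))" .
    qed
    then show "(\<Sum>k\<in>F. ((1 + \<bar>of_int k\<bar>)\<^sup>2 / ?w k)\<^sup>2) \<le> 32 * weight_sum"
      using sum_weight_le[OF assms(2)] unfolding sum_distrib_left[symmetric] by linarith
    show "(\<Sum>k\<in>F. (?w k * \<bar>c k\<bar>)\<^sup>2) \<le> K"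
      using h3_ballD[OF assms] by (simp add: power_mult_distrib add_nonneg_nonneg)
  qed (auto intro!: sum_nonneg simp: weight_sum_nonneg)
  finally have "(\<Sum>k\<in>F. (1 + \<bar>of_int k\<bar>)\<^sup>2 * \<bar>c k\<bar>) \<le> sqrt ((32 * weight_sum) * K)"
    by (rule real_le_rsqrt)
  then show ?thesis by (simp add: sup_const_def real_sqrt_mult)
qed

lemma D_D: "D (D c) k = - (of_int k)\<^sup>2 * c k"
  by (simp add: D_def power2_eq_square)

lemma D_diff: "D (\<lambda>k. c k - d k) = (\<lambda>k. D c k - D d k)"
  by (simp add: D_def fun_eq_iff algebra_simps)

lemma sum_uminus: "(\<Sum>k\<in>F. g (- k)) = (\<Sum>k\<in>uminus ` F. g (k::int))"
  by (simp add: sum.reindex inj_on_def)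

lemma h3_ball_sums:
  assumes "h3_ball K c" "finite F"
  shows "(\<Sum>k\<in>F. \<bar>c k\<bar>) \<le> sup_const * sqrt K"
    and "(\<Sum>k\<in>F. \<bar>D c k\<bar>) \<le> sup_const * sqrt K"
    and "(\<Sum>k\<in>F. \<bar>D (D c) k\<bar>) \<le> sup_const * sqrt K"
proof -
  have le: "1 \<le> (1 + a)\<^sup>2" "a \<le> (1 + a)\<^sup>2" "a\<^sup>2 \<le> (1 + a)\<^sup>2" if "a \<ge> 0" for a :: real
    using that by (auto simp: power2_sum)
  have "(\<Sum>k\<in>F. \<bar>c k\<bar>) \<le> (\<Sum>k\<in>F. (1 + \<bar>of_int k\<bar>)\<^sup>2 * \<bar>c k\<bar>)"
    using mult_right_mono[OF le(1)[OF abs_ge_zero], of "\<bar>c _\<bar>"] by (intro sum_mono) simp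
  then show "(\<Sum>k\<in>F. \<bar>c k\<bar>) \<le> sup_const * sqrt K" using h3_ball_sum[OF assms] by simp
  have "(\<Sum>k\<in>F. \<bar>D c k\<bar>) = (\<Sum>k\<in>F. \<bar>of_int (- k)\<bar> * \<bar>c (- k)\<bar>)"
    by (simp add: D_def abs_mult)
  also have "\<dots> = (\<Sum>k\<in>uminus ` F. \<bar>of_int k\<bar> * \<bar>c k\<bar>)" by (rule sum_uminus)
  also have "\<dots> \<le> (\<Sum>k\<in>uminus ` F. (1 + \<bar>of_int k\<bar>)\<^sup>2 * \<bar>c k\<bar>)"
    using le(2) by (intro sum_mono mult_right_mono) auto
  also have "\<dots> \<le> sup_const * sqrt K" using assms by (intro h3_ball_sum) auto
  finally show "(\<Sum>k\<in>F. \<bar>D c k\<bar>) \<le> sup_const * sqrt K" .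
  have "(\<Sum>k\<in>F. \<bar>D (D c) k\<bar>) = (\<Sum>k\<in>F. \<bar>of_int k\<bar>\<^sup>2 * \<bar>c k\<bar>)"
    by (simp add: D_D abs_mult)
  also have "\<dots> \<le> (\<Sum>k\<in>F. (1 + \<bar>of_int k\<bar>)\<^sup>2 * \<bar>c k\<bar>)"
    by (intro sum_mono mult_right_mono le(3)) auto
  finally show "(\<Sum>k\<in>F. \<bar>D (D c) k\<bar>) \<le> sup_const * sqrt K" using h3_ball_sum[OF assms] by simp
qed

lemma l1_of_bounded:
  assumes "\<And>F. finite F \<Longrightarrow> (\<Sum>k\<in>F. \<bar>c k\<bar>) \<le> B" shows "l1 c"
  unfolding l1_def by (rule nonneg_bdd_above_summable_on) (auto intro!: bdd_aboveI2 assms)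

lemma h3_ball_l1:
  assumes "h3_ball K c" shows "l1 c" "l1 (D c)" "l1 (D (D c))"
  using h3_ball_sums[OF assms] by (auto intro: l1_of_bounded)

lemma h3_ball_hseries_le:
  assumes "h3_ball K c"
  shows "\<bar>hseries c x\<bar> \<le> sup_const * sqrt K" "\<bar>hseries (D c) x\<bar> \<le> sup_const * sqrt K" "\<bar>hseries (D (D c)) x\<bar> \<le> sup_const * sqrt K"
  using h3_ball_sums[OF assms] h3_ball_l1[OF assms] by (auto intro: abs_hseries_le)

lemma h3_ball_deriv:
  assumes "h3_ball K c"
  shows "(hseries c has_real_derivative hseries (D c) x) (at x)"
    "(hseries (D c) has_real_derivative hseries (D (D c)) x) (at x)"
  using h3_ball_l1[OF assms] by (auto intro: hseries_deriv)

subsection \<open>Weak derivatives\<close>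

lemma torus_test_functionD:
  assumes "torus_test_function \<phi>"
  shows "((deriv ^^ j) \<phi> has_real_derivative (deriv ^^ Suc j) \<phi> x) (at x)"
    and "(deriv ^^ j) \<phi> (x + 2 * pi) = (deriv ^^ j) \<phi> x"
    and "continuous_on A ((deriv ^^ j) \<phi>)"
proof -
  have d: "((deriv ^^ j) \<phi> has_real_derivative (deriv ^^ Suc j) \<phi> x) (at x)" for j x
    using assms unfolding torus_test_function_def
    by (auto simp: DERIV_deriv_iff_real_differentiable)
  show "((deriv ^^ j) \<phi> has_real_derivative (deriv ^^ Suc j) \<phi> x) (at x)" by (rule d)
  show "continuous_on A ((deriv ^^ j) \<phi>)"
    using d DERIV_isCont by (intro continuous_at_imp_continuous_on) blast
  show "(deriv ^^ j) \<phi> (x + 2 * pi) = (deriv ^^ j) \<phi> x"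
  proof (induction j arbitrary: x)
    case 0
    then show ?case using assms periodic_fun_simple.plus_period
      unfolding torus_test_function_def by fastforce
  next
    case (Suc j)
    have "((\<lambda>y. (deriv ^^ j) \<phi> (y + 2 * pi)) has_real_derivative (deriv ^^ Suc j) \<phi> (x + 2 * pi)) (at x)"
      using d[of j "x + 2 * pi"] by (simp only: DERIV_shift)
    then have "((deriv ^^ j) \<phi> has_real_derivative (deriv ^^ Suc j) \<phi> (x + 2 * pi)) (at x)"
      by (simp only: Suc)
    then show ?case using d DERIV_unique by blast
  qed
qed

lemma ip_deriv_parts:
  assumes "\<And>x. (f has_real_derivative f' x) (at x)" "\<And>x. (g has_real_derivative g' x) (at x)"
    "continuous_on UNIV f'" "continuous_on UNIV g'"
    "\<And>x. f (x + 2 * pi) = f x" "\<And>x. g (x + 2 * pi) = g x"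
  shows "ip f g' = - ip f' g"
proof -
  have c: "continuous_on UNIV f" "continuous_on UNIV g"
    by (auto intro!: continuous_at_imp_continuous_on DERIV_isCont[OF assms(1)] DERIV_isCont[OF assms(2)])
  have "(\<integral>x. f' x * g x + f x * g' x \<partial>torus) = 0"
    by (rule integral_torus_deriv_periodic[where F = "\<lambda>x. f x * g x"])
       (use assms(5)[of "-pi"] assms(6)[of "-pi"] in
        \<open>auto intro!: derivative_eq_intros assms(1,2) continuous_intros c assms(3,4)\<close>)
  moreover have "(\<integral>x. f' x * g x + f x * g' x \<partial>torus) = ip f' g + ip f g'"
    unfolding ip_def
    by (intro Bochner_Integration.integral_add integrable_torus_continuous continuous_intros c assms)
  ultimately show ?thesis by simp
qed

text \<open>The flux and its first two derivatives are not trigonometric polynomials; this determines the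
coefficients of their derivatives all the same.\<close>

lemma ip_deriv_hartley:
  assumes "\<And>x. (g has_real_derivative g' x) (at x)" "continuous_on UNIV g'" "\<And>x. g (x + 2 * pi) = g x"
  shows "ip g' (hartley k) = D (\<lambda>k. ip g (hartley k)) k"
proof -
  have "ip (hartley k) g' = - ip (\<lambda>x. of_int k * hartley (-k) x) g"
    by (rule ip_deriv_parts[OF hartley_deriv assms(1)])
       (auto intro!: continuous_intros assms hartley_periodic)
  then show ?thesis by (simp add: ip_cmult_left D_def ip_commute[of g'] ip_commute[of g])
qed

lemma trig_sum_periodic: "trig_sum S c (x + 2 * pi) = trig_sum S c x"
  by (simp add: trig_sum_def hartley_periodic)

lemma ip_trig_sum_test_deriv:
  assumes "torus_test_function \<phi>"
  shows "ip (trig_sum (modes n) c) ((deriv ^^ j) \<phi>) = (-1)^j * ip (trig_sum (modes n) ((D ^^ j) c)) \<phi>"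
proof (induction j arbitrary: c)
  case (Suc j)
  have "ip (trig_sum (modes n) c) ((deriv ^^ Suc j) \<phi>) = - ip (trig_sum (modes n) (D c)) ((deriv ^^ j) \<phi>)"
    by (rule ip_deriv_parts[OF trig_sum_deriv])
       (auto intro!: torus_test_functionD[OF assms] continuous_on_trig_sum trig_sum_periodic simp del: funpow.simps)
  then show ?case by (simp add: Suc funpow_swap1)
qed simp

lemma D_iter: "\<bar>(D ^^ j) c k\<bar> = \<bar>of_int k\<bar> ^ j * \<bar>c (if even j then k else - k)\<bar>"
proof (induction j arbitrary: k)
  case (Suc j)
  have "\<bar>(D ^^ Suc j) c k\<bar> = \<bar>of_int k\<bar> * \<bar>(D ^^ j) c (- k)\<bar>"
    by (simp add: D_def abs_mult)
  then show ?case by (simp add: Suc)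
qed simp

lemma pow_le_weight: "j \<le> 3 \<Longrightarrow> (\<bar>real_of_int k\<bar> ^ j)\<^sup>2 \<le> 1 + of_int k ^ 6"
proof (cases k rule: int_abs_cases)
  case 1 then show ?thesis by (cases j) auto
next
  case 2
  assume "j \<le> 3"
  then have "\<bar>real_of_int k\<bar> ^ j \<le> \<bar>real_of_int k\<bar> ^ 3" using 2 by (intro power_increasing) auto
  then have "(\<bar>real_of_int k\<bar> ^ j)\<^sup>2 \<le> (\<bar>real_of_int k\<bar> ^ 3)\<^sup>2" by (intro power_mono) auto
  also have "\<dots> = of_int k ^ 6" by (simp flip: power_mult add: power_even_abs)
  finally show ?thesis by simp
qed

lemma h3_ball_D_iter:
  assumes "h3_ball K c" "j \<le> 3" "finite F"
  shows "(\<Sum>k\<in>F. ((D ^^ j) c k)\<^sup>2) \<le> K"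
proof -
  define s where "s k = (if even j then k else - k)" for k :: int
  have "inj_on s F" by (auto simp: s_def inj_on_def)
  have "((D ^^ j) c k)\<^sup>2 \<le> (1 + of_int (s k) ^ 6) * (c (s k))\<^sup>2" for k
  proof -
    have "((D ^^ j) c k)\<^sup>2 = (\<bar>of_int k\<bar> ^ j)\<^sup>2 * (c (s k))\<^sup>2"
      using arg_cong[OF D_iter[of j c k], of "\<lambda>x. x\<^sup>2"] by (simp add: power_mult_distrib s_def)
    also have "\<dots> \<le> (1 + of_int k ^ 6) * (c (s k))\<^sup>2"
      by (intro mult_right_mono pow_le_weight assms(2)) auto
    finally show ?thesis by (cases "even j") (simp_all add: s_def)
  qed
  then have "(\<Sum>k\<in>F. ((D ^^ j) c k)\<^sup>2) \<le> (\<Sum>k\<in>F. (1 + of_int (s k) ^ 6) * (c (s k))\<^sup>2)"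
    by (rule sum_mono)
  also have "\<dots> = (\<Sum>k\<in>s ` F. (1 + of_int k ^ 6) * (c k)\<^sup>2)"
    using \<open>inj_on s F\<close> by (simp add: sum.reindex)
  also have "\<dots> \<le> K" using assms by (intro h3_ballD) auto
  finally show ?thesis .
qed

lemma is_weak_deriv_iff:
  "is_weak_deriv k f g \<longleftrightarrow> (\<forall>\<phi>. torus_test_function \<phi> \<longrightarrow> ip f ((deriv ^^ k) \<phi>) = (-1)^k * ip g \<phi>)"
  unfolding is_weak_deriv_def LBINT_eq_torus ip_def ..

text \<open>The function is provided by Riesz and Fischer. The defining identity of a weak derivative holds for
the partial sums by integration by parts and passes to the limit.\<close>

lemma hseries_weak_deriv:
  assumes c: "h3_ball K c" and j: "j \<le> 3"
  obtains G where "G \<in> L2_torus" "is_weak_deriv j (hseries c) G" "ip G G \<le> K"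
proof -
  obtain G where G: "G \<in> L2_torus" "ip G G \<le> K"
    "(\<lambda>n. ip (\<lambda>x. G x - trig_sum (modes n) ((D ^^ j) c) x) (\<lambda>x. G x - trig_sum (modes n) ((D ^^ j) c) x)) \<longlonglongrightarrow> 0"
    using Riesz_Fischer[OF h3_ball_D_iter[OF c j]] by blast
  have sG: "sq_integrable G" using G(1) by (simp add: L2_torus_iff)
  have "ip (hseries c) ((deriv ^^ j) \<phi>) = (-1)^j * ip G \<phi>" if \<phi>: "torus_test_function \<phi>" for \<phi>
  proof -
    have sphi: "sq_integrable ((deriv ^^ i) \<phi>)" for i by (intro sq_integrable_continuous torus_test_functionD \<phi>)
    have sphi0: "sq_integrable \<phi>" using sphi[of 0] by simp
    have 1: "(\<lambda>n. ip (trig_sum (modes n) ((D ^^ j) c)) \<phi>) \<longlonglongrightarrow> ip G \<phi>"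
    proof (rule LIM_zero_cancel, rule Lim_null_comparison)
      let ?r = "\<lambda>n x. G x - trig_sum (modes n) ((D ^^ j) c) x"
      show "\<forall>\<^sub>F n in sequentially. norm (ip (trig_sum (modes n) ((D ^^ j) c)) \<phi> - ip G \<phi>) \<le> sqrt (ip (?r n) (?r n)) * sqrt (ip \<phi> \<phi>)"
      proof (rule always_eventually, rule allI)
        fix n
        have "ip (?r n) \<phi> = ip G \<phi> - ip (trig_sum (modes n) ((D ^^ j) c)) \<phi>"
          by (intro ip_diff_left sG sq_integrable_trig_sum sphi0)
        moreover have "\<bar>ip (?r n) \<phi>\<bar> \<le> sqrt (ip (?r n) (?r n)) * sqrt (ip \<phi> \<phi>)"
          by (intro ip_Cauchy_Schwarz sq_integrable_diff sG sq_integrable_trig_sum sphi0)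
        ultimately show "norm (ip (trig_sum (modes n) ((D ^^ j) c)) \<phi> - ip G \<phi>) \<le> sqrt (ip (?r n) (?r n)) * sqrt (ip \<phi> \<phi>)"
          by simp
      qed
      have "(\<lambda>n. sqrt (ip (?r n) (?r n)) * sqrt (ip \<phi> \<phi>)) \<longlonglongrightarrow> sqrt 0 * sqrt (ip \<phi> \<phi>)"
        by (intro tendsto_intros G(3))
      then show "(\<lambda>n. sqrt (ip (?r n) (?r n)) * sqrt (ip \<phi> \<phi>)) \<longlonglongrightarrow> 0" by simp
    qed
    have 2: "(\<lambda>n. ip (trig_sum (modes n) c) ((deriv ^^ j) \<phi>)) \<longlonglongrightarrow> ip (hseries c) ((deriv ^^ j) \<phi>)"
      unfolding ip_def
    proof (rule integral_dominated_convergence)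
      have l: "l1 c" using h3_ball_l1[OF c] by simp
      have [measurable]: "(deriv ^^ j) \<phi> \<in> borel_measurable borel" "hseries c \<in> borel_measurable borel"
        using sphi sq_integrable_hseries[OF l] by blast+
      show "(\<lambda>x. hseries c x * (deriv ^^ j) \<phi> x) \<in> borel_measurable torus"
        "(\<lambda>x. trig_sum (modes n) c x * (deriv ^^ j) \<phi> x) \<in> borel_measurable torus" for n
        by measurable
      show "integrable torus (\<lambda>x. sup_const * sqrt K * \<bar>(deriv ^^ j) \<phi> x\<bar>)"
        using sq_integrable_integrable[OF sphi] by simp
      show "AE x in torus. (\<lambda>n. trig_sum (modes n) c x * (deriv ^^ j) \<phi> x) \<longlonglongrightarrow> hseries c x * (deriv ^^ j) \<phi> x"
        by (intro AE_I2 tendsto_intros tendsto_uniform_limitI[OF uniform_limit_trig_sum[OF l]]) auto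
      show "AE x in torus. norm (trig_sum (modes n) c x * (deriv ^^ j) \<phi> x) \<le> sup_const * sqrt K * \<bar>(deriv ^^ j) \<phi> x\<bar>" for n
      proof (rule AE_I2)
        fix x
        have "\<bar>trig_sum (modes n) c x\<bar> \<le> (\<Sum>k\<in>modes n. \<bar>c k\<bar>)"
          unfolding trig_sum_def by (rule order_trans[OF sum_abs sum_mono]) (rule abs_hartley_mult_le)
        also have "\<dots> \<le> sup_const * sqrt K" by (rule h3_ball_sums[OF c]) simp
        finally show "norm (trig_sum (modes n) c x * (deriv ^^ j) \<phi> x) \<le> sup_const * sqrt K * \<bar>(deriv ^^ j) \<phi> x\<bar>"
          by (simp add: abs_mult mult_right_mono)
      qed
    qed
    have "(\<lambda>n. (-1)^j * ip (trig_sum (modes n) ((D ^^ j) c)) \<phi>) \<longlonglongrightarrow> (-1)^j * ip G \<phi>"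
      by (intro tendsto_intros 1)
    then show ?thesis using 2 unfolding ip_trig_sum_test_deriv[OF \<phi>] by (rule LIMSEQ_unique[OF _ , rotated])
  qed
  then have "is_weak_deriv j (hseries c) G" by (simp add: is_weak_deriv_iff)
  with G show ?thesis using that by blast
qed

text \<open>All weak derivatives of the same order have the same coefficients, so the representative that
\<open>weak_deriv\<close> chooses does not influence the norm.\<close>

lemma weak_deriv_norm_unique:
  assumes "g \<in> L2_torus" "G \<in> L2_torus" "is_weak_deriv j f g" "is_weak_deriv j f G"
  shows "ip g g = ip G G"
proof (rule ip_eq_of_coef_eq)
  fix k
  have "(-1)^j * ip g (hartley k) = (-1)^j * ip G (hartley k)"
    using assms(3,4) test_function_hartley[of k] unfolding is_weak_deriv_iff by metis
  then show "ip g (hartley k) = ip G (hartley k)" by simp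
qed (use assms in \<open>auto simp: L2_torus_iff\<close>)

lemma weak_deriv_props:
  assumes "f \<in> sobolev_torus m" "j \<le> m"
  shows "weak_deriv j f \<in> L2_torus" "is_weak_deriv j f (weak_deriv j f)"
proof -
  have "\<exists>g. g \<in> L2_torus \<and> is_weak_deriv j f g" using assms by (auto simp: sobolev_torus_def)
  from someI_ex[OF this] show "weak_deriv j f \<in> L2_torus" "is_weak_deriv j f (weak_deriv j f)"
    by (simp_all add: weak_deriv_def)
qed

lemma H3_norm_sq:
  assumes "f \<in> H3_torus"
  shows "(H3_norm f)\<^sup>2 = (\<Sum>j\<le>3. ip (weak_deriv j f) (weak_deriv j f))"
proof -
  have "f \<in> sobolev_torus 3" using assms by (simp add: H3_torus_def)
  then have s: "sq_integrable (weak_deriv j f)" if "j \<le> 3" for j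
    using weak_deriv_props that by (auto simp: L2_torus_iff)
  have "(H3_norm f)\<^sup>2 = (\<Sum>j\<le>3. (L2_torus_norm (weak_deriv j f))\<^sup>2)"
    unfolding H3_norm_def sobolev_torus_norm_def by (simp add: sum_nonneg)
  also have "\<dots> = (\<Sum>j\<le>3. ip (weak_deriv j f) (weak_deriv j f))"
    by (intro sum.cong L2_torus_norm_sq s) auto
  finally show ?thesis .
qed

lemma H3_norm_nonneg: "H3_norm f \<ge> 0"
  by (simp add: H3_norm_def sobolev_torus_norm_def sum_nonneg)

lemma h3_ball_imp_H3:
  assumes "h3_ball K c"
  shows "hseries c \<in> H3_torus" "(H3_norm (hseries c))\<^sup>2 \<le> 4 * K"
proof -
  have l: "l1 c" using h3_ball_l1[OF assms] by simp
  have "hseries c \<in> L2_torus"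
    unfolding L2_torus_iff by (auto intro: sq_integrable_hseries[OF l] periodic_fun_simple.intro hseries_periodic)
  moreover have "\<exists>g\<in>L2_torus. is_weak_deriv j (hseries c) g" if "j \<le> 3" for j
    using hseries_weak_deriv[OF assms that] by blast
  ultimately have s: "hseries c \<in> sobolev_torus 3" by (auto simp: sobolev_torus_def)
  then show H: "hseries c \<in> H3_torus" by (simp add: H3_torus_def continuous_on_hseries[OF l])
  have "ip (weak_deriv j (hseries c)) (weak_deriv j (hseries c)) \<le> K" if "j \<le> 3" for j
  proof -
    obtain G where "G \<in> L2_torus" "is_weak_deriv j (hseries c) G" "ip G G \<le> K"
      by (rule hseries_weak_deriv[OF assms \<open>j \<le> 3\<close>])
    then show ?thesis
      using weak_deriv_norm_unique weak_deriv_props[OF s that] by metis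
  qed
  then have "(\<Sum>j\<le>3. ip (weak_deriv j (hseries c)) (weak_deriv j (hseries c))) \<le> (\<Sum>j\<le>(3::nat). K)"
    by (intro sum_mono) auto
  then show "(H3_norm (hseries c))\<^sup>2 \<le> 4 * K" by (simp add: H3_norm_sq[OF H])
qed

text \<open>Bessel for the zeroth and third weak derivatives. Since the coefficients are then absolutely summable,
the series and the continuous function \<open>f\<close> have the same coefficients and coincide.\<close>

lemma H3_imp_h3_ball:
  assumes "f \<in> H3_torus"
  shows "h3_ball ((H3_norm f)\<^sup>2) (\<lambda>k. ip f (hartley k))" "f = hseries (\<lambda>k. ip f (hartley k))"
proof -
  have s: "f \<in> sobolev_torus 3" using assms by (simp add: H3_torus_def)
  let ?g = "\<lambda>j. weak_deriv j f"
  have g: "sq_integrable (?g j)" if "j \<le> 3" for j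
    using weak_deriv_props(1)[OF s that] by (simp add: L2_torus_iff)
  have w: "ip f ((deriv ^^ j) (hartley k)) = (-1)^j * ip (?g j) (hartley k)" if "j \<le> 3" for j k
    using weak_deriv_props(2)[OF s that] test_function_hartley by (simp add: is_weak_deriv_iff)
  have c0: "ip (?g 0) (hartley k) = ip f (hartley k)" for k using w[of 0 k] by simp
  have c3: "ip (?g 3) (hartley k) = of_int k ^ 3 * ip f (hartley (-k))" for k
    using w[of 3 k] unfolding deriv_iter_hartley ip_cmult_right by (simp add: dsign_def)
  show B: "h3_ball ((H3_norm f)\<^sup>2) (\<lambda>k. ip f (hartley k))"
    unfolding h3_ball_def
  proof (intro allI impI)
    fix F :: "int set" assume F: "finite F"
    have "(\<Sum>k\<in>F. (1 + of_int k ^ 6) * (ip f (hartley k))\<^sup>2)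
        = (\<Sum>k\<in>F. (ip (?g 0) (hartley k))\<^sup>2) + (\<Sum>k\<in>F. (ip (?g 3) (hartley (-k)))\<^sup>2)"
      unfolding c0 c3 by (simp add: sum.distrib algebra_simps power_mult_distrib flip: power_mult)
    also have "(\<Sum>k\<in>F. (ip (?g 3) (hartley (-k)))\<^sup>2) = (\<Sum>k\<in>uminus ` F. (ip (?g 3) (hartley k))\<^sup>2)"
      by (rule sum_uminus)
    also have "(\<Sum>k\<in>F. (ip (?g 0) (hartley k))\<^sup>2) + \<dots> \<le> ip (?g 0) (?g 0) + ip (?g 3) (?g 3)"
      using F by (intro add_mono Bessel g) auto
    also have "\<dots> = (\<Sum>j\<in>{0,3}. ip (?g j) (?g j))" by simp
    also have "\<dots> \<le> (\<Sum>j\<le>3. ip (?g j) (?g j))"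
      by (rule sum_mono2) (auto simp: ip_self_nonneg)
    also have "\<dots> = (H3_norm f)\<^sup>2" by (simp add: H3_norm_sq[OF assms])
    finally show "(\<Sum>k\<in>F. (1 + of_int k ^ 6) * (ip f (hartley k))\<^sup>2) \<le> (H3_norm f)\<^sup>2" .
  qed
  have "continuous_on UNIV f" using assms by (simp add: H3_torus_def)
  moreover have "f (x + 2 * pi) = f x" for x
    using s periodic_fun_simple.plus_period by (fastforce simp: sobolev_torus_def L2_torus_iff)
  ultimately show "f = hseries (\<lambda>k. ip f (hartley k))"
    using hseries_ip_eq h3_ball_l1(1)[OF B] by blast
qed

section \<open>Ordinary differential equations with finitely many unknowns\<close>

lemma lipschitz_continuous_on:
  fixes f :: "(int \<Rightarrow> real) \<Rightarrow> real"
  assumes lip: "\<And>c d. \<bar>f c - f d\<bar> \<le> L * (\<Sum>j\<in>S. \<bar>c j - d j\<bar>)"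
    and y: "\<And>j. j \<in> S \<Longrightarrow> continuous_on I (\<lambda>t. y t j)"
  shows "continuous_on I (\<lambda>t. f (y t))"
  unfolding continuous_on_def
proof (intro ballI)
  fix t assume t: "t \<in> I"
  show "((\<lambda>s. f (y s)) \<longlongrightarrow> f (y t)) (at t within I)"
  proof (rule LIM_zero_cancel, rule Lim_null_comparison)
    show "\<forall>\<^sub>F s in at t within I. norm (f (y s) - f (y t)) \<le> L * (\<Sum>j\<in>S. \<bar>y s j - y t j\<bar>)"
      by (intro always_eventually allI) (use lip in simp)
    have "((\<lambda>s. L * (\<Sum>j\<in>S. \<bar>y s j - y t j\<bar>)) \<longlongrightarrow> L * (\<Sum>j\<in>S. \<bar>y t j - y t j\<bar>)) (at t within I)"
      by (intro tendsto_intros) (use y t in \<open>auto simp: continuous_on_def\<close>)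
    then show "((\<lambda>s. L * (\<Sum>j\<in>S. \<bar>y s j - y t j\<bar>)) \<longlongrightarrow> 0) (at t within I)" by simp
  qed
qed

text \<open>Picard iteration. The increments obey \<open>A (B t)^n / n!\<close>, so the iteration converges on the
whole interval. Working with families indexed by integers of which only those in \<open>S\<close> move allows
the dimension to vary, as it must in the Galerkin method.\<close>

lemma finite_system_ODE:
  fixes f :: "int \<Rightarrow> (int \<Rightarrow> real) \<Rightarrow> real"
  assumes S: "finite S" and L: "L \<ge> 0" and T: "T \<ge> 0"
    and lip: "\<And>k c d. \<bar>f k c - f k d\<bar> \<le> L * (\<Sum>j\<in>S. \<bar>c j - d j\<bar>)"
    and zero: "\<And>k c. k \<notin> S \<Longrightarrow> f k c = 0"
  obtains y where "y 0 = c0"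
    "\<And>k t. t \<in> {0..T} \<Longrightarrow> ((\<lambda>t. y t k) has_real_derivative f k (y t)) (at t within {0..T})"
proof -
  define x where "x = rec_nat (\<lambda>t::real. c0) (\<lambda>n xn t k. c0 k + integral {0..t} (\<lambda>s. f k (xn s)))"
  have x_0: "x 0 t = c0" for t by (simp add: x_def)
  have x_Suc: "x (Suc n) t k = c0 k + integral {0..t} (\<lambda>s. f k (x n s))" for n t k
    by (simp add: x_def)
  have cont_f: "continuous_on {0..T} (\<lambda>s. f k (y s))"
    if "\<And>j. continuous_on {0..T} (\<lambda>t. y t j)" for y k
    by (rule lipschitz_continuous_on[OF lip]) (rule that)
  have cont_x: "continuous_on {0..T} (\<lambda>t. x n t k)" for n k
  proof (induction n arbitrary: k)
    case (Suc n)
    have "(\<lambda>s. f k (x n s)) integrable_on {0..T}"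
      by (intro integrable_continuous_interval cont_f Suc)
    then show ?case unfolding x_Suc
      by (intro continuous_intros indefinite_integral_continuous_1)
  qed (simp add: x_0)
  have int_f: "(\<lambda>s. f k (x n s)) integrable_on {0..t}" if "t \<le> T" for k n t
    using that by (intro integrable_continuous_interval continuous_on_subset[OF cont_f[OF cont_x]]) auto
  define B where "B = L * real (card S)"
  have B: "B \<ge> 0" using L by (simp add: B_def)
  define A where "A = T * (\<Sum>j\<in>S. \<bar>f j c0\<bar>)"
  have A: "A \<ge> 0" using T by (simp add: A_def sum_nonneg)
  have step: "\<bar>x (Suc n) t k - x n t k\<bar> \<le> A * (B * t) ^ n / fact n" if "t \<in> {0..T}" for n t k
    using that
  proof (induction n arbitrary: t k)
    case 0
    have "x (Suc 0) t k - x 0 t k = t * f k c0" using 0 by (simp add: x_Suc x_0)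
    moreover have "\<bar>f k c0\<bar> \<le> (\<Sum>j\<in>S. \<bar>f j c0\<bar>)"
      by (cases "k \<in> S") (use S in \<open>auto simp: zero sum_nonneg intro: member_le_sum\<close>)
    ultimately show ?case using 0 by (simp add: abs_mult A_def mult_mono)
  next
    case (Suc n)
    have "x (Suc (Suc n)) t k - x (Suc n) t k = integral {0..t} (\<lambda>s. f k (x (Suc n) s) - f k (x n s))"
    proof -
      have "x (Suc (Suc n)) t k - x (Suc n) t k =
          integral {0..t} (\<lambda>s. f k (x (Suc n) s)) - integral {0..t} (\<lambda>s. f k (x n s))"
        using x_Suc[of "Suc n" t k] x_Suc[of n t k] by linarith
      also have "\<dots> = integral {0..t} (\<lambda>s. f k (x (Suc n) s) - f k (x n s))"
        by (rule Henstock_Kurzweil_Integration.integral_diff[symmetric]) (use Suc.prems int_f in auto)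
      finally show ?thesis .
    qed
    also have "\<bar>\<dots>\<bar> \<le> integral {0..t} (\<lambda>s. A * B * (B * s) ^ n / fact n)"
    proof (rule Henstock_Kurzweil_Integration.integral_norm_bound_integral[where 'a = real, unfolded real_norm_def])
      show "(\<lambda>s. f k (x (Suc n) s) - f k (x n s)) integrable_on {0..t}"
        using Suc.prems by (intro Henstock_Kurzweil_Integration.integrable_diff int_f) auto
      show "(\<lambda>s. A * B * (B * s) ^ n / fact n) integrable_on {0..t}"
        by (intro integrable_continuous_interval continuous_intros) auto
      fix s assume s: "s \<in> {0..t}"
      have "\<bar>f k (x (Suc n) s) - f k (x n s)\<bar> \<le> L * (\<Sum>j\<in>S. \<bar>x (Suc n) s j - x n s j\<bar>)" by (rule lip)
      also have "\<dots> \<le> L * (\<Sum>j\<in>S. A * (B * s) ^ n / fact n)"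
        using s Suc.prems L by (intro mult_left_mono sum_mono Suc.IH) auto
      also have "\<dots> = A * B * (B * s) ^ n / fact n" by (simp add: B_def)
      finally show "\<bar>f k (x (Suc n) s) - f k (x n s)\<bar> \<le> A * B * (B * s) ^ n / fact n" .
    qed
    also have "\<dots> = A * (B * t) ^ Suc n / fact (Suc n)"
    proof (rule integral_unique)
      have "((\<lambda>s. A * B * (B * s) ^ n / fact n) has_integral
          A * (B * t) ^ Suc n / fact (Suc n) - A * (B * 0) ^ Suc n / fact (Suc n)) {0..t}"
      proof (rule fundamental_theorem_of_calculus)
        fix s
        have "((\<lambda>s. B * s) has_real_derivative B) (at s within {0..t})"
          by (auto intro!: derivative_eq_intros)
        from DERIV_cdivide[OF DERIV_cmult[OF DERIV_power_Suc[OF this, of n], of A], of "fact (Suc n)"]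
        have "((\<lambda>s. A * (B * s) ^ Suc n / fact (Suc n)) has_real_derivative
            A * ((1 + real n) * (B * (B * s) ^ n)) / fact (Suc n)) (at s within {0..t})" .
        also have "A * ((1 + real n) * (B * (B * s) ^ n)) / fact (Suc n) = A * B * (B * s) ^ n / fact n"
        proof -
          have "fact (Suc n) = (1 + real n) * fact n" by (simp add: algebra_simps)
          moreover have "A * (p * Y) / (p * F) = A * Y / F" if "p \<noteq> 0" for p Y F :: real
            using that by simp
          moreover have "1 + real n \<noteq> 0" by linarith
          ultimately show ?thesis by (simp only: mult.assoc)
        qed
        finally show "((\<lambda>s. A * (B * s) ^ Suc n / fact (Suc n)) has_vector_derivative
            A * B * (B * s) ^ n / fact n) (at s within {0..t})"
          by (simp only: has_real_derivative_iff_has_vector_derivative)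
      qed (use Suc.prems in auto)
      then show "((\<lambda>s. A * B * (B * s) ^ n / fact n) has_integral A * (B * t) ^ Suc n / fact (Suc n)) {0..t}"
        by simp
    qed
    finally show ?case .
  qed
  define M where "M n = A * (B * T) ^ n / fact n" for n
  have M: "\<bar>x (Suc n) t k - x n t k\<bar> \<le> M n" if "t \<in> {0..T}" for n t k
  proof -
    have "\<bar>x (Suc n) t k - x n t k\<bar> \<le> A * (B * t) ^ n / fact n" using step that by blast
    also have "\<dots> \<le> M n" unfolding M_def
      using that A B by (intro divide_right_mono mult_left_mono power_mono) auto
    finally show ?thesis .
  qed
  have sM: "summable M"
    using summable_mult[OF summable_exp[of "B * T"], of A] by (simp add: M_def[abs_def] field_simps)
  define y where "y t k = c0 k + (\<Sum>n. x (Suc n) t k - x n t k)" for t k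
  have u: "uniform_limit {0..T} (\<lambda>n t. x n t k) (\<lambda>t. y t k) sequentially" for k
  proof -
    have "uniform_limit {0..T} (\<lambda>n t. \<Sum>i<n. x (Suc i) t k - x i t k)
        (\<lambda>t. \<Sum>i. x (Suc i) t k - x i t k) sequentially"
      by (rule Weierstrass_m_test[OF _ sM]) (use M in auto)
    moreover have "(\<Sum>i<n. x (Suc i) t k - x i t k) = x n t k - c0 k" for n t
      using sum_lessThan_telescope[of "\<lambda>n. x n t k" n] by (simp only: x_0)
    ultimately have "uniform_limit {0..T} (\<lambda>n t. c0 k + (x n t k - c0 k)) (\<lambda>t. y t k) sequentially"
      unfolding y_def by (intro uniform_limit_intros) simp
    then show ?thesis by simp
  qed
  have cont_y: "continuous_on {0..T} (\<lambda>t. y t k)" for k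
    by (rule uniform_limit_theorem[OF _ u]) (auto intro: always_eventually cont_x)
  have uf: "uniform_limit {0..T} (\<lambda>n s. f k (x n s)) (\<lambda>s. f k (y s)) sequentially" for k
  proof (rule uniform_limitI)
    fix e :: real assume e: "e > 0"
    define d where "d = e / (B + 1)"
    have d: "d > 0" "B * d < e" using e B by (auto simp: d_def field_simps)
    have "\<forall>\<^sub>F n in sequentially. \<forall>j\<in>S. \<forall>t\<in>{0..T}. dist (x n t j) (y t j) < d"
      using S d by (intro eventually_ball_finite ballI uniform_limitD[OF u]) auto
    then show "\<forall>\<^sub>F n in sequentially. \<forall>s\<in>{0..T}. dist (f k (x n s)) (f k (y s)) < e"
    proof eventually_elim
      case (elim n)
      show ?case
      proof
        fix s assume s: "s \<in> {0..T}"
        have "\<bar>f k (x n s) - f k (y s)\<bar> \<le> L * (\<Sum>j\<in>S. \<bar>x n s j - y s j\<bar>)" by (rule lip)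
        also have "\<dots> \<le> L * (\<Sum>j\<in>S. d)"
          using elim s L by (intro mult_left_mono sum_mono) (auto simp: dist_real_def intro: less_imp_le)
        also have "\<dots> = B * d" by (simp add: B_def)
        finally show "dist (f k (x n s)) (f k (y s)) < e" using d by (simp add: dist_real_def)
      qed
    qed
  qed
  have y_eq: "y t k = c0 k + integral {0..t} (\<lambda>s. f k (y s))" if t: "t \<in> {0..T}" for t k
  proof -
    have "uniform_limit {0..t} (\<lambda>n s. f k (x n s)) (\<lambda>s. f k (y s)) sequentially"
      using uf by (rule uniform_limit_on_subset) (use t in auto)
    moreover have "continuous_on {0..t} (\<lambda>s. f k (x n s))" for n
      by (rule continuous_on_subset[OF cont_f[OF cont_x]]) (use t in auto)
    ultimately obtain I J where I: "\<And>n. ((\<lambda>s. f k (x n s)) has_integral I n) {0..t}"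
        "((\<lambda>s. f k (y s)) has_integral J) {0..t}" "I \<longlonglongrightarrow> J"
      by (rule uniform_limit_integral) auto
    have "(\<lambda>n. x (Suc n) t k) \<longlonglongrightarrow> c0 k + J"
      unfolding x_Suc integral_unique[OF I(1)] by (intro tendsto_intros I)
    moreover have "(\<lambda>n. x (Suc n) t k) \<longlonglongrightarrow> y t k"
      by (rule LIMSEQ_Suc, rule tendsto_uniform_limitI[OF u]) (rule t)
    ultimately show ?thesis using LIMSEQ_unique integral_unique[OF I(2)] by blast
  qed
  show ?thesis
  proof (rule that)
    show "y 0 = c0" using y_eq[of 0] T by (auto simp: fun_eq_iff)
    fix k t assume t: "t \<in> {0..T}"
    have "((\<lambda>t. c0 k + integral {0..t} (\<lambda>s. f k (y s))) has_real_derivative 0 + f k (y t)) (at t within {0..T})"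
      by (intro DERIV_add DERIV_const integral_has_real_derivative cont_f cont_y t)
    then have "((\<lambda>t. c0 k + integral {0..t} (\<lambda>s. f k (y s))) has_real_derivative f k (y t)) (at t within {0..T})"
      by simp
    then show "((\<lambda>t. y t k) has_real_derivative f k (y t)) (at t within {0..T})"
      by (rule has_field_derivative_transform_within[OF _ zero_less_one t]) (simp add: y_eq)
  qed
qed

section \<open>The Galerkin system\<close>

text \<open>The cut-off at \<open>\<mu>\<close> makes \<open>flux\<close> globally Lipschitz, which gives the Galerkin
system solutions on any time interval.\<close>

definition flux :: "real \<Rightarrow> real \<Rightarrow> real \<Rightarrow> real" where
  "flux \<mu> a b = arctan (b / max a \<mu>)"

lemma arctan_lipschitz: "\<bar>arctan x - arctan y\<bar> \<le> \<bar>x - y\<bar>"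
proof -
  have "norm (arctan x - arctan y) \<le> 1 * norm (x - y)"
  proof (rule field_differentiable_bound[where S = UNIV])
    show "(arctan has_field_derivative inverse (1 + z\<^sup>2)) (at z within UNIV)" for z
      using DERIV_arctan by simp
    show "norm (inverse (1 + z\<^sup>2)) \<le> 1" for z :: real by (simp add: inverse_le_1_iff)
  qed auto
  then show ?thesis by simp
qed

text \<open>The derivative with respect to \<open>a\<close> is \<open>- b / (a\<^sup>2 + b\<^sup>2)\<close>, and
\<open>\<mu> |b| \<le> a\<^sup>2 + b\<^sup>2\<close>.\<close>

lemma arctan_recip_lipschitz:
  assumes "\<mu> > 0" "a \<ge> \<mu>" "a' \<ge> \<mu>"
  shows "\<bar>arctan (b / a) - arctan (b / a')\<bar> \<le> \<bar>a - a'\<bar> / \<mu>"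
proof -
  have "norm (arctan (b / a) - arctan (b / a')) \<le> (1 / \<mu>) * norm (a - a')"
  proof (rule field_differentiable_bound[where S = "{\<mu>..}"])
    fix z assume z: "z \<in> {\<mu>..}"
    then have z0: "z > 0" using assms by auto
    show "((\<lambda>z. arctan (b / z)) has_field_derivative (- b / (z\<^sup>2 + b\<^sup>2))) (at z within {\<mu>..})"
    proof -
      have "((\<lambda>z. b / z) has_field_derivative (- b / z\<^sup>2)) (at z within {\<mu>..})"
        using z0 by (auto intro!: derivative_eq_intros simp: power2_eq_square)
      then have "((\<lambda>z. arctan (b / z)) has_field_derivative (inverse (1 + (b / z)\<^sup>2) * (- b / z\<^sup>2))) (at z within {\<mu>..})"
        by (rule DERIV_chain2[OF DERIV_arctan])
      also have "inverse (1 + (b / z)\<^sup>2) * (- b / z\<^sup>2) = - b / (z\<^sup>2 + b\<^sup>2)"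
      proof -
        have "z\<^sup>2 + b\<^sup>2 > 0" using z0 by (simp add: add_pos_nonneg)
        moreover have "1 + (b / z)\<^sup>2 = (z\<^sup>2 + b\<^sup>2) / z\<^sup>2" using z0 by (simp add: field_simps)
        ultimately show ?thesis using z0 by simp
      qed
      finally show ?thesis .
    qed
    have "\<mu> * \<bar>b\<bar> \<le> z * \<bar>b\<bar>" using z by (intro mult_right_mono) auto
    also have "\<dots> \<le> z\<^sup>2 + b\<^sup>2"
    proof -
      have "0 \<le> (z - \<bar>b\<bar>)\<^sup>2" "0 \<le> z * \<bar>b\<bar>" using z0 by auto
      then show ?thesis by (simp add: power2_diff)
    qed
    finally show "norm (- b / (z\<^sup>2 + b\<^sup>2)) \<le> 1 / \<mu>"
      using assms z0 by (simp add: divide_simps abs_mult add_pos_nonneg mult.commute)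
  qed (use assms in auto)
  then show ?thesis by simp
qed

lemma flux_lipschitz:
  assumes "\<mu> > 0"
  shows "\<bar>flux \<mu> a b - flux \<mu> a' b'\<bar> \<le> (\<bar>a - a'\<bar> + \<bar>b - b'\<bar>) / \<mu>"
proof -
  have "\<bar>arctan (b / max a \<mu>) - arctan (b' / max a \<mu>)\<bar> \<le> \<bar>b / max a \<mu> - b' / max a \<mu>\<bar>"
    by (rule arctan_lipschitz)
  also have "\<dots> = \<bar>b - b'\<bar> / max a \<mu>" using assms by (simp add: diff_divide_distrib[symmetric])
  also have "\<dots> \<le> \<bar>b - b'\<bar> / \<mu>" using assms by (intro divide_left_mono) auto
  finally have 1: "\<bar>arctan (b / max a \<mu>) - arctan (b' / max a \<mu>)\<bar> \<le> \<bar>b - b'\<bar> / \<mu>" .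
  have "\<bar>arctan (b' / max a \<mu>) - arctan (b' / max a' \<mu>)\<bar> \<le> \<bar>max a \<mu> - max a' \<mu>\<bar> / \<mu>"
    by (rule arctan_recip_lipschitz) (use assms in auto)
  also have "\<dots> \<le> \<bar>a - a'\<bar> / \<mu>" using assms by (intro divide_right_mono) auto
  finally show ?thesis using 1 unfolding flux_def add_divide_distrib by linarith
qed

lemma continuous_on_flux:
  assumes "\<mu> > 0" "continuous_on A f" "continuous_on A g"
  shows "continuous_on A (\<lambda>x. flux \<mu> (f x) (g x))"
  unfolding flux_def using assms
  by (intro continuous_intros) (auto simp: max_def)

lemma abs_flux_le: "\<bar>flux \<mu> a b\<bar> \<le> 2"
  unfolding flux_def using arctan_lbound[of "b / max a \<mu>"] arctan_ubound[of "b / max a \<mu>"] pi_less_4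
  by linarith

text \<open>In terms of these coefficients the equation with the cut-off is \<open>c' = D (flux_coef \<mu> c)\<close>.\<close>

definition flux_coef :: "real \<Rightarrow> (int \<Rightarrow> real) \<Rightarrow> int \<Rightarrow> real" where
  "flux_coef \<mu> c k = ip (\<lambda>x. flux \<mu> (hseries c x) (hseries (D c) x)) (hartley k)"

text \<open>Since \<open>arctan\<close> is bounded, every single coefficient of a solution moves with a speed that is
bounded uniformly over all states \<open>c\<close>.\<close>

lemma abs_flux_coef_le:
  assumes "\<mu> > 0" "l1 c" "l1 (D c)"
  shows "\<bar>flux_coef \<mu> c k\<bar> \<le> 4 * pi"
proof -
  have c: "continuous_on UNIV (\<lambda>x. flux \<mu> (hseries c x) (hseries (D c) x) * hartley k x)"
    by (intro continuous_intros continuous_on_flux continuous_on_hseries assms)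
  have "\<bar>flux_coef \<mu> c k\<bar> \<le> (\<integral>x. \<bar>flux \<mu> (hseries c x) (hseries (D c) x) * hartley k x\<bar> \<partial>torus)"
    unfolding flux_coef_def ip_def by (rule integral_abs_bound)
  also have "\<dots> \<le> (\<integral>x. 2 \<partial>torus)"
    by (intro integral_mono integrable_abs integrable_torus_continuous[OF c])
       (auto intro: order_trans[OF abs_hartley_mult_le abs_flux_le])
  also have "\<dots> = 4 * pi" using measure_torus by simp
  finally show ?thesis .
qed

lemma galerkin_exists:
  assumes \<mu>: "\<mu> > 0" and T: "T \<ge> 0" and c0: "\<And>k. k \<notin> modes n \<Longrightarrow> c0 k = 0"
  obtains c where "c 0 = c0" "\<And>t k. t \<in> {0..T} \<Longrightarrow> k \<notin> modes n \<Longrightarrow> c t k = 0"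
    "\<And>t k. t \<in> {0..T} \<Longrightarrow> k \<in> modes n \<Longrightarrow>
       ((\<lambda>t. c t k) has_real_derivative D (flux_coef \<mu> (c t)) k) (at t within {0..T})"
proof -
  define P :: "(int \<Rightarrow> real) \<Rightarrow> int \<Rightarrow> real" where "P c k = (if k \<in> modes n then c k else 0)" for c k
  have P_l1: "l1 (P c)" "l1 (D (P c))" for c
    by (rule l1_finite[of "modes n"]; auto simp: P_def D_def)+
  define F where "F k c = (if k \<in> modes n then D (flux_coef \<mu> (P c)) k else 0)" for k c
  define K where "K = (1 + real n) / \<mu>"
  have K: "K \<ge> 0" using \<mu> by (simp add: K_def)
  have sup: "\<bar>flux \<mu> (hseries (P c) x) (hseries (D (P c)) x) - flux \<mu> (hseries (P d) x) (hseries (D (P d)) x)\<bar>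
      \<le> K * (\<Sum>j\<in>modes n. \<bar>c j - d j\<bar>)" for c d x
  proof -
    have e: "hseries (P c) x - hseries (P d) x = hseries (\<lambda>k. P c k - P d k) x"
        "hseries (D (P c)) x - hseries (D (P d)) x = hseries (D (\<lambda>k. P c k - P d k)) x"
      by (simp_all add: hseries_diff P_l1 D_diff)
    have 1: "\<bar>hseries (P c) x - hseries (P d) x\<bar> \<le> (\<Sum>j\<in>modes n. \<bar>c j - d j\<bar>)"
    proof -
      have t: "hseries (P c) x - hseries (P d) x = trig_sum (modes n) (\<lambda>k. P c k - P d k) x"
        unfolding e by (rule hseries_finite) (auto simp: P_def)
      show ?thesis unfolding t trig_sum_def
        by (rule order_trans[OF sum_abs sum_mono], rule order_trans[OF abs_hartley_mult_le]) (simp add: P_def)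
    qed
    have 2: "\<bar>hseries (D (P c)) x - hseries (D (P d)) x\<bar> \<le> real n * (\<Sum>j\<in>modes n. \<bar>c j - d j\<bar>)"
    proof -
      have t: "hseries (D (P c)) x - hseries (D (P d)) x = trig_sum (modes n) (D (\<lambda>k. P c k - P d k)) x"
        unfolding e by (rule hseries_finite) (auto simp: P_def D_def)
      have "\<bar>hseries (D (P c)) x - hseries (D (P d)) x\<bar> \<le> (\<Sum>k\<in>modes n. real n * \<bar>c (- k) - d (- k)\<bar>)" unfolding t trig_sum_def
        by (rule order_trans[OF sum_abs sum_mono], rule order_trans[OF abs_hartley_mult_le])
           (auto simp: P_def D_def abs_mult intro!: mult_right_mono)
      also have "\<dots> = real n * (\<Sum>k\<in>modes n. \<bar>c k - d k\<bar>)"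
        unfolding sum_distrib_left by (rule sum.reindex_bij_witness[of _ uminus uminus]) auto
      finally show ?thesis .
    qed
    have "\<bar>flux \<mu> (hseries (P c) x) (hseries (D (P c)) x) - flux \<mu> (hseries (P d) x) (hseries (D (P d)) x)\<bar>
        \<le> (\<bar>hseries (P c) x - hseries (P d) x\<bar> + \<bar>hseries (D (P c)) x - hseries (D (P d)) x\<bar>) / \<mu>"
      by (rule flux_lipschitz[OF \<mu>])
    also have "\<dots> \<le> ((\<Sum>j\<in>modes n. \<bar>c j - d j\<bar>) + real n * (\<Sum>j\<in>modes n. \<bar>c j - d j\<bar>)) / \<mu>"
      using 1 2 \<mu> by (intro divide_right_mono) auto
    finally show ?thesis by (simp add: K_def algebra_simps)
  qed
  have lip_flux_coef: "\<bar>flux_coef \<mu> (P c) k - flux_coef \<mu> (P d) k\<bar> \<le> 2 * pi * K * (\<Sum>j\<in>modes n. \<bar>c j - d j\<bar>)" for c d k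
  proof -
    let ?g = "\<lambda>c x. flux \<mu> (hseries (P c) x) (hseries (D (P c)) x)"
    have cg: "continuous_on UNIV (?g c)" for c
      by (intro continuous_on_flux continuous_on_hseries P_l1 \<mu>)
    have "flux_coef \<mu> (P c) k - flux_coef \<mu> (P d) k = ip (\<lambda>x. ?g c x - ?g d x) (hartley k)"
      unfolding flux_coef_def by (rule ip_diff_left[symmetric]) (rule sq_integrable_continuous[OF cg] sq_integrable_hartley)+
    then have "\<bar>flux_coef \<mu> (P c) k - flux_coef \<mu> (P d) k\<bar> \<le> (\<integral>x. \<bar>(?g c x - ?g d x) * hartley k x\<bar> \<partial>torus)"
      by (simp only: ip_def integral_abs_bound)
    also have "\<dots> \<le> (\<integral>x. K * (\<Sum>j\<in>modes n. \<bar>c j - d j\<bar>) \<partial>torus)"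
    proof (rule integral_mono)
      show "integrable torus (\<lambda>x. \<bar>(?g c x - ?g d x) * hartley k x\<bar>)"
        by (rule integrable_torus_continuous)
           (rule continuous_on_rabs continuous_on_mult continuous_on_diff cg continuous_on_hartley)+
      show "\<bar>(?g c x - ?g d x) * hartley k x\<bar> \<le> K * (\<Sum>j\<in>modes n. \<bar>c j - d j\<bar>)" for x
        using abs_hartley_mult_le sup by (rule order_trans)
    qed simp
    also have "\<dots> = 2 * pi * K * (\<Sum>j\<in>modes n. \<bar>c j - d j\<bar>)" using measure_torus by simp
    finally show ?thesis .
  qed
  have lip: "\<bar>F k c - F k d\<bar> \<le> (real n * (2 * pi * K)) * (\<Sum>j\<in>modes n. \<bar>c j - d j\<bar>)" for k c d
  proof (cases "k \<in> modes n")
    case True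
    have "F k c - F k d = - of_int k * (flux_coef \<mu> (P c) (-k) - flux_coef \<mu> (P d) (-k))"
      using True by (simp add: F_def D_def algebra_simps)
    then have "\<bar>F k c - F k d\<bar> = \<bar>of_int k\<bar> * \<bar>flux_coef \<mu> (P c) (-k) - flux_coef \<mu> (P d) (-k)\<bar>"
      by (simp add: abs_mult)
    also have "\<dots> \<le> real n * (2 * pi * K * (\<Sum>j\<in>modes n. \<bar>c j - d j\<bar>))"
      using True lip_flux_coef by (intro mult_mono) auto
    finally show ?thesis by simp
  qed (auto simp: F_def K intro!: mult_nonneg_nonneg sum_nonneg)
  obtain c where c: "c 0 = c0"
    "\<And>k t. t \<in> {0..T} \<Longrightarrow> ((\<lambda>t. c t k) has_real_derivative F k (c t)) (at t within {0..T})"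
    by (rule finite_system_ODE[OF _ _ T lip, where ?c0.0 = c0]) (use K in \<open>auto simp: F_def\<close>)
  have out: "c t k = 0" if t: "t \<in> {0..T}" and k: "k \<notin> modes n" for t k
  proof -
    have "\<exists>z. \<forall>t\<in>{0..T}. c t k = z"
    proof (rule has_field_derivative_zero_constant)
      show "((\<lambda>t. c t k) has_field_derivative 0) (at t within {0..T})" if "t \<in> {0..T}" for t
        using c(2)[OF that, of k] k by (simp only: F_def if_False)
    qed simp
    then have "c t k = c 0 k" using t T by auto
    then show ?thesis using c(1) c0[OF k] by simp
  qed
  show ?thesis
  proof (rule that[of c, OF c(1) out])
    fix t k assume t: "t \<in> {0..T}" and k: "k \<in> modes n"
    have "P (c t) = c t" using out[OF t] by (auto simp: P_def)
    then have "F k (c t) = D (flux_coef \<mu> (c t)) k" using k by (simp add: F_def)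
    then show "((\<lambda>t. c t k) has_real_derivative D (flux_coef \<mu> (c t)) k) (at t within {0..T})"
      using c(2)[OF t, of k] by simp
  qed
qed

section \<open>Energy estimate\<close>

lemma DERIV_arctan_quotient:
  assumes "(f has_real_derivative f1 x) (at x)" "(f1 has_real_derivative f2) (at x)" "0 < f x"
  shows "((\<lambda>x. arctan (f1 x / f x)) has_real_derivative
    (f x * f2 - (f1 x)\<^sup>2) / ((f x)\<^sup>2 + (f1 x)\<^sup>2)) (at x)"
proof -
  define a b where "a = f x" and "b = f1 x"
  have a: "a > 0" using assms(3) by (simp add: a_def)
  have "((\<lambda>x. arctan (f1 x / f x)) has_real_derivative
     inverse (1 + (b / a)\<^sup>2) * ((f2 * a - b * b) / (a * a))) (at x)"
    unfolding a_def b_def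
    by (rule DERIV_chain2[OF DERIV_arctan DERIV_divide]) (use assms in auto)
  also have "inverse (1 + (b / a)\<^sup>2) * ((f2 * a - b * b) / (a * a)) = (a * f2 - b\<^sup>2) / (a\<^sup>2 + b\<^sup>2)"
  proof -
    have "1 + (b / a)\<^sup>2 = (a\<^sup>2 + b\<^sup>2) / (a * a)" using a by (simp add: field_simps power2_eq_square)
    moreover have "a\<^sup>2 + b\<^sup>2 > 0" using a by (simp add: add_pos_nonneg)
    ultimately show ?thesis using a by (simp add: power2_eq_square mult.commute)
  qed
  finally show ?thesis by (simp add: a_def b_def)
qed

lemma DERIV_quotient_second:
  fixes N Q :: "real \<Rightarrow> real"
  assumes "(N has_real_derivative N1 x) (at x)" "(Q has_real_derivative Q1 x) (at x)"
    "(N1 has_real_derivative N2) (at x)" "(Q1 has_real_derivative Q2) (at x)" "Q x \<noteq> 0"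
  shows "((\<lambda>x. N1 x / Q x - N x * Q1 x / (Q x)\<^sup>2) has_real_derivative
    N2 / Q x - 2 * N1 x * Q1 x / (Q x)\<^sup>2 - N x * Q2 / (Q x)\<^sup>2 + 2 * N x * (Q1 x)\<^sup>2 / (Q x) ^ 3) (at x)"
proof -
  have "((\<lambda>x. N1 x / Q x - N x * Q1 x / (Q x)\<^sup>2) has_real_derivative
    (N2 * Q x - N1 x * Q1 x) / (Q x * Q x) -
    ((N1 x * Q1 x + Q2 * N x) * (Q x)\<^sup>2 - (N x * Q1 x) * (2 * Q x * Q1 x)) / ((Q x)\<^sup>2 * (Q x)\<^sup>2)) (at x)"
    using assms(5) by (auto intro!: derivative_eq_intros assms(1-4) simp: power2_eq_square algebra_simps)
  also have "(N2 * Q x - N1 x * Q1 x) / (Q x * Q x) -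
    ((N1 x * Q1 x + Q2 * N x) * (Q x)\<^sup>2 - (N x * Q1 x) * (2 * Q x * Q1 x)) / ((Q x)\<^sup>2 * (Q x)\<^sup>2)
    = N2 / Q x - 2 * N1 x * Q1 x / (Q x)\<^sup>2 - N x * Q2 / (Q x)\<^sup>2 + 2 * N x * (Q1 x)\<^sup>2 / (Q x) ^ 3"
    using assms(5) by (simp add: field_simps power2_eq_square power3_eq_cube)
  finally show ?thesis .
qed

text \<open>With \<open>a, b, p, q\<close> standing for \<open>u\<close> and its first three derivatives, the third derivative of
\<open>arctan (u_x / u)\<close> is \<open>a / (a\<^sup>2 + b\<^sup>2)\<close> times the fourth derivative of \<open>u\<close> plus this
expression. Writing the first derivative of the flux as \<open>N / Q\<close>, the names \<open>N1\<close>, \<open>Q1\<close> and \<open>Q2\<close> are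
derivatives of \<open>N\<close> and \<open>Q\<close>. The second derivative of \<open>N\<close> is \<open>a u_xxxx - p\<^sup>2\<close>; the terms
\<open>b q\<close> cancel in it.\<close>

definition flux_rem :: "real \<Rightarrow> real \<Rightarrow> real \<Rightarrow> real \<Rightarrow> real" where
  "flux_rem a b p q = (let Q = a\<^sup>2 + b\<^sup>2; N = a * p - b\<^sup>2; N1 = a * q - b * p; Q1 = 2 * b * (a + p);
     Q2 = 2 * p * (a + p) + 2 * b * (b + q)
   in - p\<^sup>2 / Q - 2 * N1 * Q1 / Q\<^sup>2 - N * Q2 / Q\<^sup>2 + 2 * N * Q1\<^sup>2 / Q ^ 3)"

definition rem_const :: "real \<Rightarrow> real \<Rightarrow> real" where
  "rem_const \<mu> B = B\<^sup>2 / \<mu>\<^sup>2 + 20 * B ^ 4 / \<mu> ^ 4 + 64 * B ^ 6 / \<mu> ^ 6 + 12 * B ^ 3 / \<mu> ^ 4"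

lemma abs_mult_le: "\<bar>x\<bar> \<le> X \<Longrightarrow> \<bar>y\<bar> \<le> Y \<Longrightarrow> \<bar>x * y\<bar> \<le> X * (Y::real)"
  by (simp add: abs_mult mult_mono')

text \<open>Only \<open>N1\<close> and \<open>Q2\<close> contain \<open>q\<close>, and they enter linearly in separate terms. This linear growth
in the third derivative is what closes the energy estimate in H3.\<close>

lemma flux_rem_le:
  assumes \<mu>: "0 < \<mu>" "\<mu> \<le> a" and B: "\<bar>a\<bar> \<le> B" "\<bar>b\<bar> \<le> B" "\<bar>p\<bar> \<le> B"
  shows "\<bar>flux_rem a b p q\<bar> \<le> rem_const \<mu> B * (1 + \<bar>q\<bar>)"
proof -
  define Q where "Q = a\<^sup>2 + b\<^sup>2"
  define N where "N = a * p - b\<^sup>2"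
  define Q1 where "Q1 = 2 * b * (a + p)"
  define S where "S = 2 * p * (a + p) + 2 * b\<^sup>2"
  have B0: "B \<ge> 0" using B by linarith
  have Q: "\<mu>\<^sup>2 \<le> Q" using power_mono[OF \<mu>(2), of 2] \<mu>(1) by (simp add: Q_def add_increasing2)
  have Q0: "Q > 0" using Q \<mu>(1) by (smt (verit) zero_less_power)
  have dv: "\<bar>x / Q ^ j\<bar> \<le> X / \<mu> ^ (2 * j)" if "\<bar>x\<bar> \<le> X" for x X j
  proof -
    have "(\<mu>\<^sup>2) ^ j \<le> Q ^ j" using Q by (intro power_mono) auto
    then show ?thesis using that \<mu>(1) Q0 unfolding abs_divide power_mult
      by (intro frac_le) auto
  qed
  have bb: "\<bar>b\<^sup>2\<bar> \<le> B\<^sup>2" "\<bar>p\<^sup>2\<bar> \<le> B\<^sup>2" using B power_mono[of "\<bar>b\<bar>" B 2] power_mono[of "\<bar>p\<bar>" B 2] by auto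
  have N: "\<bar>N\<bar> \<le> 2 * B\<^sup>2"
    using abs_mult_le[OF B(1) B(3)] bb(1) unfolding N_def power2_eq_square by linarith
  have ap: "\<bar>a + p\<bar> \<le> 2 * B" using B by linarith
  have Q1: "\<bar>Q1\<bar> \<le> 4 * B\<^sup>2"
    using abs_mult_le[OF B(2) ap] unfolding Q1_def power2_eq_square by (simp add: mult.assoc)
  have S: "\<bar>S\<bar> \<le> 6 * B\<^sup>2"
  proof -
    have "S = 2 * (p * (a + p)) + 2 * b\<^sup>2" by (simp add: S_def)
    moreover have "\<bar>p * (a + p)\<bar> \<le> 2 * B\<^sup>2"
      using abs_mult_le[OF B(3) ap] by (simp add: power2_eq_square)
    ultimately show ?thesis using bb(1) by linarith
  qed
  have eq: "flux_rem a b p q = - (p\<^sup>2 / Q ^ 1) + (2 * (b * p) * Q1) / Q ^ 2 - (N * S) / Q ^ 2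
      + 2 * (N * Q1\<^sup>2) / Q ^ 3 - (2 * (a * Q1) + 2 * (N * b)) / Q ^ 2 * q"
    unfolding flux_rem_def Let_def Q_def[symmetric] N_def[symmetric] Q1_def[symmetric]
    unfolding S_def by (simp add: diff_divide_distrib add_divide_distrib algebra_simps power2_eq_square)
  have 1: "\<bar>p\<^sup>2 / Q ^ 1\<bar> \<le> B\<^sup>2 / \<mu>\<^sup>2" using dv[OF bb(2), of 1] by simp
  have "\<bar>2 * (b * p) * Q1\<bar> \<le> (2 * (B * B)) * (4 * B\<^sup>2)"
    using abs_mult_le[OF B(2,3)] by (intro abs_mult_le[OF _ Q1]) simp
  from dv[OF this, of 2] have 2: "\<bar>(2 * (b * p) * Q1) / Q ^ 2\<bar> \<le> 8 * B ^ 4 / \<mu> ^ 4"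
    by (simp add: power_numeral_reduce algebra_simps)
  from dv[OF abs_mult_le[OF N S], of 2] have 3: "\<bar>(N * S) / Q ^ 2\<bar> \<le> 12 * B ^ 4 / \<mu> ^ 4"
    by (simp add: power_numeral_reduce algebra_simps)
  have "\<bar>Q1\<^sup>2\<bar> \<le> (4 * B\<^sup>2)\<^sup>2" using power_mono[OF Q1, of 2] by simp
  from abs_mult_le[OF N this] have "\<bar>2 * (N * Q1\<^sup>2)\<bar> \<le> 2 * (2 * B\<^sup>2 * (4 * B\<^sup>2)\<^sup>2)" by simp
  from dv[OF this, of 3] have 4: "\<bar>2 * (N * Q1\<^sup>2) / Q ^ 3\<bar> \<le> 64 * B ^ 6 / \<mu> ^ 6"
    by (simp add: power_numeral_reduce algebra_simps)
  have "\<bar>2 * (a * Q1) + 2 * (N * b)\<bar> \<le> 2 * (B * (4 * B\<^sup>2)) + 2 * (2 * B\<^sup>2 * B)"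
    using abs_mult_le[OF B(1) Q1] abs_mult_le[OF N B(2)] by linarith
  from dv[OF this, of 2] have 5: "\<bar>(2 * (a * Q1) + 2 * (N * b)) / Q ^ 2\<bar> \<le> 12 * B ^ 3 / \<mu> ^ 4"
    by (simp add: power_numeral_reduce algebra_simps)
  from abs_mult_le[OF this order_refl[of "\<bar>q\<bar>"]]
  have 6: "\<bar>(2 * (a * Q1) + 2 * (N * b)) / Q ^ 2 * q\<bar> \<le> 12 * B ^ 3 / \<mu> ^ 4 * \<bar>q\<bar>" .
  define X where "X = B\<^sup>2 / \<mu>\<^sup>2 + 20 * B ^ 4 / \<mu> ^ 4 + 64 * B ^ 6 / \<mu> ^ 6"
  define Y where "Y = 12 * B ^ 3 / \<mu> ^ 4"
  have X: "X \<ge> 0" and Y: "Y \<ge> 0" using B0 \<mu>(1) by (simp_all add: X_def Y_def)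
  have "20 * B ^ 4 / \<mu> ^ 4 = 8 * B ^ 4 / \<mu> ^ 4 + 12 * B ^ 4 / \<mu> ^ 4"
    by (simp flip: add_divide_distrib)
  moreover have "\<bar>- x1 + x2 - x3 + x4 - x5\<bar> \<le> y1 + (y2 + y3) + y4 + y5"
    if "\<bar>x1\<bar> \<le> y1" "\<bar>x2\<bar> \<le> y2" "\<bar>x3\<bar> \<le> y3" "\<bar>x4\<bar> \<le> y4" "\<bar>x5\<bar> \<le> y5"
    for x1 x2 x3 x4 x5 y1 y2 y3 y4 y5 :: real
    using that by linarith
  from this[OF 1 2 3 4 6] have "\<bar>flux_rem a b p q\<bar> \<le> B\<^sup>2 / \<mu>\<^sup>2 + (8 * B ^ 4 / \<mu> ^ 4 + 12 * B ^ 4 / \<mu> ^ 4)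
      + 64 * B ^ 6 / \<mu> ^ 6 + 12 * B ^ 3 / \<mu> ^ 4 * \<bar>q\<bar>"
    unfolding eq .
  ultimately have "\<bar>flux_rem a b p q\<bar> \<le> X + Y * \<bar>q\<bar>"
    unfolding X_def Y_def by (simp only:)
  also have "\<dots> \<le> (X + Y) * (1 + \<bar>q\<bar>)"
    using X Y by (simp add: algebra_simps)
  finally show ?thesis by (simp add: rem_const_def X_def Y_def)
qed

text \<open>The summand \<open>\<mu>\<close> makes the bound positive; it is divided by in \<open>ellipticity\<close>.\<close>

definition c2_bound :: "real \<Rightarrow> real \<Rightarrow> real" where "c2_bound \<mu> K = sup_const * sqrt K + \<mu>"
definition ellipticity :: "real \<Rightarrow> real \<Rightarrow> real" where "ellipticity \<mu> K = \<mu> / (2 * (c2_bound \<mu> K)\<^sup>2)"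
definition flux_rem_const :: "real \<Rightarrow> real \<Rightarrow> real" where "flux_rem_const \<mu> K = rem_const \<mu> (c2_bound \<mu> K)"

text \<open>In this context \<open>u = U 0\<close> is a trigonometric polynomial that obeys both bounds, \<open>U j\<close> is its
\<open>j\<close>-th derivative, and \<open>g0\<close> is the flux with derivatives \<open>g1\<close>, \<open>g2\<close>, \<open>g3\<close>. The constants \<open>B\<close>, \<open>a0\<close>
and \<open>C1\<close> depend on \<open>\<mu>\<close> and \<open>K\<close> only.\<close>

context
  fixes \<mu> K :: real and c :: "int \<Rightarrow> real" and n :: nat
  assumes \<mu>: "0 < \<mu>" and c: "h3_ball K c" and supp: "\<And>k. k \<notin> modes n \<Longrightarrow> c k = 0"
    and low: "\<And>x. \<mu> \<le> hseries c x"
begin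

definition "U j = hseries ((D ^^ j) c)"

lemma supp_D: "k \<notin> modes n \<Longrightarrow> (D ^^ j) c k = 0"
proof (induction j arbitrary: k)
  case (Suc j)
  then have "- k \<notin> modes n" by auto
  then show ?case using Suc.IH[of "- k"] by (simp add: D_def)
qed (use supp in auto)

lemma U_trig_sum: "U j = trig_sum (modes n) ((D ^^ j) c)"
  unfolding U_def by (rule ext, rule hseries_finite) (use supp_D in auto)

lemma U_deriv: "(U j has_real_derivative U (Suc j) x) (at x)"
  unfolding U_trig_sum using trig_sum_deriv[of n "(D ^^ j) c" x] by simp

lemma U_cont: "continuous_on A (U j)"
  unfolding U_trig_sum by (rule continuous_on_trig_sum)

lemma U_periodic: "U j (x + 2 * pi) = U j x"
  by (simp add: U_def hseries_periodic)

lemma U_simps: "U 0 = hseries c" "U (Suc 0) = hseries (D c)" "U 2 = hseries (D (D c))"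
  by (simp_all add: U_def numeral_2_eq_2)

abbreviation "B \<equiv> c2_bound \<mu> K"

lemma U_le: "\<bar>U 0 x\<bar> \<le> B" "\<bar>U (Suc 0) x\<bar> \<le> B" "\<bar>U 2 x\<bar> \<le> B"
  using h3_ball_hseries_le[OF c, of x] \<mu> by (auto simp: U_simps c2_bound_def)

lemma B_pos: "B > 0" using U_le(1)[of 0] low[of 0] \<mu> by (simp add: U_simps)

definition "QQ x = (U 0 x)\<^sup>2 + (U 1 x)\<^sup>2"
definition "NN x = U 0 x * U 2 x - (U 1 x)\<^sup>2"
definition "QQ1 x = 2 * U 1 x * (U 0 x + U 2 x)"
definition "NN1 x = U 0 x * U 3 x - U 1 x * U 2 x"
definition "g0 x = arctan (U 1 x / U 0 x)"
definition "g1 x = NN x / QQ x"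
definition "g2 x = NN1 x / QQ x - NN x * QQ1 x / (QQ x)\<^sup>2"
definition "g3 x = U 0 x / QQ x * U 4 x + flux_rem (U 0 x) (U 1 x) (U 2 x) (U 3 x)"

lemma U0_pos: "U 0 x > 0" using low[of x] \<mu> by (simp add: U_simps)

lemma QQ_ge: "\<mu>\<^sup>2 \<le> QQ x"
  using power_mono[OF low[of x], of 2] \<mu> by (simp add: QQ_def U_simps add_increasing2)

lemma QQ_pos: "QQ x > 0" using QQ_ge[of x] \<mu> by (smt (verit) zero_less_power)

lemma g0_flux: "g0 = (\<lambda>x. flux \<mu> (hseries c x) (hseries (D c) x))"
  by (simp add: fun_eq_iff g0_def flux_def U_simps max_absorb1[OF low])

lemma U_derivs:
  "(U 0 has_real_derivative U 1 x) (at x)" "(U 1 has_real_derivative U 2 x) (at x)"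
  "(U 2 has_real_derivative U 3 x) (at x)" "(U 3 has_real_derivative U 4 x) (at x)"
  using U_deriv[of 0 x] U_deriv[of 1 x] U_deriv[of 2 x] U_deriv[of 3 x]
  by (simp_all add: eval_nat_numeral)

lemma g0_deriv: "(g0 has_real_derivative g1 x) (at x)"
  unfolding g0_def[abs_def] g1_def NN_def QQ_def
  by (rule DERIV_arctan_quotient[OF U_derivs(1,2) U0_pos])

lemma QN_derivs:
  "(QQ has_real_derivative QQ1 x) (at x)" "(NN has_real_derivative NN1 x) (at x)"
  "(QQ1 has_real_derivative (2 * U 2 x * (U 0 x + U 2 x) + 2 * U 1 x * (U 1 x + U 3 x))) (at x)"
  "(NN1 has_real_derivative (U 0 x * U 4 x - (U 2 x)\<^sup>2)) (at x)"
  unfolding QQ_def[abs_def] NN_def[abs_def] QQ1_def[abs_def] NN1_def[abs_def]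
  by (auto intro!: derivative_eq_intros U_derivs simp: algebra_simps power2_eq_square simp del: One_nat_def)

lemma g1_deriv: "(g1 has_real_derivative g2 x) (at x)"
proof -
  have "((\<lambda>x. NN x / QQ x) has_real_derivative (NN1 x * QQ x - NN x * QQ1 x) / (QQ x * QQ x)) (at x)"
    by (rule DERIV_divide[OF QN_derivs(2,1)]) (use QQ_pos[of x] in simp)
  also have "(NN1 x * QQ x - NN x * QQ1 x) / (QQ x * QQ x) = g2 x"
    using QQ_pos[of x] by (simp add: g2_def field_simps power2_eq_square)
  finally show ?thesis by (simp add: g1_def[abs_def])
qed

lemma g2_deriv: "(g2 has_real_derivative g3 x) (at x)"
proof -
  have "(g2 has_real_derivative
    (U 0 x * U 4 x - (U 2 x)\<^sup>2) / QQ x - 2 * NN1 x * QQ1 x / (QQ x)\<^sup>2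
     - NN x * (2 * U 2 x * (U 0 x + U 2 x) + 2 * U 1 x * (U 1 x + U 3 x)) / (QQ x)\<^sup>2
     + 2 * NN x * (QQ1 x)\<^sup>2 / (QQ x) ^ 3) (at x)"
    unfolding g2_def[abs_def]
    by (rule DERIV_quotient_second[OF QN_derivs(2,1,4,3)]) (use QQ_pos[of x] in simp)
  also have "(U 0 x * U 4 x - (U 2 x)\<^sup>2) / QQ x - 2 * NN1 x * QQ1 x / (QQ x)\<^sup>2
     - NN x * (2 * U 2 x * (U 0 x + U 2 x) + 2 * U 1 x * (U 1 x + U 3 x)) / (QQ x)\<^sup>2
     + 2 * NN x * (QQ1 x)\<^sup>2 / (QQ x) ^ 3 = g3 x"
    unfolding g3_def flux_rem_def Let_def QQ_def NN_def QQ1_def NN1_def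
    by (simp add: diff_divide_distrib)
  finally show ?thesis .
qed

lemma gs_cont: "continuous_on A g1" "continuous_on A g2" "continuous_on A g3" "continuous_on A g0"
proof -
  have q: "QQ x \<noteq> 0" "U 0 x \<noteq> 0" for x using QQ_pos[of x] U0_pos[of x] by auto
  have cq: "continuous_on A QQ" "continuous_on A NN" "continuous_on A QQ1" "continuous_on A NN1"
    unfolding QQ_def[abs_def] NN_def[abs_def] QQ1_def[abs_def] NN1_def[abs_def]
    by (intro continuous_intros U_cont)+
  show "continuous_on A g1" "continuous_on A g2" "continuous_on A g0"
    unfolding g1_def[abs_def] g2_def[abs_def] g0_def[abs_def]
    using q by (auto intro!: continuous_intros cq U_cont)
  show "continuous_on A g3"
    unfolding g3_def[abs_def] flux_rem_def Let_def QQ_def[symmetric]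
    using q by (auto intro!: continuous_intros cq U_cont)
qed

lemma gs_periodic: "g0 (x + 2 * pi) = g0 x" "g1 (x + 2 * pi) = g1 x" "g2 (x + 2 * pi) = g2 x"
  by (simp_all add: g0_def g1_def g2_def QQ_def NN_def QQ1_def NN1_def U_periodic)

lemma ip_g3_hartley: "ip g3 (hartley k) = - (of_int k)\<^sup>2 * D (flux_coef \<mu> c) k"
proof -
  have "ip g3 (hartley k) = D (\<lambda>k. ip g2 (hartley k)) k" for k
    by (rule ip_deriv_hartley[OF g2_deriv gs_cont(3) gs_periodic(3)])
  moreover have "ip g2 (hartley k) = D (\<lambda>k. ip g1 (hartley k)) k" for k
    by (rule ip_deriv_hartley[OF g1_deriv gs_cont(2) gs_periodic(2)])
  moreover have "ip g1 (hartley k) = D (\<lambda>k. ip g0 (hartley k)) k" for k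
    by (rule ip_deriv_hartley[OF g0_deriv gs_cont(1) gs_periodic(1)])
  ultimately have "ip g3 (hartley k) = D (D (D (\<lambda>k. ip g0 (hartley k)))) k" by simp
  also have "(\<lambda>k. ip g0 (hartley k)) = flux_coef \<mu> c" by (simp add: g0_flux flux_coef_def[abs_def])
  also have "D (D (D (flux_coef \<mu> c))) k = - (of_int k)\<^sup>2 * D (flux_coef \<mu> c) k" by (rule D_D)
  finally show ?thesis .
qed

abbreviation "a0 \<equiv> ellipticity \<mu> K"

lemma a0_pos: "a0 > 0" using \<mu> B_pos by (simp add: ellipticity_def)

lemma coeff_bounds: "a0 \<le> U 0 x / QQ x" "U 0 x / QQ x \<le> 1 / \<mu>"
proof -
  have "(U 0 x)\<^sup>2 \<le> B\<^sup>2" "(U 1 x)\<^sup>2 \<le> B\<^sup>2"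
    using power_mono[OF U_le(1)[of x], of 2] power_mono[OF U_le(2)[of x], of 2] by auto
  then have "QQ x \<le> 2 * B\<^sup>2" by (simp add: QQ_def)
  then show "a0 \<le> U 0 x / QQ x"
    unfolding ellipticity_def using low[of x] \<mu> QQ_pos[of x] by (intro frac_le) (auto simp: U_simps)
  have "\<mu> * U 0 x \<le> U 0 x * U 0 x" using low[of x] U0_pos[of x] by (intro mult_right_mono) (auto simp: U_simps)
  also have "\<dots> \<le> QQ x" by (simp add: QQ_def power2_eq_square)
  finally show "U 0 x / QQ x \<le> 1 / \<mu>" using \<mu> QQ_pos[of x] by (simp add: field_simps)
qed

abbreviation "C1 \<equiv> flux_rem_const \<mu> K"

definition "RR x = flux_rem (U 0 x) (U 1 x) (U 2 x) (U 3 x)"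

lemma RR_sq_le: "(RR x)\<^sup>2 \<le> 2 * C1\<^sup>2 * (1 + (U 3 x)\<^sup>2)"
proof -
  have "\<bar>RR x\<bar> \<le> C1 * (1 + \<bar>U 3 x\<bar>)"
    unfolding RR_def flux_rem_const_def using low[of x] U_le[of x] \<mu> by (intro flux_rem_le) (auto simp: U_simps)
  then have "\<bar>RR x\<bar>\<^sup>2 \<le> (C1 * (1 + \<bar>U 3 x\<bar>))\<^sup>2" by (intro power_mono) auto
  then have "(RR x)\<^sup>2 \<le> C1\<^sup>2 * (1 + \<bar>U 3 x\<bar>)\<^sup>2" by (simp add: power_mult_distrib)
  also have "(1 + \<bar>U 3 x\<bar>)\<^sup>2 \<le> 2 * (1 + (U 3 x)\<^sup>2)"
    using zero_le_power2[of "1 - \<bar>U 3 x\<bar>"] by (simp add: power2_sum power2_diff)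
  then have "C1\<^sup>2 * (1 + \<bar>U 3 x\<bar>)\<^sup>2 \<le> C1\<^sup>2 * (2 * (1 + (U 3 x)\<^sup>2))" by (intro mult_left_mono) auto
  finally show ?thesis by (simp add: algebra_simps)
qed

lemma ip_U3: "ip (U 3) (U 3) \<le> K"
  unfolding U_trig_sum ip_trig_sum_trig_sum[OF finite_atLeastAtMost_int] by (rule h3_ball_D_iter[OF c]) auto

lemma ip_U4: "ip (U 4) (U 4) = (\<Sum>k\<in>modes n. of_int k ^ 8 * (c k)\<^sup>2)"
proof -
  have "(D ^^ 4) c k = of_int k ^ 4 * c k" for k
    by (simp add: eval_nat_numeral D_def)
  then show ?thesis unfolding U_trig_sum ip_trig_sum_trig_sum[OF finite_atLeastAtMost_int]
    by (simp add: power_mult_distrib flip: power_mult)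
qed

lemma sq_integrable_U: "sq_integrable (U j)" by (intro sq_integrable_continuous U_cont)

lemma int_one_U3: "(\<integral>x. M * (1 + (U 3 x)\<^sup>2) \<partial>torus) \<le> M * (2 * pi + K)" if "M \<ge> 0" for M
proof -
  have "integrable torus (\<lambda>x. (U 3 x)\<^sup>2)" using sq_integrable_U by (simp add: sq_integrable_def)
  then have "(\<integral>x. 1 + (U 3 x)\<^sup>2 \<partial>torus) = 2 * pi + ip (U 3) (U 3)"
    using measure_torus by (simp add: ip_def power2_eq_square)
  then show ?thesis using mult_left_mono[OF _ that, of "2 * pi + ip (U 3) (U 3)" "2 * pi + K"] ip_U3 by simp
qed

text \<open>The sum is minus the integral of \<open>U 4 * g3\<close>, by three integrations by parts. The leading term
of \<open>g3\<close> produces the dissipation, one half of which absorbs the remainder.\<close>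

lemma energy_high:
  "2 * (\<Sum>k\<in>modes n. of_int k ^ 6 * c k * D (flux_coef \<mu> c) k) + a0 * (\<Sum>k\<in>modes n. of_int k ^ 8 * (c k)\<^sup>2)
    \<le> 2 * C1\<^sup>2 / a0 * (2 * pi + K)"
proof -
  have s3: "sq_integrable g3" by (intro sq_integrable_continuous gs_cont)
  have "ip (U 4) g3 = (\<Sum>k\<in>modes n. (of_int k ^ 4 * c k) * ip g3 (hartley k))"
    unfolding U_trig_sum ip_trig_sum_left[OF s3] by (simp add: eval_nat_numeral D_def mult_ac)
  also have "\<dots> = - (\<Sum>k\<in>modes n. of_int k ^ 6 * c k * D (flux_coef \<mu> c) k)"
    unfolding ip_g3_hartley sum_negf[symmetric] by (intro sum.cong) (auto simp: power_numeral_reduce)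
  finally have e: "(\<Sum>k\<in>modes n. of_int k ^ 6 * c k * D (flux_coef \<mu> c) k) = - ip (U 4) g3" by simp
  have i: "integrable torus (\<lambda>x. U 4 x * g3 x)" "integrable torus (\<lambda>x. U 4 x * U 4 x)"
    by (intro sq_integrable_mult_integrable sq_integrable_U s3)+
  have "2 * (- ip (U 4) g3) + a0 * ip (U 4) (U 4) = (\<integral>x. - 2 * (U 4 x * g3 x) + a0 * (U 4 x * U 4 x) \<partial>torus)"
    using i by (simp add: ip_def)
  also have "\<dots> \<le> (\<integral>x. 2 * C1\<^sup>2 / a0 * (1 + (U 3 x)\<^sup>2) \<partial>torus)"
  proof (rule integral_mono)
    show "integrable torus (\<lambda>x. - 2 * (U 4 x * g3 x) + a0 * (U 4 x * U 4 x))" using i by simp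
    show "integrable torus (\<lambda>x. 2 * C1\<^sup>2 / a0 * (1 + (U 3 x)\<^sup>2))" using sq_integrable_U[of 3] by (simp add: sq_integrable_def)
    fix x
    define y where "y = U 4 x"
    have "- 2 * (y * g3 x) + a0 * (y * y) = - 2 * (U 0 x / QQ x * y\<^sup>2) - 2 * (y * RR x) + a0 * y\<^sup>2"
      unfolding g3_def RR_def y_def[symmetric] by (simp add: algebra_simps power2_eq_square)
    also have "\<dots> \<le> - 2 * (a0 * y\<^sup>2) - 2 * (y * RR x) + a0 * y\<^sup>2"
      using mult_right_mono[OF coeff_bounds(1)[of x], of "y\<^sup>2"] by simp
    also have "\<dots> \<le> (RR x)\<^sup>2 / a0"
    proof -
      have "0 \<le> (a0 * y + RR x)\<^sup>2 / a0" using a0_pos by simp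
      also have "\<dots> = a0 * y\<^sup>2 + 2 * (y * RR x) + (RR x)\<^sup>2 / a0"
        using a0_pos by (simp add: field_simps power2_eq_square)
      finally show ?thesis by simp
    qed
    also have "\<dots> \<le> 2 * C1\<^sup>2 * (1 + (U 3 x)\<^sup>2) / a0"
      using a0_pos by (intro divide_right_mono RR_sq_le) auto
    finally show "- 2 * (U 4 x * g3 x) + a0 * (U 4 x * U 4 x) \<le> 2 * C1\<^sup>2 / a0 * (1 + (U 3 x)\<^sup>2)"
      by (simp add: y_def)
  qed
  also have "\<dots> \<le> 2 * C1\<^sup>2 / a0 * (2 * pi + K)"
    by (rule int_one_U3) (use a0_pos in auto)
  finally show ?thesis unfolding e ip_U4 .
qed

text \<open>The L2 norm decreases because \<open>u_x\<close> and \<open>arctan (u_x / u)\<close> have the same sign.\<close>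

lemma energy_low: "(\<Sum>k\<in>modes n. c k * D (flux_coef \<mu> c) k) \<le> 0"
proof -
  have "0 \<le> ip (U 1) g0"
    unfolding ip_def
  proof (rule Bochner_Integration.integral_nonneg)
    fix x
    show "0 \<le> U 1 x * g0 x"
      using U0_pos[of x] by (cases "U 1 x \<ge> 0")
        (auto simp: g0_def mult_nonneg_nonneg mult_nonpos_nonpos divide_nonpos_pos)
  qed
  also have "ip (U 1) g0 = (\<Sum>k\<in>modes n. D c k * flux_coef \<mu> c k)"
    unfolding U_trig_sum ip_trig_sum_left[OF sq_integrable_continuous[OF gs_cont(4)]] by (simp add: g0_flux flux_coef_def)
  also have "\<dots> = - (\<Sum>k\<in>modes n. c k * D (flux_coef \<mu> c) k)"
    unfolding sum_negf[symmetric] by (rule sum.reindex_bij_witness[of _ uminus uminus]) (auto simp: D_def)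
  finally show ?thesis by simp
qed

text \<open>Bessel for \<open>g3\<close>.\<close>

lemma flux_coeff_bound:
  assumes "finite F"
  shows "(\<Sum>k\<in>F. of_int k ^ 6 * (flux_coef \<mu> c k)\<^sup>2)
     \<le> 2 / \<mu>\<^sup>2 * (\<Sum>k\<in>modes n. of_int k ^ 8 * (c k)\<^sup>2) + 4 * C1\<^sup>2 * (2 * pi + K)"
proof -
  have s3: "sq_integrable g3" by (intro sq_integrable_continuous gs_cont)
  have "(ip g3 (hartley (- k)))\<^sup>2 = of_int k ^ 6 * (flux_coef \<mu> c k)\<^sup>2" for k
    unfolding ip_g3_hartley by (simp add: D_def power_mult_distrib power_numeral_reduce)
  then have "(\<Sum>k\<in>F. of_int k ^ 6 * (flux_coef \<mu> c k)\<^sup>2) = (\<Sum>k\<in>uminus ` F. (ip g3 (hartley k))\<^sup>2)"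
    using sum_uminus[of "\<lambda>k. (ip g3 (hartley k))\<^sup>2" F] by simp
  also have "\<dots> \<le> ip g3 g3" using assms by (intro Bessel s3) auto
  also have "\<dots> \<le> (\<integral>x. 2 / \<mu>\<^sup>2 * (U 4 x * U 4 x) + 4 * C1\<^sup>2 * (1 + (U 3 x)\<^sup>2) \<partial>torus)"
    unfolding ip_def
  proof (rule integral_mono)
    show "integrable torus (\<lambda>x. g3 x * g3 x)" by (intro sq_integrable_mult_integrable s3)
    show "integrable torus (\<lambda>x. 2 / \<mu>\<^sup>2 * (U 4 x * U 4 x) + 4 * C1\<^sup>2 * (1 + (U 3 x)\<^sup>2))"
      using sq_integrable_mult_integrable[OF sq_integrable_U[of 4] sq_integrable_U[of 4]] sq_integrable_U[of 3] by (simp add: sq_integrable_def)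
    fix x
    define q where "q = U 0 x / QQ x"
    have "q \<ge> 0" using U0_pos[of x] QQ_pos[of x] by (simp add: q_def)
    then have "q\<^sup>2 \<le> (1 / \<mu>)\<^sup>2" using coeff_bounds(2)[of x] by (intro power_mono) (auto simp: q_def)
    then have 1: "(q * U 4 x)\<^sup>2 \<le> (1 / \<mu>)\<^sup>2 * (U 4 x)\<^sup>2"
      unfolding power_mult_distrib by (intro mult_right_mono) auto
    have "g3 x * g3 x = (q * U 4 x + RR x)\<^sup>2" by (simp add: g3_def q_def RR_def power2_eq_square)
    also have "\<dots> \<le> 2 * (q * U 4 x)\<^sup>2 + 2 * (RR x)\<^sup>2"
      using zero_le_power2[of "q * U 4 x - RR x"] by (simp add: power2_sum power2_diff)
    also have "\<dots> \<le> 2 * ((1 / \<mu>)\<^sup>2 * (U 4 x)\<^sup>2) + 2 * (2 * C1\<^sup>2 * (1 + (U 3 x)\<^sup>2))"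
      using 1 RR_sq_le[of x] by simp
    finally show "g3 x * g3 x \<le> 2 / \<mu>\<^sup>2 * (U 4 x * U 4 x) + 4 * C1\<^sup>2 * (1 + (U 3 x)\<^sup>2)"
      by (simp add: power_divide power2_eq_square)
  qed
  also have "\<dots> = 2 / \<mu>\<^sup>2 * ip (U 4) (U 4) + (\<integral>x. 4 * C1\<^sup>2 * (1 + (U 3 x)\<^sup>2) \<partial>torus)"
    using sq_integrable_mult_integrable[OF sq_integrable_U[of 4] sq_integrable_U[of 4]] sq_integrable_U[of 3] by (simp add: sq_integrable_def ip_def)
  also have "\<dots> \<le> 2 / \<mu>\<^sup>2 * ip (U 4) (U 4) + 4 * C1\<^sup>2 * (2 * pi + K)"
    by (intro add_left_mono int_one_U3) auto
  finally show ?thesis by (simp only: ip_U4)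
qed

end

lemma galerkin_energy:
  assumes \<mu>: "0 < \<mu>" and K: "0 \<le> K"
  shows "\<exists>a>0. \<exists>C\<ge>0.
    (\<forall>c n. h3_ball K c \<and> (\<forall>k. k \<notin> modes n \<longrightarrow> c k = 0) \<and> (\<forall>x. \<mu> \<le> hseries c x) \<longrightarrow>
       2 * (\<Sum>k\<in>modes n. (1 + of_int k ^ 6) * c k * D (flux_coef \<mu> c) k) + a * (\<Sum>k\<in>modes n. of_int k ^ 8 * (c k)\<^sup>2) \<le> C) \<and>
    (\<forall>c n F. h3_ball K c \<and> (\<forall>k. k \<notin> modes n \<longrightarrow> c k = 0) \<and> (\<forall>x. \<mu> \<le> hseries c x) \<and> finite F \<longrightarrow>
       (\<Sum>k\<in>F. of_int k ^ 6 * (flux_coef \<mu> c k)\<^sup>2) \<le> C * (1 + (\<Sum>k\<in>modes n. of_int k ^ 8 * (c k)\<^sup>2)))"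
proof -
  let ?B = "c2_bound \<mu> K"
  let ?a = "ellipticity \<mu> K"
  let ?C1 = "flux_rem_const \<mu> K"
  define C where "C = 2 * ?C1\<^sup>2 / ?a * (2 * pi + K) + 4 * ?C1\<^sup>2 * (2 * pi + K) + 2 / \<mu>\<^sup>2"
  have Bp: "?B > 0" using \<mu> K sup_const_nonneg by (simp add: c2_bound_def add_nonneg_pos)
  have ap: "?a > 0" using \<mu> Bp by (simp add: ellipticity_def)
  have parts: "0 \<le> 2 * ?C1\<^sup>2 / ?a * (2 * pi + K)" "0 \<le> 4 * ?C1\<^sup>2 * (2 * pi + K)" "0 \<le> 2 / \<mu>\<^sup>2"
    using ap K pi_ge_zero by (auto intro!: mult_nonneg_nonneg divide_nonneg_pos simp del: times_divide_eq_left times_divide_eq_right divide_divide_eq_right)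
  have C: "C \<ge> 0" unfolding C_def using parts by linarith
  show ?thesis
  proof (intro exI[of _ ?a] exI[of _ C] conjI ap C allI impI; elim conjE)
    fix c n assume a: "h3_ball K c" "\<forall>k. k \<notin> modes n \<longrightarrow> c k = 0" "\<forall>x. \<mu> \<le> hseries c x"
    have e1: "2 * (\<Sum>k\<in>modes n. of_int k ^ 6 * c k * D (flux_coef \<mu> c) k) + ?a * (\<Sum>k\<in>modes n. of_int k ^ 8 * (c k)\<^sup>2)
        \<le> 2 * ?C1\<^sup>2 / ?a * (2 * pi + K)"
      by (rule energy_high[OF \<mu>]) (use a in auto)
    have e2: "(\<Sum>k\<in>modes n. c k * D (flux_coef \<mu> c) k) \<le> 0"
      by (rule energy_low[OF \<mu>]) (use a in auto)
    have "2 * (\<Sum>k\<in>modes n. (1 + of_int k ^ 6) * c k * D (flux_coef \<mu> c) k)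
       = 2 * (\<Sum>k\<in>modes n. c k * D (flux_coef \<mu> c) k) + 2 * (\<Sum>k\<in>modes n. of_int k ^ 6 * c k * D (flux_coef \<mu> c) k)"
      by (simp add: algebra_simps sum.distrib)
    then show "2 * (\<Sum>k\<in>modes n. (1 + of_int k ^ 6) * c k * D (flux_coef \<mu> c) k) + ?a * (\<Sum>k\<in>modes n. of_int k ^ 8 * (c k)\<^sup>2) \<le> C"
      using e1 e2 parts unfolding C_def by linarith
  next
    fix c n and F :: "int set" assume a: "h3_ball K c" "\<forall>k. k \<notin> modes n \<longrightarrow> c k = 0" "\<forall>x. \<mu> \<le> hseries c x" and F: "finite F"
    define E where "E = (\<Sum>k\<in>modes n. of_int k ^ 8 * (c k)\<^sup>2)"
    have E: "E \<ge> 0" by (simp add: E_def sum_nonneg)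
    have "(\<Sum>k\<in>F. of_int k ^ 6 * (flux_coef \<mu> c k)\<^sup>2) \<le> 2 / \<mu>\<^sup>2 * E + 4 * ?C1\<^sup>2 * (2 * pi + K)"
      unfolding E_def by (rule flux_coeff_bound[OF \<mu>]) (use a F in auto)
    also have "\<dots> \<le> C * E + C"
      using parts E unfolding C_def by (intro add_mono mult_right_mono) linarith+
    finally show "(\<Sum>k\<in>F. of_int k ^ 6 * (flux_coef \<mu> c k)\<^sup>2) \<le> C * (1 + (\<Sum>k\<in>modes n. of_int k ^ 8 * (c k)\<^sup>2))"
      by (simp add: E_def algebra_simps)
  qed
qed

section \<open>Uniform estimates for the Galerkin approximations\<close>

text \<open>Every member of the H3 ball and its derivative have coefficients below this summable
family, which serves as majorant in limits within the ball.\<close>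

definition coef_bound :: "real \<Rightarrow> int \<Rightarrow> real" where "coef_bound K k = 2 * sqrt K / (1 + (of_int k)\<^sup>2)"

lemma coef_bound_summable: "coef_bound K summable_on UNIV"
proof -
  have "(\<lambda>k::int. (2 * sqrt K) * (1 / (1 + (of_int k)\<^sup>2))) summable_on UNIV"
    by (intro summable_on_cmult_right summable_weight)
  then show ?thesis by (simp add: coef_bound_def[abs_def])
qed

lemma h3_ball_le_coef_bound:
  assumes "h3_ball K c"
  shows "\<bar>c k\<bar> \<le> coef_bound K k" "\<bar>D c k\<bar> \<le> coef_bound K k"
proof -
  have K: "K \<ge> 0" using h3_ball_nonneg[OF assms] .
  have one: "(1 + of_int j ^ 6) * (c j)\<^sup>2 \<le> K" for j using h3_ballD[OF assms, of "{j}"] by simp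
  have *: "x * \<bar>c j\<bar> \<le> 2 * sqrt K" if "x\<^sup>2 \<le> 4 * (1 + of_int j ^ 6)" for x j
  proof (rule power2_le_imp_le)
    have "(x * \<bar>c j\<bar>)\<^sup>2 \<le> 4 * (1 + of_int j ^ 6) * (c j)\<^sup>2"
      using that by (simp add: power_mult_distrib mult_right_mono)
    also have "\<dots> = 4 * ((1 + of_int j ^ 6) * (c j)\<^sup>2)" by (simp only: mult.assoc)
    also have "\<dots> \<le> 4 * K" using one[of j] by linarith
    also have "\<dots> = (2 * sqrt K)\<^sup>2" using K by (simp add: power_mult_distrib)
    finally show "(x * \<bar>c j\<bar>)\<^sup>2 \<le> (2 * sqrt K)\<^sup>2" .
  qed (use K in simp)
  have w: "(1 + (real_of_int j)\<^sup>2)\<^sup>2 \<le> 4 * (1 + of_int j ^ 6)"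
       "(\<bar>real_of_int j\<bar> * (1 + (of_int j)\<^sup>2))\<^sup>2 \<le> 4 * (1 + of_int j ^ 6)" for j
  proof -
    define a where "a = \<bar>real_of_int j\<bar>"
    have e: "(real_of_int j)\<^sup>2 = a\<^sup>2" "real_of_int j ^ 6 = a ^ 6" by (simp_all add: a_def power_even_abs)
    have "(1 + a\<^sup>2)\<^sup>2 \<le> 4 * (1 + a ^ 6) \<and> (a * (1 + a\<^sup>2))\<^sup>2 \<le> 4 * (1 + a ^ 6)"
    proof (cases j rule: int_abs_cases)
      case 1 then show ?thesis by (simp add: a_def)
    next
      case 2
      then have a: "a \<ge> 1" by (simp add: a_def)
      then have "1 + a\<^sup>2 \<le> 2 * a\<^sup>2" by (simp add: one_le_power)
      then have b: "(1 + a\<^sup>2)\<^sup>2 \<le> (2 * a\<^sup>2)\<^sup>2" by (intro power_mono) auto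
      have e4: "(2 * a\<^sup>2)\<^sup>2 = 4 * a ^ 4" by (simp add: power_mult_distrib)
      have f1: "(1 + a\<^sup>2)\<^sup>2 \<le> 4 * a ^ 4" using b unfolding e4 .
      have "a ^ 4 \<le> a ^ 6" using a by (intro power_increasing) auto
      then have f2: "4 * a ^ 4 \<le> 4 * (1 + a ^ 6)" by simp
      have "(a * (1 + a\<^sup>2))\<^sup>2 \<le> a\<^sup>2 * (4 * a ^ 4)"
        unfolding power_mult_distrib[of a] using f1 by (rule mult_left_mono) simp
      also have "\<dots> = 4 * a ^ 6" by (simp add: power_numeral_reduce)
      also have "\<dots> \<le> 4 * (1 + a ^ 6)" by simp
      finally show ?thesis using order_trans[OF f1 f2] by blast
    qed
    then show "(1 + (real_of_int j)\<^sup>2)\<^sup>2 \<le> 4 * (1 + of_int j ^ 6)"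
       "(\<bar>real_of_int j\<bar> * (1 + (of_int j)\<^sup>2))\<^sup>2 \<le> 4 * (1 + of_int j ^ 6)"
      unfolding e a_def[symmetric] by auto
  qed
  have p: "1 + (real_of_int k)\<^sup>2 > 0" by (simp add: add_pos_nonneg)
  show "\<bar>c k\<bar> \<le> coef_bound K k"
    using *[OF w(1)[of k]] p by (simp add: coef_bound_def pos_le_divide_eq mult.commute)
  have "\<bar>D c k\<bar> * (1 + (real_of_int k)\<^sup>2) = \<bar>real_of_int (-k)\<bar> * (1 + (of_int (-k))\<^sup>2) * \<bar>c (-k)\<bar>"
    by (simp add: D_def abs_mult)
  also have "\<dots> \<le> 2 * sqrt K" by (rule *[OF w(2)])
  finally show "\<bar>D c k\<bar> \<le> coef_bound K k"
    using p by (simp add: coef_bound_def pos_le_divide_eq)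
qed

text \<open>Two series in the same H3 ball differ little as soon as finitely many of their coefficients do,
since the tails are dominated by a fixed summable family. With the speed bound of
\<open>abs_flux_coef_le\<close> this controls solutions for short times.\<close>

lemma hseries_close:
  assumes "K \<ge> 0" "e > 0"
  shows "\<exists>L. \<exists>\<delta>>0. \<forall>c d \<tau> x. h3_ball K c \<and> h3_ball K d \<and> \<tau> \<le> \<delta> \<and>
      (\<forall>k\<in>modes L. \<bar>c k - d k\<bar> \<le> 4 * pi * \<bar>of_int k\<bar> * \<tau>) \<longrightarrow> \<bar>hseries c x - hseries d x\<bar> \<le> e"
proof -
  have s: "(\<lambda>k. 2 * coef_bound K k) summable_on UNIV" by (intro summable_on_cmult_right coef_bound_summable)
  have nn: "0 \<le> 2 * coef_bound K k" for k using assms(1) by (simp add: coef_bound_def add_nonneg_nonneg)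
  obtain L where L: "\<And>F. finite F \<Longrightarrow> F \<inter> modes L = {} \<Longrightarrow> (\<Sum>k\<in>F. 2 * coef_bound K k) < e / 2"
    by (rule tail_small[OF nn s, of "e / 2"]) (use assms in auto)
  define A where "A = (\<Sum>k\<in>modes L. 4 * pi * \<bar>real_of_int k\<bar>)"
  have A: "A \<ge> 0" by (simp add: A_def sum_nonneg)
  define \<delta> where "\<delta> = e / (2 * (A + 1))"
  have \<delta>: "\<delta> > 0" "A * \<delta> \<le> e / 2" using A assms by (auto simp: \<delta>_def field_simps)
  show ?thesis
  proof (intro exI[of _ L] exI[of _ \<delta>] conjI \<delta>(1) allI impI; elim conjE)
    fix c d \<tau> x
    assume c: "h3_ball K c" and d: "h3_ball K d" and t: "\<tau> \<le> \<delta>"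
      and le: "\<forall>k\<in>modes L. \<bar>c k - d k\<bar> \<le> 4 * pi * \<bar>of_int k\<bar> * \<tau>"
    have "(\<Sum>k\<in>F. \<bar>c k - d k\<bar>) \<le> e" if F: "finite F" for F
    proof -
      have "(\<Sum>k\<in>F. \<bar>c k - d k\<bar>) \<le> (\<Sum>k\<in>F \<union> modes L. \<bar>c k - d k\<bar>)"
        using F by (intro sum_mono2) auto
      also have "\<dots> = (\<Sum>k\<in>modes L. \<bar>c k - d k\<bar>) + (\<Sum>k\<in>F - modes L. \<bar>c k - d k\<bar>)"
        using F by (subst sum.union_disjoint[symmetric]) (auto intro: sum.cong)
      also have "(\<Sum>k\<in>modes L. \<bar>c k - d k\<bar>) \<le> (\<Sum>k\<in>modes L. 4 * pi * \<bar>of_int k\<bar> * \<delta>)"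
      proof (rule sum_mono)
        fix k assume "k \<in> modes L"
        then have "\<bar>c k - d k\<bar> \<le> 4 * pi * \<bar>of_int k\<bar> * \<tau>" by (rule le[rule_format])
        also have "\<dots> \<le> 4 * pi * \<bar>of_int k\<bar> * \<delta>" using t by (intro mult_left_mono) auto
        finally show "\<bar>c k - d k\<bar> \<le> 4 * pi * \<bar>of_int k\<bar> * \<delta>" .
      qed
      also have "\<dots> = A * \<delta>" by (simp add: A_def sum_distrib_right)
      also have "\<dots> \<le> e / 2" by (rule \<delta>)
      also have "(\<Sum>k\<in>F - modes L. \<bar>c k - d k\<bar>) \<le> (\<Sum>k\<in>F - modes L. 2 * coef_bound K k)"
      proof (rule sum_mono)
        fix k
        show "\<bar>c k - d k\<bar> \<le> 2 * coef_bound K k"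
          using h3_ball_le_coef_bound(1)[OF c, of k] h3_ball_le_coef_bound(1)[OF d, of k] by linarith
      qed
      also have "\<dots> \<le> e / 2" using F by (intro less_imp_le L) auto
      finally show ?thesis by simp
    qed
    then have "\<bar>hseries (\<lambda>k. c k - d k) x\<bar> \<le> e"
      by (intro abs_hseries_le l1_diff h3_ball_l1[OF c] h3_ball_l1[OF d])
    then show "\<bar>hseries c x - hseries d x\<bar> \<le> e" by (simp add: hseries_diff h3_ball_l1[OF c] h3_ball_l1[OF d])
  qed
qed

lemma h3_ball_limit:
  assumes "\<And>k. (\<lambda>j::nat. c j k) \<longlonglongrightarrow> d k" "\<And>j. h3_ball K (c j)"
  shows "h3_ball K d"
  unfolding h3_ball_def
proof (intro allI impI)
  fix F :: "int set" assume F: "finite F"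
  have "(\<lambda>j. \<Sum>k\<in>F. (1 + of_int k ^ 6) * (c j k)\<^sup>2) \<longlonglongrightarrow> (\<Sum>k\<in>F. (1 + of_int k ^ 6) * (d k)\<^sup>2)"
    by (intro tendsto_intros assms)
  then show "(\<Sum>k\<in>F. (1 + of_int k ^ 6) * (d k)\<^sup>2) \<le> K"
    by (rule tendsto_upperbound) (simp_all add: h3_ballD[OF assms(2) F])
qed

lemma hseries_limit:
  assumes "\<And>k. (\<lambda>j::nat. c j k) \<longlonglongrightarrow> d k" "\<And>j. h3_ball K (c j)"
  shows "(\<lambda>j. hseries (c j) x) \<longlonglongrightarrow> hseries d x"
  by (rule hseries_tendsto[where S = UNIV and M = "coef_bound K"])
     (use assms(1) h3_ball_le_coef_bound[OF assms(2)] coef_bound_summable in auto)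

lemma flux_coef_tendsto:
  assumes \<mu>: "\<mu> > 0" and lim: "\<And>k. (\<lambda>j. c j k) \<longlonglongrightarrow> d k"
    and c: "\<And>j::nat. h3_ball K (c j)"
  shows "(\<lambda>j. flux_coef \<mu> (c j) k) \<longlonglongrightarrow> flux_coef \<mu> d k"
proof -
  have d: "h3_ball K d" by (rule h3_ball_limit[OF lim c])
  have l: "(\<lambda>j. hseries (c j) x) \<longlonglongrightarrow> hseries d x" "(\<lambda>j. hseries (D (c j)) x) \<longlonglongrightarrow> hseries (D d) x" for x
  proof -
    show "(\<lambda>j. hseries (c j) x) \<longlonglongrightarrow> hseries d x" by (rule hseries_limit[OF lim c])
    show "(\<lambda>j. hseries (D (c j)) x) \<longlonglongrightarrow> hseries (D d) x"
    proof (rule hseries_tendsto[where S = UNIV and M = "coef_bound K"])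
      show "(\<lambda>j. D (c j) k) \<longlonglongrightarrow> D d k" for k unfolding D_def by (intro tendsto_intros lim)
    qed (use h3_ball_le_coef_bound[OF c] coef_bound_summable in auto)
  qed
  show ?thesis
    unfolding flux_coef_def ip_def
  proof (rule integral_dominated_convergence)
    have cc: "continuous_on UNIV (\<lambda>x. flux \<mu> (hseries c x) (hseries (D c) x) * hartley k x)" if "h3_ball K c" for c
      by (intro continuous_intros continuous_on_flux continuous_on_hseries h3_ball_l1[OF that] \<mu>)
    show "(\<lambda>x. flux \<mu> (hseries d x) (hseries (D d) x) * hartley k x) \<in> borel_measurable torus"
      "(\<lambda>x. flux \<mu> (hseries (c j) x) (hseries (D (c j)) x) * hartley k x) \<in> borel_measurable torus" for j
      by (intro borel_imp_torus borel_measurable_continuous_onI cc d c)+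
    show "integrable torus (\<lambda>x. 2)" by simp
    show "AE x in torus. (\<lambda>j. flux \<mu> (hseries (c j) x) (hseries (D (c j)) x) * hartley k x) \<longlonglongrightarrow> flux \<mu> (hseries d x) (hseries (D d) x) * hartley k x"
    proof (rule AE_I2)
      fix x
      have "max (hseries d x) \<mu> \<noteq> 0" using \<mu> by (auto simp: max_def)
      then show "(\<lambda>j. flux \<mu> (hseries (c j) x) (hseries (D (c j)) x) * hartley k x) \<longlonglongrightarrow> flux \<mu> (hseries d x) (hseries (D d) x) * hartley k x"
        unfolding flux_def by (intro tendsto_intros l)
    qed
    show "AE x in torus. norm (flux \<mu> (hseries (c j) x) (hseries (D (c j)) x) * hartley k x) \<le> 2" for j
      by (intro AE_I2) (auto intro: order_trans[OF abs_hartley_mult_le abs_flux_le])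
  qed
qed

lemma continuous_on_flux_coef:
  assumes \<mu>: "\<mu> > 0" and c: "\<And>k. continuous_on S (\<lambda>t::real. c t k)" and K: "\<And>t. t \<in> S \<Longrightarrow> h3_ball K (c t)"
  shows "continuous_on S (\<lambda>t. flux_coef \<mu> (c t) k)"
  unfolding continuous_on_sequentially
proof (intro allI impI ballI, elim conjE)
  fix x a assume a: "a \<in> S" and x: "\<forall>n. x n \<in> S" "x \<longlonglongrightarrow> a"
  have "(\<lambda>j. c (x j) k) \<longlonglongrightarrow> c a k" for k
    using c[of k] a x unfolding continuous_on_sequentially by (auto simp: o_def)
  then have "(\<lambda>j. flux_coef \<mu> (c (x j)) k) \<longlonglongrightarrow> flux_coef \<mu> (c a) k"
    by (rule flux_coef_tendsto[OF \<mu>]) (use K x in auto)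
  then show "((\<lambda>t. flux_coef \<mu> (c t) k) \<circ> x) \<longlonglongrightarrow> flux_coef \<mu> (c a) k" by (simp add: o_def)
qed

text \<open>Look at the first time at which \<open>E\<close> reaches \<open>K\<close>.\<close>

lemma bootstrap:
  fixes E :: "real \<Rightarrow> real"
  assumes "continuous_on {0..T} E"
    and step: "\<And>t. t \<in> {0..T} \<Longrightarrow> (\<And>s. 0 \<le> s \<Longrightarrow> s < t \<Longrightarrow> E s \<le> K) \<Longrightarrow> E t < K"
    and t: "t \<in> {0..T}"
  shows "E t < K"
proof (rule ccontr)
  assume "\<not> E t < K"
  define A where "A = {0..T} \<inter> E -` {K..}"
  have A: "t \<in> A" using \<open>\<not> E t < K\<close> t by (auto simp: A_def)
  have cl: "closed A" unfolding A_def
    by (rule continuous_closed_preimage[OF assms(1)]) auto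
  have bd: "bdd_below A" by (rule bdd_belowI[of _ 0]) (auto simp: A_def)
  have t0: "Inf A \<in> A" using closed_contains_Inf[OF _ bd cl] A by auto
  have "E s \<le> K" if "0 \<le> s" "s < Inf A" for s
  proof (rule ccontr)
    assume "\<not> E s \<le> K"
    then have "s \<in> A" using that t0 by (auto simp: A_def)
    then show False using cInf_lower[OF _ bd, of s] that by simp
  qed
  then have "E (Inf A) < K" using t0 by (intro step) (auto simp: A_def)
  then show False using t0 by (auto simp: A_def)
qed

lemma decreasing_within:
  fixes f :: "real \<Rightarrow> real"
  assumes t: "t \<in> {0..T}" and f: "\<And>s. s \<in> {0..T} \<Longrightarrow> (f has_real_derivative f' s) (at s within {0..T})"
    and le: "\<And>s. 0 < s \<Longrightarrow> s < t \<Longrightarrow> f' s \<le> 0"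
  shows "f t \<le> f 0"
proof (cases "t = 0")
  case False
  show ?thesis
  proof (rule DERIV_nonpos_imp_decreasing_open[of 0 t])
    show "0 \<le> t" using t by simp
    show "\<exists>y. DERIV f x :> y \<and> y \<le> 0" if "0 < x" "x < t" for x
    proof -
      have "(f has_real_derivative f' x) (at x within {0..T})" using that t by (intro f) auto
      then have "(f has_real_derivative f' x) (at x)"
        using that t by (simp add: at_within_Icc_at)
      then show ?thesis using le that by blast
    qed
    show "continuous_on {0..t} f"
      using t by (intro DERIV_continuous_on[OF DERIV_subset[OF f]]) auto
  qed
qed simp

text \<open>The properties of the Galerkin approximation with modes \<open>|k| \<le> n\<close> that survive the limit
\<open>n \<rightarrow> \<infinity>\<close>. The last one combines the dissipation with the bound of the flux in H3.\<close>

definition galerkin_sol where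
  "galerkin_sol m M T C n c0 c \<longleftrightarrow> (\<forall>k\<in>modes n. c 0 k = c0 k) \<and>
       (\<forall>t\<in>{0..T}. h3_ball (M + 1) (c t) \<and> (\<forall>x. m / 2 \<le> hseries (c t) x)) \<and>
       (\<forall>t\<in>{0..T}. \<forall>k\<in>modes n. ((\<lambda>t. c t k) has_real_derivative D (flux_coef (m / 2) (c t)) k) (at t within {0..T})) \<and>
       (\<forall>k. continuous_on {0..T} (\<lambda>t. c t k)) \<and>
       (\<forall>k. \<forall>t\<in>{0..T}. \<forall>s\<in>{0..T}. \<bar>c t k - c s k\<bar> \<le> 4 * pi * \<bar>of_int k\<bar> * \<bar>t - s\<bar>) \<and>
       (\<forall>F. finite F \<longrightarrow> integral {0..T} (\<lambda>t. \<Sum>k\<in>F. of_int k ^ 8 * (c t k)\<^sup>2 + of_int k ^ 6 * (flux_coef (m / 2) (c t) k)\<^sup>2) \<le> C)"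

text \<open>The bound of \<open>E\<close>, the squared H3 norm, is a bootstrap: as long as \<open>E \<le> M + 1\<close>, the solution
stays above \<open>m / 2\<close> by \<open>hseries_close\<close>, so the energy estimate applies and shows \<open>E \<le> M + C t\<close>,
which is below \<open>M + 1\<close> for short times.\<close>

lemma galerkin_bounds:
  assumes m: "m > 0" and M: "M \<ge> 0"
  shows "\<exists>T>0. \<exists>C\<ge>0. \<forall>c0. h3_ball M c0 \<and> (\<forall>x. m \<le> hseries c0 x) \<longrightarrow>
    (\<exists>L. \<forall>n\<ge>L. \<exists>c. galerkin_sol m M T C n c0 c)"
proof -
  define \<mu> K where "\<mu> = m / 2" and "K = M + 1"
  have \<mu>: "\<mu> > 0" and K: "K \<ge> 0" using m M by (auto simp: \<mu>_def K_def)
  obtain a C where aC: "a > 0" "C \<ge> 0"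
    and e1': "\<forall>c n. h3_ball K c \<and> (\<forall>k. k \<notin> modes n \<longrightarrow> c k = 0) \<and> (\<forall>x. \<mu> \<le> hseries c x) \<longrightarrow>
       2 * (\<Sum>k\<in>modes n. (1 + of_int k ^ 6) * c k * D (flux_coef \<mu> c) k) + a * (\<Sum>k\<in>modes n. of_int k ^ 8 * (c k)\<^sup>2) \<le> C"
    and e2': "\<forall>c n F. h3_ball K c \<and> (\<forall>k. k \<notin> modes n \<longrightarrow> c k = 0) \<and> (\<forall>x. \<mu> \<le> hseries c x) \<and> finite F \<longrightarrow>
       (\<Sum>k\<in>F. of_int k ^ 6 * (flux_coef \<mu> c k)\<^sup>2) \<le> C * (1 + (\<Sum>k\<in>modes n. of_int k ^ 8 * (c k)\<^sup>2))"
    using galerkin_energy[OF \<mu> K] by blast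
  have e1: "2 * (\<Sum>k\<in>modes n. (1 + of_int k ^ 6) * c k * D (flux_coef \<mu> c) k) + a * (\<Sum>k\<in>modes n. of_int k ^ 8 * (c k)\<^sup>2) \<le> C"
    if "h3_ball K c" "\<And>k. k \<notin> modes n \<Longrightarrow> c k = 0" "\<And>x. \<mu> \<le> hseries c x" for c n
    using e1' that by blast
  have e2: "(\<Sum>k\<in>F. of_int k ^ 6 * (flux_coef \<mu> c k)\<^sup>2) \<le> C * (1 + (\<Sum>k\<in>modes n. of_int k ^ 8 * (c k)\<^sup>2))"
    if "h3_ball K c" "\<And>k. k \<notin> modes n \<Longrightarrow> c k = 0" "\<And>x. \<mu> \<le> hseries c x" "finite F" for c n F
    using e2' that by blast
  obtain L \<delta> where \<delta>: "\<delta> > 0"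
    and close': "\<forall>c d \<tau> x. h3_ball K c \<and> h3_ball K d \<and> \<tau> \<le> \<delta> \<and>
      (\<forall>k\<in>modes L. \<bar>c k - d k\<bar> \<le> 4 * pi * \<bar>of_int k\<bar> * \<tau>) \<longrightarrow> \<bar>hseries c x - hseries d x\<bar> \<le> \<mu>"
    using hseries_close[OF K \<mu>] by blast
  have close: "\<bar>hseries c x - hseries d x\<bar> \<le> \<mu>"
    if "h3_ball K c" "h3_ball K d" "\<tau> \<le> \<delta>" "\<And>k. k \<in> modes L \<Longrightarrow> \<bar>c k - d k\<bar> \<le> 4 * pi * \<bar>of_int k\<bar> * \<tau>"
    for c d \<tau> x using close' that by blast
  define T where "T = min \<delta> (1 / (2 * (C + 1)))"
  have T: "T > 0" "T \<le> \<delta>" using \<delta> aC by (auto simp: T_def)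
  have CT: "C * T < 1"
  proof -
    have "C * T \<le> C * (1 / (2 * (C + 1)))" using aC by (intro mult_left_mono) (auto simp: T_def)
    also have "\<dots> < 1" using aC by (simp add: field_simps)
    finally show ?thesis .
  qed
  define C' where "C' = (1 + C) * ((M + 1) / a) + C * T"
  have C': "C' \<ge> 0" using aC T M by (auto simp: C'_def)
  show ?thesis
  proof (intro exI[of _ T] exI[of _ C'] conjI T(1) C' allI impI; elim conjE)
    fix c0 assume c0: "h3_ball M c0" "\<forall>x. m \<le> hseries c0 x"
    have "\<exists>c. galerkin_sol m M T C' n c0 c"
      if n: "n \<ge> L" for n
    proof -
      obtain c where ci: "c 0 = (\<lambda>k. if k \<in> modes n then c0 k else 0)"
        and supp: "\<And>t k. t \<in> {0..T} \<Longrightarrow> k \<notin> modes n \<Longrightarrow> c t k = 0"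
        and der: "\<And>t k. t \<in> {0..T} \<Longrightarrow> k \<in> modes n \<Longrightarrow>
           ((\<lambda>t. c t k) has_real_derivative D (flux_coef \<mu> (c t)) k) (at t within {0..T})"
        by (rule galerkin_exists[OF \<mu> less_imp_le[OF T(1)], of n "\<lambda>k. if k \<in> modes n then c0 k else 0"]) auto
      have l1: "l1 (c t)" "l1 (D (c t))" if "t \<in> {0..T}" for t
        by (rule l1_finite[of "modes n"]; use supp[OF that] in \<open>auto simp: D_def\<close>)+
      have cont: "continuous_on {0..T} (\<lambda>t. c t k)" for k
      proof (cases "k \<in> modes n")
        case True
        show ?thesis by (rule DERIV_continuous_on) (rule der[OF _ True])
      next
        case False
        show ?thesis
          by (rule continuous_on_eq[OF continuous_on_const[of _ 0]]) (use supp False in auto)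
      qed
      have lip2: "\<bar>c t k - c s k\<bar> \<le> 4 * pi * \<bar>of_int k\<bar> * \<bar>t - s\<bar>"
        if t: "t \<in> {0..T}" and s: "s \<in> {0..T}" for t s k
      proof (cases "k \<in> modes n")
        case k: True
        have "norm (c t k - c s k) \<le> (4 * pi * \<bar>of_int k\<bar>) * norm (t - s)"
        proof (rule field_differentiable_bound[where S = "{0..T}"])
          fix s assume s: "s \<in> {0..T}"
          show "((\<lambda>t. c t k) has_field_derivative D (flux_coef \<mu> (c s)) k) (at s within {0..T})" by (rule der[OF s k])
          show "norm (D (flux_coef \<mu> (c s)) k) \<le> 4 * pi * \<bar>of_int k\<bar>"
            using mult_left_mono[OF abs_flux_coef_le[OF \<mu> l1[OF s], of "-k"], of "\<bar>of_int k\<bar>"]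
            by (simp add: D_def abs_mult mult.commute)
        qed (use t s in auto)
        then show ?thesis by simp
      qed (use supp t s in auto)
      have lip: "\<bar>c t k - c0 k\<bar> \<le> 4 * pi * \<bar>of_int k\<bar> * t" if t: "t \<in> {0..T}" and k: "k \<in> modes n" for t k
        using lip2[OF t, of 0 k] ci k t by simp
      define E where "E t = (\<Sum>k\<in>modes n. (1 + of_int k ^ 6) * (c t k)\<^sup>2)" for t
      define S where "S t = (\<Sum>k\<in>modes n. of_int k ^ 8 * (c t k)\<^sup>2)" for t
      define E' where "E' t = 2 * (\<Sum>k\<in>modes n. (1 + of_int k ^ 6) * c t k * D (flux_coef \<mu> (c t)) k)" for t
      have E_ball: "h3_ball K (c t)" if "t \<in> {0..T}" "E t \<le> K" for t
        unfolding h3_ball_def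
      proof (intro allI impI)
        fix F :: "int set" assume F: "finite F"
        have "(\<Sum>k\<in>F. (1 + of_int k ^ 6) * (c t k)\<^sup>2) = (\<Sum>k\<in>F \<inter> modes n. (1 + of_int k ^ 6) * (c t k)\<^sup>2)"
          using F supp[OF that(1)] by (intro sum.mono_neutral_right) auto
        also have "\<dots> \<le> E t" unfolding E_def by (rule sum_mono2) auto
        finally show "(\<Sum>k\<in>F. (1 + of_int k ^ 6) * (c t k)\<^sup>2) \<le> K" using that(2) by simp
      qed
      have low: "\<mu> \<le> hseries (c t) x" if "t \<in> {0..T}" "E t \<le> K" for t x
      proof -
        have "\<bar>hseries (c t) x - hseries c0 x\<bar> \<le> \<mu>"
        proof (rule close[where \<tau> = t])
          show "h3_ball K (c t)" by (rule E_ball[OF that])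
          show "h3_ball K c0" by (rule h3_ball_mono[OF c0(1)]) (simp add: K_def)
          show "t \<le> \<delta>" using that(1) T by auto
          show "\<bar>c t k - c0 k\<bar> \<le> 4 * pi * \<bar>of_int k\<bar> * t" if "k \<in> modes L" for k
            using lip[OF \<open>t \<in> {0..T}\<close>] that modes_mono[OF n] by blast
        qed
        then show ?thesis using c0(2)[rule_format, of x] unfolding \<mu>_def by linarith
      qed
      have E_der: "(E has_real_derivative E' t) (at t within {0..T})" if "t \<in> {0..T}" for t
      proof -
        have "(E has_real_derivative (\<Sum>k\<in>modes n. (1 + of_int k ^ 6) * (2 * (c t k) * D (flux_coef \<mu> (c t)) k))) (at t within {0..T})"
          unfolding E_def[abs_def]
        proof (intro DERIV_sum DERIV_cmult)
          fix k assume "k \<in> modes n"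
          from DERIV_power[OF der[OF that this], of 2]
          show "((\<lambda>t. (c t k)\<^sup>2) has_real_derivative 2 * c t k * D (flux_coef \<mu> (c t)) k) (at t within {0..T})"
            by (simp add: mult_ac)
        qed
        also have "(\<Sum>k\<in>modes n. (1 + of_int k ^ 6) * (2 * (c t k) * D (flux_coef \<mu> (c t)) k)) = E' t"
          unfolding E'_def sum_distrib_left by (intro sum.cong) auto
        finally show ?thesis .
      qed
      have S_cont: "continuous_on {0..T} S"
        unfolding S_def[abs_def] by (intro continuous_intros cont)
      have S_nonneg: "S t \<ge> 0" for t by (simp add: S_def sum_nonneg)
      \<comment> \<open>The energy estimate says that \<open>H\<close> decreases.\<close>
      define H where "H t = E t + a * integral {0..t} S - C * t" for t
      have H_der: "(H has_real_derivative E' t + a * S t - C) (at t within {0..T})" if "t \<in> {0..T}" for t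
      proof -
        have "((\<lambda>t. C * t) has_real_derivative C) (at t within {0..T})"
          by (auto intro!: derivative_eq_intros)
        then show ?thesis unfolding H_def[abs_def]
          by (intro DERIV_diff DERIV_add E_der DERIV_cmult integral_has_real_derivative S_cont that)
      qed
      have H_le: "E t + a * integral {0..t} S \<le> M + C * t"
        if t: "t \<in> {0..T}" and g: "\<And>s. 0 \<le> s \<Longrightarrow> s < t \<Longrightarrow> E s \<le> K" for t
      proof -
        have "H t \<le> H 0"
        proof (rule decreasing_within[OF t H_der])
          fix s assume s: "0 < s" "s < t"
          then have sT: "s \<in> {0..T}" using t by auto
          have Es: "E s \<le> K" using g s by simp
          have "E' s + a * S s \<le> C" unfolding E'_def S_def
            by (rule e1[OF E_ball[OF sT Es]]) (use supp[OF sT] low[OF sT Es] in auto)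
          then show "E' s + a * S s - C \<le> 0" by simp
        qed
        moreover have "H 0 = E 0" by (simp add: H_def)
        moreover have "E 0 \<le> M"
          using h3_ballD[OF c0(1), of "modes n"] by (simp add: E_def ci)
        ultimately show ?thesis by (simp add: H_def)
      qed
      have I_nonneg: "0 \<le> integral {0..t} S" if "t \<in> {0..T}" for t
        by (intro Henstock_Kurzweil_Integration.integral_nonneg integrable_continuous_interval
            continuous_on_subset[OF S_cont]) (use that S_nonneg in auto)
      have E_lt: "E t < K" if "t \<in> {0..T}" for t
      proof (rule bootstrap[OF _ _ that])
        show "continuous_on {0..T} E" by (rule DERIV_continuous_on[OF E_der])
        fix t assume t: "t \<in> {0..T}" and g: "\<And>s. 0 \<le> s \<Longrightarrow> s < t \<Longrightarrow> E s \<le> K"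
        have "E t \<le> M + C * t"
          using H_le[OF t g] I_nonneg[OF t] aC(1) mult_nonneg_nonneg[of a "integral {0..t} S"] by linarith
        also have "\<dots> \<le> M + C * T" using t aC by (intro add_left_mono mult_left_mono) auto
        also have "\<dots> < K" using CT by (simp add: K_def)
        finally show "E t < K" .
      qed
      then have ball: "h3_ball K (c t)" and lo: "\<mu> \<le> hseries (c t) x" if "t \<in> {0..T}" for t x
        using E_ball low that less_imp_le by blast+
      have IS: "integral {0..T} S \<le> (M + 1) / a"
      proof -
        have Tin: "T \<in> {0..T}" using T by auto
        have "E T + a * integral {0..T} S \<le> M + C * T"
          by (rule H_le[OF Tin]) (use E_lt less_imp_le in auto)
        moreover have "E T \<ge> 0" by (simp add: E_def sum_nonneg)
        ultimately have "a * integral {0..T} S \<le> M + 1" using CT by linarith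
        then show ?thesis using aC by (simp add: field_simps)
      qed
      have fcc: "continuous_on {0..T} (\<lambda>t. flux_coef \<mu> (c t) k)" for k
        by (rule continuous_on_flux_coef[OF \<mu> cont ball])
      have int: "integral {0..T} (\<lambda>t. \<Sum>k\<in>F. of_int k ^ 8 * (c t k)\<^sup>2 + of_int k ^ 6 * (flux_coef \<mu> (c t) k)\<^sup>2) \<le> C'"
        if F: "finite F" for F
      proof -
        have "integral {0..T} (\<lambda>t. \<Sum>k\<in>F. of_int k ^ 8 * (c t k)\<^sup>2 + of_int k ^ 6 * (flux_coef \<mu> (c t) k)\<^sup>2)
            \<le> integral {0..T} (\<lambda>t. (1 + C) * S t + C)"
        proof (rule integral_le)
          show "(\<lambda>t. \<Sum>k\<in>F. of_int k ^ 8 * (c t k)\<^sup>2 + of_int k ^ 6 * (flux_coef \<mu> (c t) k)\<^sup>2) integrable_on {0..T}"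
            by (intro integrable_continuous_interval continuous_intros cont fcc)
          show "(\<lambda>t. (1 + C) * S t + C) integrable_on {0..T}"
            by (intro integrable_continuous_interval continuous_intros S_cont)
          fix t assume t: "t \<in> {0..T}"
          have "(\<Sum>k\<in>F. of_int k ^ 8 * (c t k)\<^sup>2) = (\<Sum>k\<in>F \<inter> modes n. of_int k ^ 8 * (c t k)\<^sup>2)"
            using F supp[OF t] by (intro sum.mono_neutral_right) auto
          also have "\<dots> \<le> S t" unfolding S_def by (rule sum_mono2) auto
          finally have "(\<Sum>k\<in>F. of_int k ^ 8 * (c t k)\<^sup>2) \<le> S t" .
          moreover have "(\<Sum>k\<in>F. of_int k ^ 6 * (flux_coef \<mu> (c t) k)\<^sup>2) \<le> C * (1 + S t)"
            unfolding S_def by (rule e2[OF ball[OF t] _ _ F]) (use supp[OF t] lo[OF t] in auto)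
          ultimately show "(\<Sum>k\<in>F. of_int k ^ 8 * (c t k)\<^sup>2 + of_int k ^ 6 * (flux_coef \<mu> (c t) k)\<^sup>2) \<le> (1 + C) * S t + C"
            by (simp add: sum.distrib algebra_simps)
        qed
        also have "\<dots> = (1 + C) * integral {0..T} S + C * T"
        proof -
          have "S integrable_on {0..T}" by (intro integrable_continuous_interval S_cont)
          then have "((\<lambda>t. (1 + C) * S t + C) has_integral (1 + C) * integral {0..T} S + C * T) {0..T}"
            using has_integral_const_real[of C 0 T] T
            by (intro has_integral_add has_integral_mult_right integrable_integral) (auto simp: mult.commute)
          then show ?thesis by (rule integral_unique)
        qed
        also have "\<dots> \<le> C'" unfolding C'_def using IS aC by (intro add_right_mono mult_left_mono) auto
        finally show ?thesis .
      qed
      show ?thesis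
        by (rule exI[of _ c]) (use ci ball lo der cont lip2 int in \<open>simp add: galerkin_sol_def K_def \<mu>_def\<close>)
    qed
    then show "\<exists>L. \<forall>n\<ge>L. \<exists>c. galerkin_sol m M T C' n c0 c"
      by blast
  qed
qed

section \<open>The limit of the Galerkin approximations\<close>

lemma coef_diff_le:
  assumes c: "h3_ball K c" and d: "h3_ball K d" and e: "\<And>x. x \<in> {-pi..pi} \<Longrightarrow> \<bar>hseries c x - hseries d x\<bar> \<le> e"
  shows "\<bar>c k - d k\<bar> \<le> 2 * pi * e"
proof -
  have l: "l1 c" "l1 d" using h3_ball_l1 c d by auto
  have "c k - d k = ip (\<lambda>x. hseries c x - hseries d x) (hartley k)"
    using l by (simp add: ip_diff_left sq_integrable_hseries sq_integrable_hartley ip_hseries_hartley)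
  then have "\<bar>c k - d k\<bar> \<le> (\<integral>x. \<bar>(hseries c x - hseries d x) * hartley k x\<bar> \<partial>torus)"
    by (simp only: ip_def integral_abs_bound)
  also have "\<dots> \<le> (\<integral>x. e \<partial>torus)"
  proof (rule integral_mono)
    show "integrable torus (\<lambda>x. \<bar>(hseries c x - hseries d x) * hartley k x\<bar>)"
      by (rule integrable_torus_continuous)
         (rule continuous_on_rabs continuous_on_mult continuous_on_diff continuous_on_hseries l continuous_on_hartley)+
    show "\<bar>(hseries c x - hseries d x) * hartley k x\<bar> \<le> e" if "x \<in> space torus" for x
      using order_trans[OF abs_hartley_mult_le e] that by simp
  qed simp
  also have "\<dots> = 2 * pi * e" using measure_torus by simp
  finally show ?thesis .
qed

lemma hseries_lipschitz:
  assumes "h3_ball K c" shows "\<bar>hseries c x - hseries c y\<bar> \<le> sup_const * sqrt K * \<bar>x - y\<bar>"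
proof -
  have "norm (hseries c x - hseries c y) \<le> (sup_const * sqrt K) * norm (x - y)"
    by (rule field_differentiable_bound[where S = UNIV and f' = "hseries (D c)"])
       (use h3_ball_deriv(1)[OF assms] h3_ball_hseries_le(2)[OF assms] in auto)
  then show ?thesis by simp
qed

text \<open>Arzela and Ascoli for the functions of \<open>(t, x)\<close>. Uniform convergence in \<open>x\<close> makes the
coefficients converge at every time.\<close>

lemma convergent_subsequence:
  fixes c :: "nat \<Rightarrow> real \<Rightarrow> int \<Rightarrow> real"
  assumes T: "T > 0" and ball: "\<And>n t. t \<in> {0..T} \<Longrightarrow> h3_ball K (c n t)"
    and lip: "\<And>n k t s. t \<in> {0..T} \<Longrightarrow> s \<in> {0..T} \<Longrightarrow> \<bar>c n t k - c n s k\<bar> \<le> 4 * pi * \<bar>of_int k\<bar> * \<bar>t - s\<bar>"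
  shows "\<exists>r d. strict_mono (r :: nat \<Rightarrow> nat) \<and> (\<forall>t\<in>{0..T}. \<forall>k. (\<lambda>j. c (r j) t k) \<longlonglongrightarrow> d t k)"
proof -
  define B where "B = sup_const * sqrt K"
  have K: "K \<ge> 0" using ball[of 0] T h3_ball_nonneg by auto
  have B: "B \<ge> 0" using K sup_const_nonneg by (simp add: B_def)
  define S where "S = {0..T} \<times> {-pi..pi}"
  define F where "F n z = hseries (c n (fst z)) (snd z)" for n and z :: "real \<times> real"
  obtain g r where r: "strict_mono (r :: nat \<Rightarrow> nat)"
    and conv: "\<And>e. 0 < e \<Longrightarrow> \<exists>N. \<forall>n x. n \<ge> N \<and> x \<in> S \<longrightarrow> norm (F (r n) x - g x) < e"
  proof (rule Arzela_Ascoli[of S F B])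
    show "compact S" unfolding S_def by (intro compact_Times compact_Icc)
    show "norm (F n z) \<le> B" if "z \<in> S" for n z
      using that h3_ball_hseries_le(1)[OF ball] by (auto simp: S_def F_def B_def)
    fix z e assume z: "z \<in> S" and e: "(0::real) < e"
    obtain L \<delta> where \<delta>: "\<delta> > 0" and close: "\<forall>c d \<tau> x. h3_ball K c \<and> h3_ball K d \<and> \<tau> \<le> \<delta> \<and>
      (\<forall>k\<in>modes L. \<bar>c k - d k\<bar> \<le> 4 * pi * \<bar>of_int k\<bar> * \<tau>) \<longrightarrow> \<bar>hseries c x - hseries d x\<bar> \<le> e / 3"
      using hseries_close[OF K, of "e / 3"] e by auto
    define \<eta> where "\<eta> = min \<delta> (e / (3 * (B + 1)))"
    have \<eta>: "\<eta> > 0" using \<delta> e B by (simp add: \<eta>_def)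
    have "norm (F n z - F n w) < e" if w: "w \<in> S" "norm (z - w) < \<eta>" for n w
    proof -
      obtain t x s y where tx: "z = (t, x)" "w = (s, y)" by (cases z, cases w)
      have ts: "t \<in> {0..T}" "s \<in> {0..T}" using z w tx by (auto simp: S_def)
      have n1: "\<bar>t - s\<bar> \<le> norm (z - w)" "\<bar>x - y\<bar> \<le> norm (z - w)"
        using norm_fst_le[of "t - s" "x - y"] norm_snd_le[of "x - y" "t - s"] by (auto simp: tx)
      have 1: "\<bar>hseries (c n t) x - hseries (c n s) x\<bar> \<le> e / 3"
        using close[rule_format, of "c n t" "c n s" "\<bar>t - s\<bar>" x] ball lip ts n1 w(2) by (auto simp: \<eta>_def)
      have "\<bar>hseries (c n s) x - hseries (c n s) y\<bar> \<le> B * \<bar>x - y\<bar>"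
        unfolding B_def by (rule hseries_lipschitz[OF ball[OF ts(2)]])
      also have "\<dots> \<le> B * (e / (3 * (B + 1)))" using n1 w(2) B by (intro mult_left_mono) (auto simp: \<eta>_def)
      also have "\<dots> \<le> e / 3" using B e by (simp add: field_simps)
      finally have 2: "\<bar>hseries (c n s) x - hseries (c n s) y\<bar> \<le> e / 3" .
      show ?thesis unfolding F_def tx fst_conv snd_conv real_norm_def using 1 2 e by linarith
    qed
    then show "\<exists>d>0. \<forall>n y. y \<in> S \<and> norm (z - y) < d \<longrightarrow> norm (F n z - F n y) < e"
      using \<eta> by blast
  qed auto
  have "convergent (\<lambda>j. c (r j) t k)" if t: "t \<in> {0..T}" for t k
  proof (rule Cauchy_convergent, rule metric_CauchyI)
    fix e :: real assume e: "e > 0"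
    define e' where "e' = e / (8 * pi)"
    have e': "e' > 0" "2 * pi * (2 * e') < e" using e by (auto simp: e'_def)
    obtain N where N: "\<And>n x. n \<ge> N \<Longrightarrow> x \<in> S \<Longrightarrow> norm (F (r n) x - g x) < e'"
      using conv[OF e'(1)] by blast
    have "dist (c (r i) t k) (c (r j) t k) < e" if "i \<ge> N" "j \<ge> N" for i j
    proof -
      have "\<bar>c (r i) t k - c (r j) t k\<bar> \<le> 2 * pi * (2 * e')"
      proof (rule coef_diff_le[OF ball[OF t] ball[OF t]])
        fix x :: real assume "x \<in> {-pi..pi}"
        then have "(t, x) \<in> S" using t by (simp add: S_def)
        then have "norm (F (r i) (t, x) - g (t, x)) < e'" "norm (F (r j) (t, x) - g (t, x)) < e'"
          using N that by auto
        then show "\<bar>hseries (c (r i) t) x - hseries (c (r j) t) x\<bar> \<le> 2 * e'" by (simp add: F_def)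
      qed
      then show ?thesis using e'(2) by (simp add: dist_real_def)
    qed
    then show "\<exists>M. \<forall>m\<ge>M. \<forall>n\<ge>M. dist (c (r m) t k) (c (r n) t k) < e" by blast
  qed
  then show ?thesis
    using r by (intro exI[of _ r] exI[of _ "\<lambda>t k. lim (\<lambda>j. c (r j) t k)"]) (auto simp: convergent_LIMSEQ_iff)
qed

text \<open>The integrated equation for the coefficients. The majorant \<open>\<beta>\<close>, which does not depend on time, encodes
boundedness in H3 with uniformly small tails.\<close>

definition coef_solution ::
    "real \<Rightarrow> real \<Rightarrow> real \<Rightarrow> (int \<Rightarrow> real) \<Rightarrow> (real \<Rightarrow> int \<Rightarrow> real) \<Rightarrow> (int \<Rightarrow> real) \<Rightarrow> bool" where
  "coef_solution \<mu> K T c0 d \<beta> \<longleftrightarrow>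
     (\<forall>t\<in>{0..T}. h3_ball K (d t) \<and> (\<forall>x. \<mu> \<le> hseries (d t) x)) \<and>
     (\<forall>k. continuous_on {0..T} (\<lambda>t. d t k)) \<and>
     (\<forall>t\<in>{0..T}. \<forall>k. d t k = c0 k + integral {0..t} (\<lambda>s. D (flux_coef \<mu> (d s)) k)) \<and>
     \<beta> summable_on UNIV \<and> (\<forall>t\<in>{0..T}. \<forall>k. (1 + of_int k ^ 6) * (d t k)\<^sup>2 \<le> \<beta> k)"

text \<open>The integral equation and the integrated bounds pass to the limit by dominated convergence. For
the majorant, multiply the equation of the mode \<open>k\<close> by \<open>2 k^6 d_k\<close>; the right-hand side is at most
\<open>k^8 d_k\<^sup>2\<close> plus \<open>k^6\<close> times the square of a flux coefficient, and both are summable over \<open>k\<close>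
after integration in time.\<close>

lemma coef_solution_exists:
  assumes m: "m > 0" and M: "M \<ge> 0"
  shows "\<exists>T>0. \<forall>c0. h3_ball M c0 \<and> (\<forall>x. m \<le> hseries c0 x) \<longrightarrow> (\<exists>d \<beta>. coef_solution (m / 2) (M + 1) T c0 d \<beta>)"
proof -
  obtain T C where T: "T > 0" and C: "C \<ge> 0"
    and gal: "\<forall>c0. h3_ball M c0 \<and> (\<forall>x. m \<le> hseries c0 x) \<longrightarrow> (\<exists>L. \<forall>n\<ge>L. \<exists>c. galerkin_sol m M T C n c0 c)"
    using galerkin_bounds[OF m M] by blast
  define \<mu> K where "\<mu> = m / 2" and "K = M + 1"
  have \<mu>: "\<mu> > 0" using m by (simp add: \<mu>_def)
  have "\<exists>d \<beta>. coef_solution \<mu> K T c0 d \<beta>" if c0: "h3_ball M c0" "\<forall>x. m \<le> hseries c0 x" for c0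
  proof -
    obtain L where "\<forall>n\<ge>L. \<exists>c. galerkin_sol m M T C n c0 c" using gal c0 by blast
    then have "\<forall>n. \<exists>c. galerkin_sol m M T C (n + L) c0 c" by simp
    then obtain c where c: "\<And>n. galerkin_sol m M T C (n + L) c0 (c n)" by metis
    note c' = c[unfolded galerkin_sol_def, folded \<mu>_def K_def]
    have init: "c n 0 k = c0 k" if "k \<in> modes (n + L)" for n k using c'[of n] that by blast
    have ball: "h3_ball K (c n t)" if "t \<in> {0..T}" for n t using c'[of n] that by blast
    have low: "\<mu> \<le> hseries (c n t) x" if "t \<in> {0..T}" for n t x using c'[of n] that by blast
    have der: "((\<lambda>t. c n t k) has_real_derivative D (flux_coef \<mu> (c n t)) k) (at t within {0..T})"
      if "t \<in> {0..T}" "k \<in> modes (n + L)" for n t k using c'[of n] that by blast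
    have cont: "continuous_on {0..T} (\<lambda>t. c n t k)" for n k using c'[of n] by blast
    have lip: "\<bar>c n t k - c n s k\<bar> \<le> 4 * pi * \<bar>of_int k\<bar> * \<bar>t - s\<bar>" if "t \<in> {0..T}" "s \<in> {0..T}" for n t s k
      using c'[of n] that by blast
    have en: "integral {0..T} (\<lambda>t. \<Sum>k\<in>F. of_int k ^ 8 * (c n t k)\<^sup>2 + of_int k ^ 6 * (flux_coef \<mu> (c n t) k)\<^sup>2) \<le> C"
      if "finite F" for n F using c'[of n] that by blast
    obtain r d where r: "strict_mono (r :: nat \<Rightarrow> nat)" and lim: "\<forall>t\<in>{0..T}. \<forall>k. (\<lambda>j. c (r j) t k) \<longlonglongrightarrow> d t k"
    proof -
      have "\<exists>r d. strict_mono (r :: nat \<Rightarrow> nat) \<and> (\<forall>t\<in>{0..T}. \<forall>k. (\<lambda>j. c (r j) t k) \<longlonglongrightarrow> d t k)"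
        by (rule convergent_subsequence[where K = K, OF T]) (rule ball lip; assumption)+
      then show ?thesis using that by blast
    qed
    have lim: "(\<lambda>j. c (r j) t k) \<longlonglongrightarrow> d t k" if "t \<in> {0..T}" for t k using lim that by blast
    have dball: "h3_ball K (d t)" if "t \<in> {0..T}" for t
      by (rule h3_ball_limit[OF lim[OF that] ball[OF that]])
    have dlow: "\<mu> \<le> hseries (d t) x" if "t \<in> {0..T}" for t x
      by (rule tendsto_lowerbound[OF hseries_limit[OF lim[OF that] ball[OF that]]]) (simp_all add: low[OF that])
    have fclim: "(\<lambda>j. flux_coef \<mu> (c (r j) t) k) \<longlonglongrightarrow> flux_coef \<mu> (d t) k" if "t \<in> {0..T}" for t k
      by (rule flux_coef_tendsto[OF \<mu> lim[OF that] ball[OF that]])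
    have fccont: "continuous_on {0..T} (\<lambda>t. flux_coef \<mu> (c n t) k)" for n k
      by (rule continuous_on_flux_coef[OF \<mu> cont ball])
    have fcle: "\<bar>flux_coef \<mu> e k\<bar> \<le> 4 * pi" if "h3_ball K e" for e k
      by (rule abs_flux_coef_le[OF \<mu>]) (use h3_ball_l1[OF that] in auto)
    have duh: "d t k = c0 k + integral {0..t} (\<lambda>s. D (flux_coef \<mu> (d s)) k)"
      and dint: "(\<lambda>s. D (flux_coef \<mu> (d s)) k) integrable_on {0..t}" if t: "t \<in> {0..T}" for t k
    proof -
      have sub: "s \<in> {0..T}" if "s \<in> {0..t}" for s using that t by auto
      have ii: "(\<lambda>s. D (flux_coef \<mu> (c (r j) s)) k) integrable_on {0..t}" for j
        unfolding D_def using t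
        by (intro integrable_continuous_interval continuous_intros continuous_on_subset[OF fccont]) auto
      have bb: "norm (D (flux_coef \<mu> (c (r j) s)) k) \<le> \<bar>of_int k\<bar> * (4 * pi)" if "s \<in> {0..t}" for j s
        using mult_left_mono[OF fcle[OF ball[OF sub[OF that], of "r j"], of "-k"], of "\<bar>of_int k\<bar>"]
        by (simp add: D_def abs_mult)
      have ll: "(\<lambda>j. D (flux_coef \<mu> (c (r j) s)) k) \<longlonglongrightarrow> D (flux_coef \<mu> (d s)) k" if "s \<in> {0..t}" for s
        unfolding D_def by (intro tendsto_intros fclim sub that)
      have dc: "(\<lambda>s. D (flux_coef \<mu> (d s)) k) integrable_on {0..t}"
        "(\<lambda>j. integral {0..t} (\<lambda>s. D (flux_coef \<mu> (c (r j) s)) k)) \<longlonglongrightarrow> integral {0..t} (\<lambda>s. D (flux_coef \<mu> (d s)) k)"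
        using dominated_convergence[OF ii integrable_const_ivl bb ll] by auto
      show "(\<lambda>s. D (flux_coef \<mu> (d s)) k) integrable_on {0..t}" by (rule dc)
      have ev: "c (r j) t k = c0 k + integral {0..t} (\<lambda>s. D (flux_coef \<mu> (c (r j) s)) k)" if j: "j \<ge> nat \<bar>k\<bar>" for j
      proof -
        have "j \<le> r j" using r by (rule seq_suble)
        then have kZ: "k \<in> modes (r j + L)" using j by auto
        have "((\<lambda>s. D (flux_coef \<mu> (c (r j) s)) k) has_integral c (r j) t k - c (r j) 0 k) {0..t}"
        proof (rule fundamental_theorem_of_calculus)
          fix s assume s: "s \<in> {0..t}"
          have "((\<lambda>t. c (r j) t k) has_real_derivative D (flux_coef \<mu> (c (r j) s)) k) (at s within {0..t})"
            by (rule DERIV_subset[OF der[OF sub[OF s] kZ]]) (use t in auto)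
          then show "((\<lambda>t. c (r j) t k) has_vector_derivative D (flux_coef \<mu> (c (r j) s)) k) (at s within {0..t})"
            by (simp only: has_real_derivative_iff_has_vector_derivative)
        qed (use t in auto)
        then show ?thesis using init[OF kZ] by (simp add: integral_unique)
      qed
      have "(\<lambda>j. c0 k + integral {0..t} (\<lambda>s. D (flux_coef \<mu> (c (r j) s)) k)) \<longlonglongrightarrow> d t k"
        by (rule Lim_transform_eventually[OF lim[OF t]]) (rule eventually_sequentiallyI[OF ev])
      moreover have "(\<lambda>j. c0 k + integral {0..t} (\<lambda>s. D (flux_coef \<mu> (c (r j) s)) k))
          \<longlonglongrightarrow> c0 k + integral {0..t} (\<lambda>s. D (flux_coef \<mu> (d s)) k)"
        by (intro tendsto_intros dc)
      ultimately show "d t k = c0 k + integral {0..t} (\<lambda>s. D (flux_coef \<mu> (d s)) k)" by (rule LIMSEQ_unique)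
    qed
    have T_in: "T \<in> {0..T}" using T by simp
    have dcont: "continuous_on {0..T} (\<lambda>t. d t k)" for k
    proof (rule continuous_on_eq)
      show "continuous_on {0..T} (\<lambda>t. c0 k + integral {0..t} (\<lambda>s. D (flux_coef \<mu> (d s)) k))"
        by (intro continuous_intros indefinite_integral_continuous_1 dint T_in)
    qed (use duh in auto)
    have dfc: "continuous_on {0..T} (\<lambda>t. flux_coef \<mu> (d t) k)" for k
      by (rule continuous_on_flux_coef[OF \<mu> dcont dball])
    define I8 where "I8 k = integral {0..T} (\<lambda>t. of_int k ^ 8 * (d t k)\<^sup>2)" for k
    define I6 where "I6 k = integral {0..T} (\<lambda>t. of_int k ^ 6 * (flux_coef \<mu> (d t) k)\<^sup>2)" for k
    have i8: "(\<lambda>t. of_int k ^ 8 * (d t k)\<^sup>2) integrable_on {0..T}"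
      and i6: "(\<lambda>t. of_int k ^ 6 * (flux_coef \<mu> (d t) k)\<^sup>2) integrable_on {0..T}" for k
      by (intro integrable_continuous_interval continuous_intros dcont dfc)+
    have I_nonneg: "I8 k \<ge> 0" "I6 k \<ge> 0" for k
      unfolding I8_def I6_def by (intro Henstock_Kurzweil_Integration.integral_nonneg i8 i6; simp)+
    have I_sum: "(\<Sum>k\<in>F. I8 k + I6 k) \<le> C" if F: "finite F" for F
    proof -
      define b where "b = (\<Sum>k\<in>F. of_int k ^ 8 * K + of_int k ^ 6 * (4 * pi)\<^sup>2)"
      have "(\<lambda>j. integral {0..T} (\<lambda>t. \<Sum>k\<in>F. of_int k ^ 8 * (c (r j) t k)\<^sup>2 + of_int k ^ 6 * (flux_coef \<mu> (c (r j) t) k)\<^sup>2))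
         \<longlonglongrightarrow> integral {0..T} (\<lambda>t. \<Sum>k\<in>F. of_int k ^ 8 * (d t k)\<^sup>2 + of_int k ^ 6 * (flux_coef \<mu> (d t) k)\<^sup>2)"
      proof (rule dominated_convergence(2)[where h = "\<lambda>t. b"])
        show "(\<lambda>t. \<Sum>k\<in>F. of_int k ^ 8 * (c (r j) t k)\<^sup>2 + of_int k ^ 6 * (flux_coef \<mu> (c (r j) t) k)\<^sup>2) integrable_on {0..T}" for j
          by (intro integrable_continuous_interval continuous_intros cont fccont)
        show "(\<lambda>j. \<Sum>k\<in>F. of_int k ^ 8 * (c (r j) t k)\<^sup>2 + of_int k ^ 6 * (flux_coef \<mu> (c (r j) t) k)\<^sup>2)
          \<longlonglongrightarrow> (\<Sum>k\<in>F. of_int k ^ 8 * (d t k)\<^sup>2 + of_int k ^ 6 * (flux_coef \<mu> (d t) k)\<^sup>2)" if "t \<in> {0..T}" for t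
          by (intro tendsto_intros lim fclim that)
        show "norm (\<Sum>k\<in>F. of_int k ^ 8 * (c (r j) t k)\<^sup>2 + of_int k ^ 6 * (flux_coef \<mu> (c (r j) t) k)\<^sup>2) \<le> b"
          if t: "t \<in> {0..T}" for j t
        proof -
          have "(c (r j) t k)\<^sup>2 \<le> K" for k
          proof -
            have "(1 + of_int k ^ 6) * (c (r j) t k)\<^sup>2 \<le> K"
              using h3_ballD[OF ball[OF t, of "r j"], of "{k}"] by simp
            moreover have "1 * (c (r j) t k)\<^sup>2 \<le> (1 + of_int k ^ 6) * (c (r j) t k)\<^sup>2"
              by (intro mult_right_mono) auto
            ultimately show ?thesis by simp
          qed
          moreover have "(flux_coef \<mu> (c (r j) t) k)\<^sup>2 \<le> (4 * pi)\<^sup>2" for k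
            using power_mono[OF fcle[OF ball[OF t, of "r j"], of k] abs_ge_zero, of 2] by simp
          ultimately have "(\<Sum>k\<in>F. of_int k ^ 8 * (c (r j) t k)\<^sup>2 + of_int k ^ 6 * (flux_coef \<mu> (c (r j) t) k)\<^sup>2) \<le> b"
            unfolding b_def by (intro sum_mono add_mono mult_left_mono) auto
          moreover have "0 \<le> (\<Sum>k\<in>F. of_int k ^ 8 * (c (r j) t k)\<^sup>2 + of_int k ^ 6 * (flux_coef \<mu> (c (r j) t) k)\<^sup>2)"
            by (intro sum_nonneg) auto
          ultimately show ?thesis by simp
        qed
      qed (rule integrable_const_ivl)
      then have "integral {0..T} (\<lambda>t. \<Sum>k\<in>F. of_int k ^ 8 * (d t k)\<^sup>2 + of_int k ^ 6 * (flux_coef \<mu> (d t) k)\<^sup>2) \<le> C"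
        by (rule tendsto_upperbound) (simp_all add: en[OF F])
      also have "integral {0..T} (\<lambda>t. \<Sum>k\<in>F. of_int k ^ 8 * (d t k)\<^sup>2 + of_int k ^ 6 * (flux_coef \<mu> (d t) k)\<^sup>2)
         = (\<Sum>k\<in>F. I8 k + I6 k)"
        unfolding I8_def I6_def Henstock_Kurzweil_Integration.integral_add[OF i8 i6, symmetric]
        by (rule Henstock_Kurzweil_Integration.integral_sum[OF F Henstock_Kurzweil_Integration.integrable_add[OF i8 i6]])
      finally show ?thesis .
    qed
    have key: "of_int k ^ 6 * (d t k)\<^sup>2 \<le> of_int k ^ 6 * (c0 k)\<^sup>2 + (I8 k + I6 (-k))" if t: "t \<in> {0..T}" for t k
    proof -
      define q where "q s = of_int k ^ 8 * (d s k)\<^sup>2 + of_int (-k) ^ 6 * (flux_coef \<mu> (d s) (-k))\<^sup>2" for s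
      have qc: "continuous_on {0..T} q" unfolding q_def[abs_def] by (intro continuous_intros dcont dfc)
      have dd: "((\<lambda>t. d t k) has_real_derivative D (flux_coef \<mu> (d s)) k) (at s within {0..T})" if s: "s \<in> {0..T}" for s
      proof -
        have cD: "continuous_on {0..T} (\<lambda>s. D (flux_coef \<mu> (d s)) k)" unfolding D_def by (intro continuous_intros dfc)
        have "((\<lambda>t. c0 k + integral {0..t} (\<lambda>s. D (flux_coef \<mu> (d s)) k)) has_real_derivative 0 + D (flux_coef \<mu> (d s)) k) (at s within {0..T})"
          by (intro DERIV_add DERIV_const integral_has_real_derivative cD s)
        then have "((\<lambda>t. c0 k + integral {0..t} (\<lambda>s. D (flux_coef \<mu> (d s)) k)) has_real_derivative D (flux_coef \<mu> (d s)) k) (at s within {0..T})"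
          by simp
        then show ?thesis
          by (rule has_field_derivative_transform_within[OF _ zero_less_one s]) (metis duh)
      qed
      \<comment> \<open>The derivative of \<open>\<phi>\<close> is minus a square.\<close>
      define \<phi> where "\<phi> s = of_int k ^ 6 * (d s k)\<^sup>2 - integral {0..s} q" for s
      have "\<phi> t \<le> \<phi> 0"
      proof (rule decreasing_within[OF t])
        fix s assume s: "s \<in> {0..T}"
        have "((\<lambda>s. (d s k)\<^sup>2) has_real_derivative 2 * (d s k * D (flux_coef \<mu> (d s)) k)) (at s within {0..T})"
          using DERIV_power[OF dd[OF s], of 2] by (simp add: mult_ac)
        then show "(\<phi> has_real_derivative of_int k ^ 6 * (2 * (d s k * D (flux_coef \<mu> (d s)) k)) - q s) (at s within {0..T})"
          unfolding \<phi>_def[abs_def] by (intro DERIV_diff DERIV_cmult integral_has_real_derivative qc s)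
      next
        fix s
        define x y where "x = of_int k ^ 4 * d s k" and "y = of_int k ^ 3 * flux_coef \<mu> (d s) (-k)"
        have "of_int k ^ 6 * (2 * (d s k * D (flux_coef \<mu> (d s)) k)) - q s = - (2 * x * y) - (x\<^sup>2 + y\<^sup>2)"
          by (simp add: q_def x_def y_def D_def power_mult_distrib power_numeral_reduce)
        also have "\<dots> = - ((x + y)\<^sup>2)" by (simp add: power2_sum)
        finally show "of_int k ^ 6 * (2 * (d s k * D (flux_coef \<mu> (d s)) k)) - q s \<le> 0" by simp
      qed
      moreover have "\<phi> 0 = of_int k ^ 6 * (c0 k)\<^sup>2" using duh[of 0 k] T by (simp add: \<phi>_def)
      moreover have "integral {0..t} q \<le> integral {0..T} q"
        using t by (intro integral_subset_le integrable_continuous_interval continuous_on_subset[OF qc]) (auto simp: q_def)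
      moreover have "integral {0..T} q = I8 k + I6 (-k)"
        unfolding q_def[abs_def] I8_def I6_def by (rule Henstock_Kurzweil_Integration.integral_add[OF i8 i6])
      ultimately show ?thesis using \<phi>_def[of t] by linarith
    qed
    \<comment> \<open>The factor 2 absorbs the weight \<open>1 + k^6\<close> for nonzero \<open>k\<close>; for \<open>k = 0\<close> the weight is 1 and the H3 ball
    provides the bound.\<close>
    define \<beta> where "\<beta> k = 2 * ((1 + of_int k ^ 6) * (c0 k)\<^sup>2 + (I8 k + I6 (-k))) + (if k = 0 then K else 0)" for k
    have \<beta>_nonneg: "\<beta> k \<ge> 0" for k
      using I_nonneg h3_ball_nonneg[OF dball[OF T_in]] by (auto simp: \<beta>_def intro!: add_nonneg_nonneg)
    have \<beta>_summable: "\<beta> summable_on UNIV"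
    proof (rule nonneg_bdd_above_summable_on)
      show "bdd_above (sum \<beta> ` {F. F \<subseteq> UNIV \<and> finite F})"
      proof (rule bdd_aboveI2)
        fix F :: "int set" assume "F \<in> {F. F \<subseteq> UNIV \<and> finite F}"
        then have F: "finite F" by simp
        have "sum \<beta> F = 2 * ((\<Sum>k\<in>F. (1 + of_int k ^ 6) * (c0 k)\<^sup>2) + ((\<Sum>k\<in>F. I8 k) + (\<Sum>k\<in>F. I6 (-k)))) + (\<Sum>k\<in>F. if k = 0 then K else 0)"
          unfolding \<beta>_def by (simp only: sum.distrib sum_distrib_left[symmetric])
        also have "(\<Sum>k\<in>F. (1 + of_int k ^ 6) * (c0 k)\<^sup>2) \<le> M" by (rule h3_ballD[OF c0(1) F])
        also have "(\<Sum>k\<in>F. I8 k) \<le> (\<Sum>k\<in>F. I8 k + I6 k)" by (intro sum_mono) (simp add: I_nonneg)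
        also have "\<dots> \<le> C" by (rule I_sum[OF F])
        also have "(\<Sum>k\<in>F. I6 (-k)) = (\<Sum>k\<in>uminus ` F. I6 k)" by (rule sum_uminus)
        also have "\<dots> \<le> (\<Sum>k\<in>uminus ` F. I8 k + I6 k)" by (intro sum_mono) (simp add: I_nonneg)
        also have "\<dots> \<le> C" using F by (intro I_sum) simp
        also have "(\<Sum>k\<in>F. if k = 0 then K else 0) \<le> K"
          using F h3_ball_nonneg[OF dball[OF T_in]] by simp
        finally show "sum \<beta> F \<le> 2 * (M + (C + C)) + K" by simp
      qed
    qed (use \<beta>_nonneg in auto)
    have \<beta>_bound: "(1 + of_int k ^ 6) * (d t k)\<^sup>2 \<le> \<beta> k" if t: "t \<in> {0..T}" for t k
    proof (cases "k = 0")
      case True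
      have "(1 + of_int k ^ 6) * (d t k)\<^sup>2 \<le> K" using h3_ballD[OF dball[OF t], of "{k}"] by simp
      also have "\<dots> \<le> \<beta> k" using True I_nonneg by (simp add: \<beta>_def)
      finally show ?thesis .
    next
      case False
      then have "1 \<le> \<bar>real_of_int k\<bar>" by linarith
      then have "1 \<le> \<bar>real_of_int k\<bar> ^ 6" by (rule one_le_power)
      then have "1 \<le> real_of_int k ^ 6" by (simp add: power_even_abs)
      then have "(1 + of_int k ^ 6) * (d t k)\<^sup>2 \<le> (2 * of_int k ^ 6) * (d t k)\<^sup>2"
        by (intro mult_right_mono) auto
      also have "\<dots> = 2 * (of_int k ^ 6 * (d t k)\<^sup>2)" by simp
      also have "\<dots> \<le> 2 * (of_int k ^ 6 * (c0 k)\<^sup>2 + (I8 k + I6 (-k)))" using key[OF t, of k] by simp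
      also have "\<dots> \<le> \<beta> k" using False by (simp add: \<beta>_def distrib_right)
      finally show ?thesis .
    qed
    have "coef_solution \<mu> K T c0 d \<beta>"
      unfolding coef_solution_def using dball dlow dcont duh \<beta>_summable \<beta>_bound by blast
    then show ?thesis by blast
  qed
  then have "\<forall>c0. h3_ball M c0 \<and> (\<forall>x. m \<le> hseries c0 x) \<longrightarrow> (\<exists>d \<beta>. coef_solution (m / 2) (M + 1) T c0 d \<beta>)"
    unfolding \<mu>_def K_def by blast
  with T show ?thesis by blast
qed

section \<open>Existence\<close>

definition arctan_rhs :: "(int \<Rightarrow> real) \<Rightarrow> real \<Rightarrow> real" where
  "arctan_rhs c x = (hseries c x * hseries (D (D c)) x - (hseries (D c) x)\<^sup>2) / ((hseries c x)\<^sup>2 + (hseries (D c) x)\<^sup>2)"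

lemma flux_deriv:
  assumes c: "h3_ball K c" and pos: "\<And>x. 0 < hseries c x"
  shows "((\<lambda>x. arctan (hseries (D c) x / hseries c x)) has_real_derivative arctan_rhs c x) (at x)"
  unfolding arctan_rhs_def by (rule DERIV_arctan_quotient[OF h3_ball_deriv[OF c] pos])

lemma deriv_hseries: "h3_ball K c \<Longrightarrow> deriv (hseries c) = hseries (D c)"
  using h3_ball_deriv(1) by (intro ext DERIV_imp_deriv)

lemma arctan_rhs_continuous:
  assumes c: "h3_ball K c" and pos: "\<And>x. 0 < hseries c x"
  shows "continuous_on A (arctan_rhs c)"
proof -
  have "(hseries c x)\<^sup>2 + (hseries (D c) x)\<^sup>2 \<noteq> 0" for x
    using pos[of x] by (simp add: sum_power2_eq_zero_iff)
  then show ?thesis unfolding arctan_rhs_def[abs_def]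
    using h3_ball_l1[OF c] by (auto intro!: continuous_intros continuous_on_hseries)
qed

lemma arctan_rhs_coef:
  assumes c: "h3_ball K c" and low: "\<And>x. \<mu> \<le> hseries c x" and \<mu>: "\<mu> > 0"
  shows "ip (arctan_rhs c) (hartley k) = D (flux_coef \<mu> c) k"
proof -
  have pos: "0 < hseries c x" for x using low[of x] \<mu> by simp
  have "ip (arctan_rhs c) (hartley k) = D (\<lambda>k. ip (\<lambda>x. arctan (hseries (D c) x / hseries c x)) (hartley k)) k"
    by (rule ip_deriv_hartley[OF flux_deriv[OF c pos] arctan_rhs_continuous[OF c pos]]) (simp add: hseries_periodic)
  also have "(\<lambda>x. arctan (hseries (D c) x / hseries c x)) = (\<lambda>x. flux \<mu> (hseries c x) (hseries (D c) x))"
    by (simp add: flux_def max_absorb1[OF low])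
  finally show ?thesis by (simp add: flux_coef_def[abs_def])
qed

text \<open>A majorant for the coefficients of a function and its first two derivatives. The reflected
summand is there because \<open>D\<close> reflects the index.\<close>

definition unif_bound :: "(int \<Rightarrow> real) \<Rightarrow> int \<Rightarrow> real" where
  "unif_bound \<beta> k = (32 / (1 + (of_int k)\<^sup>2) + \<beta> k) + (32 / (1 + (of_int k)\<^sup>2) + \<beta> (- k))"

lemma unif_bound_summable:
  assumes "\<beta> summable_on UNIV" shows "unif_bound \<beta> summable_on UNIV"
proof -
  have w: "(\<lambda>k::int. 32 * (1 / (1 + (of_int k)\<^sup>2)) :: real) summable_on UNIV"
    by (intro summable_on_cmult_right summable_weight)
  have "(\<beta> \<circ> uminus) summable_on UNIV"
    by (subst summable_on_reindex[symmetric]) (use assms in \<open>auto simp: inj_on_def\<close>)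
  then have "(\<lambda>k. (32 * (1 / (1 + (of_int k)\<^sup>2)) + \<beta> k) + (32 * (1 / (1 + (of_int k)\<^sup>2)) + \<beta> (- k))) summable_on UNIV"
    by (intro summable_on_add w assms) (simp add: o_def)
  then show ?thesis by (simp add: unif_bound_def[abs_def])
qed

lemma le_unif_bound:
  assumes "\<And>k. (1 + of_int k ^ 6) * (c k)\<^sup>2 \<le> \<beta> k"
  shows "\<bar>c k\<bar> \<le> unif_bound \<beta> k" "\<bar>D c k\<bar> \<le> unif_bound \<beta> k" "\<bar>D (D c) k\<bar> \<le> unif_bound \<beta> k"
proof -
  have nn: "0 \<le> \<beta> k" "0 \<le> 32 / (1 + (real_of_int k)\<^sup>2)" for k
  proof -
    have "0 \<le> (1 + of_int k ^ 6) * (c k)\<^sup>2" by simp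
    then show "0 \<le> \<beta> k" using assms[of k] by linarith
    show "0 \<le> 32 / (1 + (real_of_int k)\<^sup>2)" by simp
  qed
  have *: "x * \<bar>c k\<bar> \<le> 32 / (1 + (of_int k)\<^sup>2) + \<beta> k" if x: "0 \<le> x" "x \<le> (1 + \<bar>of_int k\<bar>)\<^sup>2" for x k
  proof -
    define w where "w = sqrt (1 + real_of_int k ^ 6)"
    have w: "w > 0" "w\<^sup>2 = 1 + of_int k ^ 6" by (simp_all add: w_def add_pos_nonneg add_nonneg_nonneg)
    have "x * \<bar>c k\<bar> = (x / w) * (w * \<bar>c k\<bar>)" using w by simp
    also have "\<dots> \<le> (x / w)\<^sup>2 + (w * \<bar>c k\<bar>)\<^sup>2"
    proof -
      have ab: "a * b \<le> a\<^sup>2 + b\<^sup>2" if "a \<ge> 0" "b \<ge> 0" for a b :: real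
        using sum_squares_bound[of a b] mult_nonneg_nonneg[OF that] by linarith
      show ?thesis by (rule ab) (use x(1) w(1) in auto)
    qed
    also have "(w * \<bar>c k\<bar>)\<^sup>2 \<le> \<beta> k" using assms[of k] w by (simp add: power_mult_distrib)
    also have "(x / w)\<^sup>2 \<le> 32 / (1 + (of_int k)\<^sup>2)"
    proof -
      have "x\<^sup>2 \<le> ((1 + \<bar>of_int k\<bar>)\<^sup>2)\<^sup>2" using x by (intro power_mono) auto
      also have "\<dots> = (1 + \<bar>of_int k\<bar>) ^ 4" by simp
      also have "\<dots> \<le> 32 * (1 + of_int k ^ 6) / (1 + (of_int k)\<^sup>2)" by (rule weight_bound4)
      also have "\<dots> = 32 / (1 + (of_int k)\<^sup>2) * w\<^sup>2" by (simp add: w)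
      finally show ?thesis using w(1) by (simp add: power_divide pos_divide_le_eq)
    qed
    finally show ?thesis by simp
  qed
  have p: "1 \<le> (1 + a)\<^sup>2" "a \<le> (1 + a)\<^sup>2" "a\<^sup>2 \<le> (1 + a)\<^sup>2" if "a \<ge> 0" for a :: real
    using that by (auto simp: power2_sum)
  have d: "x \<le> unif_bound \<beta> k"
    if "x \<le> 32 / (1 + (of_int k)\<^sup>2) + \<beta> k \<or> x \<le> 32 / (1 + (of_int (- k))\<^sup>2) + \<beta> (- k)" for x k
    using that nn(1)[of k] nn(1)[of "- k"] nn(2)[of k] unfolding unif_bound_def of_int_minus power2_minus by linarith
  show "\<bar>c k\<bar> \<le> unif_bound \<beta> k"
    using *[of 1 k] p(1)[of "\<bar>of_int k\<bar>"] by (intro d disjI1) simp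
  show "\<bar>D c k\<bar> \<le> unif_bound \<beta> k"
    using *[of "\<bar>of_int (-k)\<bar>" "-k"] p(2)[of "\<bar>of_int (-k)\<bar>"]
    by (intro d disjI2) (simp add: D_def abs_mult)
  show "\<bar>D (D c) k\<bar> \<le> unif_bound \<beta> k"
    using *[of "\<bar>of_int k\<bar>\<^sup>2" "k"] p(3)[of "\<bar>of_int k\<bar>"]
    by (intro d disjI1) (simp add: D_D abs_mult)
qed

text \<open>Continuity into H3 and joint continuity of \<open>u\<close>, \<open>u_x\<close> and \<open>u_xx\<close> follow from the majorant by
dominated convergence. For the pointwise equation, both sides of its integrated form are continuous
and periodic in \<open>x\<close> and have the same coefficients; the integrals over time and space are
exchanged for this. The time derivative is then the fundamental theorem of calculus.\<close>

lemma coef_solution_positive_solution: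
  assumes \<mu>: "\<mu> > 0" and T: "T > 0" and sol: "coef_solution \<mu> K T c0 d \<beta>"
  shows "positive_solution {0..T} (hseries c0) (\<lambda>t. hseries (d t))"
proof -
  have ball: "h3_ball K (d t)" and low: "\<mu> \<le> hseries (d t) x" if "t \<in> {0..T}" for t x
    using sol that unfolding coef_solution_def by blast+
  have dcont: "continuous_on {0..T} (\<lambda>t. d t k)" for k using sol unfolding coef_solution_def by blast
  have duh: "d t k = c0 k + integral {0..t} (\<lambda>s. D (flux_coef \<mu> (d s)) k)" if "t \<in> {0..T}" for t k
    using sol that unfolding coef_solution_def by blast
  have \<beta>: "\<beta> summable_on UNIV" using sol unfolding coef_solution_def by blast
  have \<beta>_le: "(1 + of_int k ^ 6) * (d t k)\<^sup>2 \<le> \<beta> k" if "t \<in> {0..T}" for t k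
    using sol that unfolding coef_solution_def by blast
  have pos: "0 < hseries (d t) x" if "t \<in> {0..T}" for t x using low[OF that, of x] \<mu> by simp
  have d0: "d 0 = c0" using duh[of 0] T by auto
  have dlim: "((\<lambda>s. d s k) \<longlongrightarrow> d t k) (at t within {0..T})" if "t \<in> {0..T}" for t k
    using dcont[of k] that by (auto simp: continuous_on_def)
  have ev: "\<forall>\<^sub>F s in at t within {0..T}. s \<in> {0..T}" for t
    by (simp add: eventually_at_filter)
  have H3: "continuous_into_H3 {0..T} (\<lambda>t. hseries (d t))"
    unfolding continuous_into_H3_def
  proof (intro conjI ballI)
    show "hseries (d t) \<in> H3_torus" if "t \<in> {0..T}" for t by (rule h3_ball_imp_H3[OF ball[OF that]])
    fix t assume t: "t \<in> {0..T}"
    define a where "a k s = (1 + of_int k ^ 6) * (d s k - d t k)\<^sup>2" for k s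
    have a_le: "\<bar>a k s\<bar> \<le> 4 * \<beta> k" if s: "s \<in> {0..T}" for k s
    proof -
      have "(d s k - d t k)\<^sup>2 \<le> 2 * (d s k)\<^sup>2 + 2 * (d t k)\<^sup>2"
        using zero_le_power2[of "d s k + d t k"] by (simp add: power2_sum power2_diff)
      then have "a k s \<le> (1 + of_int k ^ 6) * (2 * (d s k)\<^sup>2 + 2 * (d t k)\<^sup>2)"
        unfolding a_def by (intro mult_left_mono) auto
      also have "\<dots> = 2 * ((1 + of_int k ^ 6) * (d s k)\<^sup>2) + 2 * ((1 + of_int k ^ 6) * (d t k)\<^sup>2)"
        by (simp add: algebra_simps)
      also have "\<dots> \<le> 4 * \<beta> k" using \<beta>_le[OF s, of k] \<beta>_le[OF t, of k] by linarith
      finally show ?thesis by (simp add: a_def)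
    qed
    have s4: "(\<lambda>k. 4 * \<beta> k) summable_on UNIV" by (intro summable_on_cmult_right \<beta>)
    have "((\<lambda>s. \<Sum>\<^sub>\<infinity>k. a k s) \<longlongrightarrow> (\<Sum>\<^sub>\<infinity>k::int. 0)) (at t within {0..T})"
    proof (rule infsum_tannery[OF _ a_le ev s4])
      have "((\<lambda>s. a k s) \<longlongrightarrow> (1 + of_int k ^ 6) * (d t k - d t k)\<^sup>2) (at t within {0..T})" for k
        unfolding a_def by (intro tendsto_intros dlim t)
      then show "((\<lambda>s. a k s) \<longlongrightarrow> 0) (at t within {0..T})" for k by simp
    qed
    then have "((\<lambda>s. sqrt (4 * (\<Sum>\<^sub>\<infinity>k. a k s))) \<longlongrightarrow> sqrt (4 * (\<Sum>\<^sub>\<infinity>k::int. 0))) (at t within {0..T})"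
      by (intro tendsto_intros)
    then have lim: "((\<lambda>s. sqrt (4 * (\<Sum>\<^sub>\<infinity>k. a k s))) \<longlongrightarrow> 0) (at t within {0..T})" by simp
    have le: "H3_norm (\<lambda>x. hseries (d s) x - hseries (d t) x) \<le> sqrt (4 * (\<Sum>\<^sub>\<infinity>k. a k s))" if s: "s \<in> {0..T}" for s
    proof -
      have sum: "(\<lambda>k. a k s) summable_on UNIV"
        by (rule summable_on_comparison_test[OF s4]) (use a_le[OF s] in \<open>auto simp: a_def abs_le_iff\<close>)
      have "h3_ball (\<Sum>\<^sub>\<infinity>k. a k s) (\<lambda>k. d s k - d t k)"
        unfolding h3_ball_def
      proof (intro allI impI)
        fix F :: "int set" assume "finite F"
        then have "(\<Sum>k\<in>F. a k s) \<le> (\<Sum>\<^sub>\<infinity>k. a k s)"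
          by (intro finite_sum_le_infsum sum) (auto simp: a_def)
        then show "(\<Sum>k\<in>F. (1 + of_int k ^ 6) * (d s k - d t k)\<^sup>2) \<le> (\<Sum>\<^sub>\<infinity>k. a k s)" by (simp add: a_def)
      qed
      from h3_ball_imp_H3(2)[OF this]
      have "(H3_norm (hseries (\<lambda>k. d s k - d t k)))\<^sup>2 \<le> 4 * (\<Sum>\<^sub>\<infinity>k. a k s)" .
      moreover have "hseries (\<lambda>k. d s k - d t k) = (\<lambda>x. hseries (d s) x - hseries (d t) x)"
        using h3_ball_l1[OF ball[OF s]] h3_ball_l1[OF ball[OF t]] by (auto simp: hseries_diff)
      ultimately show ?thesis by (simp add: real_le_rsqrt)
    qed
    show "((\<lambda>s. H3_norm (\<lambda>x. hseries (d s) x - hseries (d t) x)) \<longlongrightarrow> 0) (at t within {0..T})"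
    proof (rule Lim_null_comparison[OF _ lim])
      show "\<forall>\<^sub>F s in at t within {0..T}. norm (H3_norm (\<lambda>x. hseries (d s) x - hseries (d t) x)) \<le> sqrt (4 * (\<Sum>\<^sub>\<infinity>k. a k s))"
        by (rule eventually_mono[OF ev]) (use le H3_norm_nonneg in auto)
    qed
  qed
  have joint: "continuous_on ({0..T} \<times> UNIV) (\<lambda>z. hseries (d (fst z)) (snd z))"
    "continuous_on ({0..T} \<times> UNIV) (\<lambda>z. hseries (D (d (fst z))) (snd z))"
    "continuous_on ({0..T} \<times> UNIV) (\<lambda>z. hseries (D (D (d (fst z)))) (snd z))"
  proof -
    have cl: "((\<lambda>z. d (fst z) k) \<longlongrightarrow> d (fst z0) k) (at z0 within {0..T} \<times> UNIV)"
      if "z0 \<in> {0..T} \<times> (UNIV :: real set)" for k z0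
    proof -
      have "continuous_on ({0..T} \<times> (UNIV :: real set)) (\<lambda>z. d (fst z) k)"
        by (rule continuous_on_compose2[OF dcont]) (auto intro: continuous_intros)
      then show ?thesis using that unfolding continuous_on_def by blast
    qed
    have ev': "\<forall>\<^sub>F z in at z0 within {0..T} \<times> (UNIV :: real set). z \<in> {0..T} \<times> UNIV" for z0
      by (simp add: eventually_at_filter)
    note ft = hseries_tendsto[where S = "{0..T} \<times> UNIV" and M = "unif_bound \<beta>", OF _ _ _ _ unif_bound_summable[OF \<beta>]]
    have bd: "\<bar>d (fst z) k\<bar> \<le> unif_bound \<beta> k" "\<bar>D (d (fst z)) k\<bar> \<le> unif_bound \<beta> k" "\<bar>D (D (d (fst z))) k\<bar> \<le> unif_bound \<beta> k"
      if "z \<in> {0..T} \<times> (UNIV :: real set)" for z k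
    proof -
      have "fst z \<in> {0..T}" using that by auto
      from le_unif_bound[OF \<beta>_le[OF this]]
      show "\<bar>d (fst z) k\<bar> \<le> unif_bound \<beta> k" "\<bar>D (d (fst z)) k\<bar> \<le> unif_bound \<beta> k" "\<bar>D (D (d (fst z))) k\<bar> \<le> unif_bound \<beta> k"
        by blast+
    qed
    show "continuous_on ({0..T} \<times> UNIV) (\<lambda>z. hseries (d (fst z)) (snd z))"
      unfolding continuous_on_def
      by (intro ballI ft cl bd ev' tendsto_snd tendsto_ident_at)
    show "continuous_on ({0..T} \<times> UNIV) (\<lambda>z. hseries (D (d (fst z))) (snd z))"
      unfolding continuous_on_def
    proof (intro ballI ft bd ev' tendsto_snd tendsto_ident_at)
      show "((\<lambda>z. D (d (fst z)) k) \<longlongrightarrow> D (d (fst z0)) k) (at z0 within {0..T} \<times> UNIV)"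
        if "z0 \<in> {0..T} \<times> (UNIV :: real set)" for z0 k
        unfolding D_def by (intro tendsto_intros cl that)
    qed
    show "continuous_on ({0..T} \<times> UNIV) (\<lambda>z. hseries (D (D (d (fst z)))) (snd z))"
      unfolding continuous_on_def
    proof (intro ballI ft bd ev' tendsto_snd tendsto_ident_at)
      show "((\<lambda>z. D (D (d (fst z))) k) \<longlongrightarrow> D (D (d (fst z0))) k) (at z0 within {0..T} \<times> UNIV)"
        if "z0 \<in> {0..T} \<times> (UNIV :: real set)" for z0 k
        unfolding D_def by (intro tendsto_intros cl that)
    qed
  qed
  have R_joint: "continuous_on ({0..T} \<times> UNIV) (\<lambda>z. arctan_rhs (d (fst z)) (snd z))"
    unfolding arctan_rhs_def
  proof (intro continuous_intros joint ballI)
    fix z assume "z \<in> {0..T} \<times> (UNIV :: real set)"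
    then have "hseries (d (fst z)) (snd z) > 0" by (intro pos) auto
    then show "(hseries (d (fst z)) (snd z))\<^sup>2 + (hseries (D (d (fst z))) (snd z))\<^sup>2 \<noteq> 0"
      by (simp add: sum_power2_eq_zero_iff)
  qed
  have R_time: "continuous_on {0..T} (\<lambda>s. arctan_rhs (d s) x)" for x
    by (rule continuous_on_compose2[OF R_joint, of _ "\<lambda>s. (s, x)", simplified])
       (auto intro!: continuous_intros)
  have dir: "hseries (d t) x = hseries c0 x + integral {0..t} (\<lambda>s. arctan_rhs (d s) x)" if t: "t \<in> {0..T}" for t x
  proof -
    have sub: "{0..t} \<subseteq> {0..T}" using t by auto
    define I where "I x = integral {0..t} (\<lambda>s. arctan_rhs (d s) x)" for x
    define z where "z x = hseries (d t) x - hseries c0 x - I x" for x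
    have RA: "continuous_on ({a..b} \<times> {0..t}) (\<lambda>(x, s). arctan_rhs (d s) x)" for a b
    proof -
      have "continuous_on ({a..b} \<times> {0..t}) (\<lambda>p. arctan_rhs (d (fst (snd p, fst p))) (snd (snd p, fst p)))"
        by (rule continuous_on_compose2[OF R_joint, of _ "\<lambda>p. (snd p, fst p)"])
           (use sub in \<open>auto intro!: continuous_intros\<close>)
      then show ?thesis by (simp add: case_prod_beta)
    qed
    have I_cont: "continuous_on UNIV I"
    proof -
      have "continuous_on {a..b} I" for a b
        unfolding I_def[abs_def]
        using integral_continuous_on_param[of "{a..b}" 0 t "\<lambda>x s. arctan_rhs (d s) x"] RA[of a b]
        by (simp add: box_real)
      then have "isCont I x" for x
        by (intro continuous_on_interior[of "{x - 1..x + 1}" I x]) auto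
      then show ?thesis by (simp add: continuous_at_imp_continuous_on)
    qed
    have I_per: "I (x + 2 * pi) = I x" for x
      by (simp add: I_def arctan_rhs_def hseries_periodic)
    have I_coef: "ip I (hartley k) = d t k - c0 k" for k
    proof -
      have "ip I (hartley k) = integral {-pi..pi} (\<lambda>x. I x * hartley k x)"
        unfolding ip_def by (rule integral_torus_eq_HK) (intro continuous_intros I_cont)
      also have "\<dots> = integral {-pi..pi} (\<lambda>x. integral {0..t} (\<lambda>s. arctan_rhs (d s) x * hartley k x))"
        unfolding I_def by simp
      also have "\<dots> = integral {0..t} (\<lambda>s. integral {-pi..pi} (\<lambda>x. arctan_rhs (d s) x * hartley k x))"
      proof -
        have "continuous_on ({-pi..pi} \<times> {0..t}) (\<lambda>p. (\<lambda>(x, s). arctan_rhs (d s) x) p * hartley k (fst p))"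
          by (intro continuous_on_mult RA continuous_intros)
        then have "continuous_on (cbox (-pi, 0) (pi, t)) (\<lambda>(x, s). arctan_rhs (d s) x * hartley k x)"
          by (simp add: cbox_Pair_eq case_prod_beta)
        from integral_swap_continuous[OF this] show ?thesis by (simp add: box_real)
      qed
      also have "\<dots> = integral {0..t} (\<lambda>s. D (flux_coef \<mu> (d s)) k)"
      proof (rule Henstock_Kurzweil_Integration.integral_cong)
        fix s assume "s \<in> {0..t}"
        then have s: "s \<in> {0..T}" using sub by auto
        have "integral {-pi..pi} (\<lambda>x. arctan_rhs (d s) x * hartley k x) = ip (arctan_rhs (d s)) (hartley k)"
          unfolding ip_def
          by (rule integral_torus_eq_HK[symmetric])
             (intro continuous_intros arctan_rhs_continuous[OF ball[OF s] pos[OF s]])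
        also have "\<dots> = D (flux_coef \<mu> (d s)) k" by (rule arctan_rhs_coef[OF ball[OF s] low[OF s] \<mu>])
        finally show "integral {-pi..pi} (\<lambda>x. arctan_rhs (d s) x * hartley k x) = D (flux_coef \<mu> (d s)) k" .
      qed
      also have "\<dots> = d t k - c0 k" using duh[OF t, of k] by simp
      finally show ?thesis .
    qed
    have l: "l1 (d t)" "l1 c0" using h3_ball_l1[OF ball[OF t]] h3_ball_l1[OF ball[of 0]] T d0 by auto
    have "z x = 0"
    proof (rule continuous_coef_zero[of z])
      show "continuous_on UNIV z" unfolding z_def[abs_def] by (intro continuous_intros continuous_on_hseries l I_cont)
      show "z (x + 2 * pi) = z x" for x by (simp only: z_def hseries_periodic I_per)
      show "ip z (hartley k) = 0" for k
        unfolding z_def[abs_def]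
        by (simp add: ip_diff_left sq_integrable_diff sq_integrable_hseries l sq_integrable_hartley sq_integrable_continuous[OF I_cont] ip_hseries_hartley I_coef)
    qed
    then show ?thesis by (simp add: z_def I_def)
  qed
  have eqn: "solves_arctan_equation {0..T} (\<lambda>t. hseries (d t))"
    unfolding solves_arctan_equation_def
  proof (intro conjI ballI allI)
    show "hseries (d t) differentiable at x" if "t \<in> {0..T}" for t x
      using h3_ball_deriv(1)[OF ball[OF that]] by (auto simp: real_differentiable_def)
    fix t x assume t: "t \<in> {0..T}"
    have "((\<lambda>s. hseries c0 x + integral {0..s} (\<lambda>s. arctan_rhs (d s) x)) has_real_derivative 0 + arctan_rhs (d t) x) (at t within {0..T})"
      by (intro DERIV_add DERIV_const integral_has_real_derivative R_time t)
    then have "((\<lambda>s. hseries c0 x + integral {0..s} (\<lambda>s. arctan_rhs (d s) x)) has_real_derivative arctan_rhs (d t) x) (at t within {0..T})"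
      by simp
    then have "((\<lambda>s. hseries (d s) x) has_real_derivative arctan_rhs (d t) x) (at t within {0..T})"
      by (rule has_field_derivative_transform_within[OF _ zero_less_one t]) (metis dir)
    moreover have "((\<lambda>y. arctan (deriv (hseries (d t)) y / hseries (d t) y)) has_real_derivative arctan_rhs (d t) x) (at x)"
      unfolding deriv_hseries[OF ball[OF t]] by (rule flux_deriv[OF ball[OF t] pos[OF t]])
    ultimately show "\<exists>e. ((\<lambda>s. hseries (d s) x) has_real_derivative e) (at t within {0..T}) \<and>
        ((\<lambda>y. arctan (deriv (hseries (d t)) y / hseries (d t) y)) has_real_derivative e) (at x)"
      by blast
  qed
  show ?thesis
    unfolding positive_solution_def using H3 pos eqn d0 by auto
qed

section \<open>Uniqueness\<close>

lemma second_derivative_at_max: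
  fixes z z1 :: "real \<Rightarrow> real"
  assumes "\<And>x. (z has_real_derivative z1 x) (at x)" "(z1 has_real_derivative z2) (at x0)"
    and max: "\<And>x. z x \<le> z x0"
  shows "z1 x0 = 0" "z2 \<le> 0"
proof -
  show z1: "z1 x0 = 0"
    by (rule DERIV_local_max[OF assms(1) zero_less_one]) (use max in auto)
  show "z2 \<le> 0"
  proof (rule ccontr)
    assume "\<not> z2 \<le> 0"
    then obtain d where d: "d > 0" "\<And>hartley. hartley > 0 \<Longrightarrow> hartley < d \<Longrightarrow> z1 x0 < z1 (x0 + hartley)"
      using DERIV_pos_inc_right[OF assms(2)] by auto
    have "z x0 < z (x0 + d / 2)"
    proof (rule DERIV_pos_imp_increasing_open[of x0 "x0 + d / 2" z])
      show "x0 < x0 + d / 2" using d by simp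
      show "\<exists>y. (z has_real_derivative y) (at x) \<and> 0 < y" if "x0 < x" "x < x0 + d / 2" for x
        using assms(1)[of x] d(2)[of "x - x0"] that z1 d(1) by (intro exI[of _ "z1 x"]) auto
      show "continuous_on {x0..x0 + d / 2} z"
        using assms(1) DERIV_isCont by (auto intro!: continuous_at_imp_continuous_on)
    qed
    then show False using max[of "x0 + d / 2"] by simp
  qed
qed

lemma derivative_at_time_max:
  fixes \<phi> :: "real \<Rightarrow> real"
  assumes "(\<phi> has_real_derivative l) (at t within {0..T})" "t \<in> {0..T}" "t > 0"
    and max: "\<And>s. s \<in> {0..T} \<Longrightarrow> \<phi> s \<le> \<phi> t"
  shows "l \<ge> 0"
proof (rule ccontr)
  assume "\<not> l \<ge> 0"
  then obtain d where d: "d > 0" "\<And>hartley. 0 < hartley \<Longrightarrow> t - hartley \<in> {0..T} \<Longrightarrow> hartley < d \<Longrightarrow> \<phi> t < \<phi> (t - hartley)"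
    using has_real_derivative_neg_dec_left[OF assms(1)] by auto
  define e where "e = min (d / 2) t"
  have "e > 0" "e < d" "t - e \<in> {0..T}" using d assms by (auto simp: e_def)
  then show False using d(2)[of e] max[of "t - e"] by simp
qed

text \<open>A family that is continuous in time uniformly in space, and continuous in space at each time.\<close>

lemma joint_continuity:
  fixes f :: "real \<Rightarrow> real \<Rightarrow> real"
  assumes c: "\<And>t. t \<in> S \<Longrightarrow> continuous_on UNIV (f t)"
    and g: "\<And>t. t \<in> S \<Longrightarrow> continuous (at t within S) (\<lambda>s. g s t)" "\<And>t. t \<in> S \<Longrightarrow> g t t = 0"
    and le: "\<And>s t x. s \<in> S \<Longrightarrow> t \<in> S \<Longrightarrow> \<bar>f s x - f t x\<bar> \<le> g s t"
  shows "continuous_on (S \<times> UNIV) (\<lambda>z. f (fst z) (snd z))"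
  unfolding continuous_on_def
proof
  fix z0 :: "real \<times> real" assume z0: "z0 \<in> S \<times> UNIV"
  obtain t x where tx: "z0 = (t, x)" by (cases z0)
  have t: "t \<in> S" using z0 tx by simp
  let ?F = "at z0 within S \<times> UNIV"
  have ev: "\<forall>\<^sub>F z in ?F. z \<in> S \<times> UNIV" by (simp add: eventually_at_filter)
  have l1: "(fst \<longlongrightarrow> t) ?F" and l2: "(snd \<longlongrightarrow> x) ?F"
    using tendsto_fst[OF tendsto_ident_at] tendsto_snd[OF tendsto_ident_at] by (auto simp: tx)
  have "((\<lambda>z. g (fst z) t) \<longlongrightarrow> g t t) ?F"
    by (rule continuous_within_tendsto_compose[OF g(1)[OF t] _ l1]) (rule eventually_mono[OF ev], auto)
  moreover have "((\<lambda>z. f t (snd z)) \<longlongrightarrow> f t x) ?F"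
    using c[OF t] l2 by (intro isCont_tendsto_compose[of _ "f t"]) (auto simp: continuous_on_eq_continuous_at)
  ultimately have lim: "((\<lambda>z. g (fst z) t + \<bar>f t (snd z) - f t x\<bar>) \<longlongrightarrow> g t t + \<bar>f t x - f t x\<bar>) ?F"
    by (intro tendsto_intros)
  have "((\<lambda>z. f (fst z) (snd z) - f t x) \<longlongrightarrow> 0) ?F"
  proof (rule Lim_null_comparison)
    show "\<forall>\<^sub>F z in ?F. norm (f (fst z) (snd z) - f t x) \<le> g (fst z) t + \<bar>f t (snd z) - f t x\<bar>"
    proof (rule eventually_mono[OF ev])
      fix z assume "z \<in> S \<times> (UNIV :: real set)"
      then have "\<bar>f (fst z) (snd z) - f t (snd z)\<bar> \<le> g (fst z) t" using t by (intro le) auto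
      then show "norm (f (fst z) (snd z) - f t x) \<le> g (fst z) t + \<bar>f t (snd z) - f t x\<bar>" by simp
    qed
    show "((\<lambda>z. g (fst z) t + \<bar>f t (snd z) - f t x\<bar>) \<longlongrightarrow> 0) ?F" using lim g(2)[OF t] by simp
  qed
  then show "((\<lambda>z. f (fst z) (snd z)) \<longlongrightarrow> f (fst z0) (snd z0)) ?F"
    unfolding tx fst_conv snd_conv by (rule LIM_zero_cancel)
qed

lemma H3_norm_zero: "H3_norm (\<lambda>x. 0) = 0"
proof -
  have "h3_ball 0 (\<lambda>k. 0)" by (simp add: h3_ball_def)
  from h3_ball_imp_H3(2)[OF this] have "(H3_norm (hseries (\<lambda>k. 0)))\<^sup>2 \<le> 0" by simp
  moreover have "hseries (\<lambda>k. 0) = (\<lambda>x. 0)" by (simp add: hseries_def fun_eq_iff)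
  ultimately show ?thesis by simp
qed

text \<open>What the maximum principle uses of a solution. Differences \<open>u s - u t\<close> lie in H3, so continuity
into H3 gives continuity of \<open>u\<close> and \<open>u_xx\<close> in time uniformly in space, and compactness gives the
bounds.\<close>

lemma solution_regularity:
  assumes sol: "positive_solution {0..T} u0 u" and T: "T > 0"
  shows "\<exists>u1 u2 m B. m > 0 \<and> continuous_on ({0..T} \<times> UNIV) (\<lambda>z. u (fst z) (snd z)) \<and>
    (\<forall>t\<in>{0..T}. \<forall>x. (u t has_real_derivative u1 t x) (at x) \<and> (u1 t has_real_derivative u2 t x) (at x) \<and>
       m \<le> u t x \<and> u t x \<le> B \<and> \<bar>u2 t x\<bar> \<le> B \<and> u t (x + 2 * pi) = u t x \<and>
       ((\<lambda>s. u s x) has_real_derivative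
          (u t x * u2 t x - (u1 t x)\<^sup>2) / ((u t x)\<^sup>2 + (u1 t x)\<^sup>2)) (at t within {0..T}))"
proof -
  have H: "u t \<in> H3_torus" and pos: "0 < u t x" if "t \<in> {0..T}" for t x
    using sol that unfolding positive_solution_def continuous_into_H3_def by blast+
  have lim: "((\<lambda>s. H3_norm (\<lambda>x. u s x - u t x)) \<longlongrightarrow> 0) (at t within {0..T})" if "t \<in> {0..T}" for t
    using sol that unfolding positive_solution_def continuous_into_H3_def by blast
  define c where "c t k = ip (u t) (hartley k)" for t k
  have ball: "h3_ball ((H3_norm (u t))\<^sup>2) (c t)" and ut: "u t = hseries (c t)" if "t \<in> {0..T}" for t
    using H3_imp_h3_ball[OF H[OF that]] unfolding c_def by auto
  define g where "g s t = sup_const * H3_norm (\<lambda>x. u s x - u t x)" for s t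
  have gc: "continuous (at t within {0..T}) (\<lambda>s. g s t)" and g0: "g t t = 0" if "t \<in> {0..T}" for t
  proof -
    show g0: "g t t = 0" by (simp add: g_def H3_norm_zero)
    have "((\<lambda>s. g s t) \<longlongrightarrow> sup_const * 0) (at t within {0..T})" unfolding g_def by (intro tendsto_intros lim that)
    then show "continuous (at t within {0..T}) (\<lambda>s. g s t)" by (simp add: continuous_within g0)
  qed
  have diff: "\<bar>hseries (c s) x - hseries (c t) x\<bar> \<le> g s t" "\<bar>hseries (D (D (c s))) x - hseries (D (D (c t))) x\<bar> \<le> g s t"
    if s: "s \<in> {0..T}" and t: "t \<in> {0..T}" for s t x
  proof -
    note l = h3_ball_l1[OF ball[OF s]] h3_ball_l1[OF ball[OF t]]
    have e: "(\<lambda>x. u s x - u t x) = hseries (\<lambda>k. c s k - c t k)"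
      unfolding ut[OF s] ut[OF t] using l by (auto simp: hseries_diff)
    have "(\<lambda>x. u s x - u t x) \<in> H3_torus"
      unfolding e by (rule h3_ball_imp_H3(1)[OF h3_ball_diff[OF ball[OF s] ball[OF t]]])
    from H3_imp_h3_ball(1)[OF this]
    have b: "h3_ball ((H3_norm (\<lambda>x. u s x - u t x))\<^sup>2) (\<lambda>k. c s k - c t k)"
      unfolding e using l by (simp add: ip_hseries_hartley l1_diff)
    have q: "sup_const * sqrt ((H3_norm (\<lambda>x. u s x - u t x))\<^sup>2) = g s t"
      by (simp add: g_def H3_norm_nonneg)
    show "\<bar>hseries (c s) x - hseries (c t) x\<bar> \<le> g s t" "\<bar>hseries (D (D (c s))) x - hseries (D (D (c t))) x\<bar> \<le> g s t"
      using h3_ball_hseries_le[OF b, of x] l unfolding q by (simp_all add: D_diff hseries_diff)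
  qed
  have cont: "continuous_on ({0..T} \<times> UNIV) (\<lambda>z. hseries (c (fst z)) (snd z))"
    by (rule joint_continuity[where g = g])
       (use gc g0 diff continuous_on_hseries h3_ball_l1[OF ball] in auto)
  have cont2: "continuous_on ({0..T} \<times> UNIV) (\<lambda>z. hseries (D (D (c (fst z)))) (snd z))"
    by (rule joint_continuity[where f = "\<lambda>t. hseries (D (D (c t)))" and g = g])
       (use gc g0 diff continuous_on_hseries h3_ball_l1[OF ball] in auto)
  let ?S = "{0..T} \<times> {-pi..pi}"
  have cS: "compact ?S" "?S \<noteq> {}" using T by (auto intro!: compact_Times)
  have cont': "continuous_on ?S (\<lambda>z. hseries (c (fst z)) (snd z))" "continuous_on ?S (\<lambda>z. hseries (D (D (c (fst z)))) (snd z))"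
    by (auto intro: continuous_on_subset[OF cont] continuous_on_subset[OF cont2])
  obtain z0 where z0: "z0 \<in> ?S" "\<forall>z\<in>?S. hseries (c (fst z0)) (snd z0) \<le> hseries (c (fst z)) (snd z)"
    using continuous_attains_inf[OF cS cont'(1)] by blast
  obtain z1 where z1: "\<forall>z\<in>?S. hseries (c (fst z)) (snd z) \<le> hseries (c (fst z1)) (snd z1)"
    using continuous_attains_sup[OF cS cont'(1)] by blast
  obtain z2 where z2: "\<forall>z\<in>?S. \<bar>hseries (D (D (c (fst z)))) (snd z)\<bar> \<le> \<bar>hseries (D (D (c (fst z2)))) (snd z2)\<bar>"
    using continuous_attains_sup[OF cS continuous_on_rabs[OF cont'(2)]] by blast
  define m where "m = hseries (c (fst z0)) (snd z0)"
  define B where "B = max (hseries (c (fst z1)) (snd z1)) \<bar>hseries (D (D (c (fst z2)))) (snd z2)\<bar>"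
  have m: "m > 0" using z0(1) pos[of "fst z0" "snd z0"] ut[of "fst z0"] by (auto simp: m_def)
  have bounds: "m \<le> hseries (c t) x" "hseries (c t) x \<le> B" "\<bar>hseries (D (D (c t))) x\<bar> \<le> B" if t: "t \<in> {0..T}" for t x
  proof -
    obtain y where y: "y \<in> {-pi..pi}" "hseries (c t) y = hseries (c t) x"
      using periodic_range[of "hseries (c t)" x] hseries_periodic by blast
    have "(t, y) \<in> ?S" using y t by simp
    from bspec[OF z0(2) this] bspec[OF z1 this]
    show "m \<le> hseries (c t) x" "hseries (c t) x \<le> B"
      unfolding m_def B_def fst_conv snd_conv y(2) by linarith+
    obtain y where y: "y \<in> {-pi..pi}" "hseries (D (D (c t))) y = hseries (D (D (c t))) x"
      using periodic_range[of "hseries (D (D (c t)))" x] hseries_periodic by blast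
    have "(t, y) \<in> ?S" using y t by simp
    from bspec[OF z2 this]
    show "\<bar>hseries (D (D (c t))) x\<bar> \<le> B"
      unfolding B_def fst_conv snd_conv y(2) by linarith
  qed
  have cont_u: "continuous_on ({0..T} \<times> UNIV) (\<lambda>z. u (fst z) (snd z))"
    by (rule continuous_on_eq[OF cont]) (auto simp: ut)
  have time: "((\<lambda>s. u s x) has_real_derivative
      (u t x * hseries (D (D (c t))) x - (hseries (D (c t)) x)\<^sup>2) / ((u t x)\<^sup>2 + (hseries (D (c t)) x)\<^sup>2)) (at t within {0..T})"
    if t: "t \<in> {0..T}" for t x
  proof -
    obtain d where d: "((\<lambda>s. u s x) has_real_derivative d) (at t within {0..T})"
        "((\<lambda>y. arctan (deriv (u t) y / u t y)) has_real_derivative d) (at x)"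
      using sol t unfolding positive_solution_def solves_arctan_equation_def by blast
    have p: "0 < hseries (c t) x" for x using pos[OF t, of x] ut[OF t] by simp
    have "d = arctan_rhs (c t) x"
      using DERIV_unique[OF d(2)] flux_deriv[OF ball[OF t] p] unfolding ut[OF t] deriv_hseries[OF ball[OF t]] by blast
    then show ?thesis using d(1) by (simp add: arctan_rhs_def ut[OF t, symmetric])
  qed
  have ders: "(u t has_real_derivative hseries (D (c t)) x) (at x)"
      "(hseries (D (c t)) has_real_derivative hseries (D (D (c t))) x) (at x)" if t: "t \<in> {0..T}" for t x
    using h3_ball_deriv[OF ball[OF t], of x] ut[OF t] by simp_all
  have all: "\<forall>t\<in>{0..T}. \<forall>x. (u t has_real_derivative hseries (D (c t)) x) (at x) \<and>
       (hseries (D (c t)) has_real_derivative hseries (D (D (c t))) x) (at x) \<and>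
       m \<le> u t x \<and> u t x \<le> B \<and> \<bar>hseries (D (D (c t))) x\<bar> \<le> B \<and> u t (x + 2 * pi) = u t x \<and>
       ((\<lambda>s. u s x) has_real_derivative
          (u t x * hseries (D (D (c t))) x - (hseries (D (c t)) x)\<^sup>2) / ((u t x)\<^sup>2 + (hseries (D (c t)) x)\<^sup>2)) (at t within {0..T})"
    using ders time bounds ut hseries_periodic by auto
  show ?thesis
    by (rule exI[of _ "\<lambda>t. hseries (D (c t))"], rule exI[of _ "\<lambda>t. hseries (D (D (c t)))"], rule exI[of _ m], rule exI[of _ B])
       (use m cont_u all in blast)
qed

text \<open>Both right-hand sides are taken at the same slope \<open>p\<close>. Replacing \<open>r\<close> by \<open>q\<close> increases the first
one, and what remains is the dependence on the value of \<open>u\<close> alone, which is Lipschitz where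
\<open>a, b \<ge> m\<close>.\<close>

lemma rhs_comparison:
  fixes a b p q r m B :: real
  assumes m: "m > 0" "m \<le> a" "m \<le> b" and B: "a \<le> B" "b \<le> B" "\<bar>q\<bar> \<le> B" and ab: "b < a" and rq: "r \<le> q"
  shows "(a * r - p\<^sup>2) / (a\<^sup>2 + p\<^sup>2) - (b * q - p\<^sup>2) / (b\<^sup>2 + p\<^sup>2) \<le> 3 * B / m\<^sup>2 * (a - b)"
proof -
  define X Y where "X = a\<^sup>2 + p\<^sup>2" and "Y = b\<^sup>2 + p\<^sup>2"
  have a0: "a > 0" "b > 0" using m by auto
  have XY: "X > 0" "Y > 0" using a0 by (auto simp: X_def Y_def add_pos_nonneg)
  have m2: "m\<^sup>2 \<le> a\<^sup>2" using m by (intro power_mono) auto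
  have mab: "m\<^sup>2 \<le> a * b" using mult_mono[OF m(2,3)] m by (simp add: power2_eq_square)
  have B0: "B \<ge> 0" using B(3) by linarith
  have XYe: "X * Y = (a * b)\<^sup>2 + p\<^sup>2 * a\<^sup>2 + p\<^sup>2 * b\<^sup>2 + p\<^sup>2 * p\<^sup>2"
    by (simp add: X_def Y_def algebra_simps power_mult_distrib)
  have pm: "p\<^sup>2 * m\<^sup>2 \<le> p\<^sup>2 * a\<^sup>2" using m2 by (intro mult_left_mono) auto
  have abm: "a * b * m\<^sup>2 \<le> (a * b)\<^sup>2"
    unfolding power2_eq_square[of "a * b"] using mab a0 by (intro mult_left_mono) auto
  have nn: "0 \<le> p\<^sup>2 * b\<^sup>2" "0 \<le> p\<^sup>2 * p\<^sup>2" "0 \<le> (a * b)\<^sup>2" by auto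
  have 1: "(p\<^sup>2 + a * b) * m\<^sup>2 \<le> X * Y" unfolding XYe distrib_right using pm abm nn by linarith
  have 2: "p\<^sup>2 * m\<^sup>2 \<le> X * Y" unfolding XYe using pm nn by linarith
  have "q * (p\<^sup>2 - a * b) \<le> \<bar>q\<bar> * \<bar>p\<^sup>2 - a * b\<bar>" by (metis abs_ge_self abs_mult)
  also have "\<dots> \<le> B * (p\<^sup>2 + a * b)"
    using B(3) a0 by (intro mult_mono) (auto simp: abs_le_iff)
  finally have 3: "q * (p\<^sup>2 - a * b) * m\<^sup>2 \<le> B * (p\<^sup>2 + a * b) * m\<^sup>2" by (intro mult_right_mono) auto
  have "p\<^sup>2 * (a + b) \<le> p\<^sup>2 * (2 * B)" using B by (intro mult_left_mono) auto
  then have 4: "p\<^sup>2 * (a + b) * m\<^sup>2 \<le> p\<^sup>2 * (2 * B) * m\<^sup>2" by (intro mult_right_mono) auto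
  define N where "N = q * (p\<^sup>2 - a * b) + p\<^sup>2 * (a + b)"
  have "N * m\<^sup>2 \<le> B * ((p\<^sup>2 + a * b) * m\<^sup>2) + 2 * B * (p\<^sup>2 * m\<^sup>2)"
    unfolding N_def distrib_right[of "q * (p\<^sup>2 - a * b)"] using 3 4 by (simp add: mult_ac)
  also have "\<dots> \<le> B * (X * Y) + 2 * B * (X * Y)"
    using 1 2 B0 by (intro add_mono mult_left_mono) auto
  finally have N: "N * m\<^sup>2 \<le> 3 * B * (X * Y)" by simp
  have "(a * r - p\<^sup>2) / X \<le> (a * q - p\<^sup>2) / X"
    using XY a0 rq by (intro divide_right_mono) auto
  then have "(a * r - p\<^sup>2) / X - (b * q - p\<^sup>2) / Y \<le> (a * q - p\<^sup>2) / X - (b * q - p\<^sup>2) / Y" by simp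
  also have "\<dots> = ((a * q - p\<^sup>2) * Y - (b * q - p\<^sup>2) * X) / (X * Y)"
    using XY by (simp add: diff_frac_eq)
  also have "(a * q - p\<^sup>2) * Y - (b * q - p\<^sup>2) * X = (a - b) * N"
    unfolding X_def Y_def N_def by (simp add: algebra_simps power2_eq_square)
  also have "(a - b) * N / (X * Y) \<le> 3 * B / m\<^sup>2 * (a - b)"
  proof -
    have "N / (X * Y) \<le> 3 * B / m\<^sup>2" using N XY m(1) by (simp add: divide_simps mult.commute)
    then have "(a - b) * (N / (X * Y)) \<le> (a - b) * (3 * B / m\<^sup>2)" using ab by (intro mult_left_mono) auto
    then show ?thesis by (simp add: mult.commute)
  qed
  finally show ?thesis by (simp add: X_def Y_def)
qed

lemma solution_le:
  assumes u: "positive_solution {0..T} u0 u" and v: "positive_solution {0..T} u0 v" and T: "T > 0"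
    and t: "t \<in> {0..T}"
  shows "u t x \<le> v t x"
proof (rule ccontr)
  assume "\<not> u t x \<le> v t x"
  obtain u1 u2 mu Bu where mu: "mu > 0" and cu: "continuous_on ({0..T} \<times> UNIV) (\<lambda>z. u (fst z) (snd z))"
    and U: "\<forall>t\<in>{0..T}. \<forall>x. (u t has_real_derivative u1 t x) (at x) \<and> (u1 t has_real_derivative u2 t x) (at x) \<and>
       mu \<le> u t x \<and> u t x \<le> Bu \<and> \<bar>u2 t x\<bar> \<le> Bu \<and> u t (x + 2 * pi) = u t x \<and>
       ((\<lambda>s. u s x) has_real_derivative
          (u t x * u2 t x - (u1 t x)\<^sup>2) / ((u t x)\<^sup>2 + (u1 t x)\<^sup>2)) (at t within {0..T})"
    using solution_regularity[OF u T] by blast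
  obtain v1 v2 mv Bv where mv: "mv > 0" and cv: "continuous_on ({0..T} \<times> UNIV) (\<lambda>z. v (fst z) (snd z))"
    and V: "\<forall>t\<in>{0..T}. \<forall>x. (v t has_real_derivative v1 t x) (at x) \<and> (v1 t has_real_derivative v2 t x) (at x) \<and>
       mv \<le> v t x \<and> v t x \<le> Bv \<and> \<bar>v2 t x\<bar> \<le> Bv \<and> v t (x + 2 * pi) = v t x \<and>
       ((\<lambda>s. v s x) has_real_derivative
          (v t x * v2 t x - (v1 t x)\<^sup>2) / ((v t x)\<^sup>2 + (v1 t x)\<^sup>2)) (at t within {0..T})"
    using solution_regularity[OF v T] by blast
  define m B where "m = min mu mv" and "B = max Bu Bv"
  \<comment> \<open>Larger than the Lipschitz constant in \<open>rhs_comparison\<close>.\<close>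
  define lam where "lam = 3 * B / m\<^sup>2 + 1"
  define w where "w t x = exp (- lam * t) * (u t x - v t x)" for t x
  let ?S = "{0..T} \<times> {-pi..pi}"
  have cS: "compact ?S" "?S \<noteq> {}" using T by (auto intro!: compact_Times)
  have cw: "continuous_on ?S (\<lambda>z. w (fst z) (snd z))"
    unfolding w_def
    by (intro continuous_intros continuous_on_subset[OF cu] continuous_on_subset[OF cv]) auto
  obtain z0 where z0: "z0 \<in> ?S" "\<forall>z\<in>?S. w (fst z) (snd z) \<le> w (fst z0) (snd z0)"
    using continuous_attains_sup[OF cS cw] by blast
  obtain t0 x0 where tx: "z0 = (t0, x0)" by (cases z0)
  have t0: "t0 \<in> {0..T}" using z0 tx by auto
  have wmax: "w s y \<le> w t0 x0" if s: "s \<in> {0..T}" for s y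
  proof -
    have "w s (x + 2 * pi) = w s x" for x using U V s by (simp add: w_def)
    then obtain y' where "y' \<in> {-pi..pi}" "w s y' = w s y" using periodic_range[of "w s" y] by blast
    moreover have "(s, y') \<in> ?S" using calculation s by simp
    from bspec[OF z0(2) this] have "w s y' \<le> w t0 x0" unfolding tx fst_conv snd_conv .
    ultimately show ?thesis by simp
  qed
  have "w t x > 0" using \<open>\<not> u t x \<le> v t x\<close> by (simp add: w_def)
  then have w0: "w t0 x0 > 0" using wmax[OF t, of x] by linarith
  then have gt: "v t0 x0 < u t0 x0" by (simp add: w_def zero_less_mult_iff)
  have "u 0 x0 = v 0 x0" using u v by (simp add: positive_solution_def)
  then have "t0 \<noteq> 0" using gt by auto
  then have t0p: "t0 > 0" using t0 by auto
  have zmax: "u t0 y - v t0 y \<le> u t0 x0 - v t0 x0" for y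
    using wmax[OF t0, of y] by (simp add: w_def)
  have dz: "((\<lambda>x. u t0 x - v t0 x) has_real_derivative u1 t0 x - v1 t0 x) (at x)" for x
    using U V t0 by (intro DERIV_diff) auto
  have dz1: "((\<lambda>x. u1 t0 x - v1 t0 x) has_real_derivative u2 t0 x0 - v2 t0 x0) (at x0)"
    using U V t0 by (intro DERIV_diff) auto
  have p: "u1 t0 x0 = v1 t0 x0" and q: "u2 t0 x0 \<le> v2 t0 x0"
    using second_derivative_at_max[OF dz dz1 zmax] by auto
  define du where "du = (u t0 x0 * u2 t0 x0 - (u1 t0 x0)\<^sup>2) / ((u t0 x0)\<^sup>2 + (u1 t0 x0)\<^sup>2)"
  define dv where "dv = (v t0 x0 * v2 t0 x0 - (v1 t0 x0)\<^sup>2) / ((v t0 x0)\<^sup>2 + (v1 t0 x0)\<^sup>2)"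
  have Du: "((\<lambda>s. u s x0) has_real_derivative du) (at t0 within {0..T})"
    and Dv: "((\<lambda>s. v s x0) has_real_derivative dv) (at t0 within {0..T})"
    using U V t0 unfolding du_def dv_def by blast+
  have De: "((\<lambda>s. exp (- lam * s)) has_real_derivative - lam * exp (- lam * t0)) (at t0 within {0..T})"
    by (auto intro!: derivative_eq_intros)
  have "((\<lambda>s. w s x0) has_real_derivative
      (- lam * exp (- lam * t0)) * (u t0 x0 - v t0 x0) + (du - dv) * exp (- lam * t0)) (at t0 within {0..T})"
    unfolding w_def by (rule DERIV_mult[OF De DERIV_diff[OF Du Dv]])
  from derivative_at_time_max[OF this t0 t0p wmax]
  have "0 \<le> exp (- lam * t0) * ((du - dv) - lam * (u t0 x0 - v t0 x0))" by (simp add: algebra_simps)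
  then have "lam * (u t0 x0 - v t0 x0) \<le> du - dv" by (simp add: zero_le_mult_iff)
  moreover have "du - dv \<le> 3 * B / m\<^sup>2 * (u t0 x0 - v t0 x0)"
    unfolding du_def dv_def p
  proof (rule rhs_comparison)
    show "m > 0" using mu mv by (simp add: m_def)
    show "m \<le> u t0 x0" "m \<le> v t0 x0" "u t0 x0 \<le> B" "v t0 x0 \<le> B" "\<bar>v2 t0 x0\<bar> \<le> B"
      using U V t0 by (auto simp: m_def B_def min_le_iff_disj le_max_iff_disj)
  qed (use gt q in auto)
  ultimately have "lam * (u t0 x0 - v t0 x0) \<le> 3 * B / m\<^sup>2 * (u t0 x0 - v t0 x0)" by simp
  then show False using gt by (simp add: lam_def distrib_right)
qed

section \<open>Local well-posedness\<close>

lemma time_interval_ereal: "time_interval (ereal T) = {0..T}"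
  by (auto simp: time_interval_def)

text \<open>The time comes from \<open>coef_solution_exists\<close>, which depends on \<open>M\<close> and \<open>m\<close> but not on the initial value.\<close>

lemma existence_time:
  assumes "m > 0"
  shows "\<exists>T>0. \<forall>u0\<in>H3_torus. H3_norm u0 = M \<longrightarrow> (\<forall>x. m \<le> u0 x) \<longrightarrow> (\<exists>u. positive_solution {0..T} u0 u)"
proof -
  obtain T where T: "T > 0"
    and ex: "\<forall>c0. h3_ball (M\<^sup>2) c0 \<and> (\<forall>x. m \<le> hseries c0 x) \<longrightarrow> (\<exists>d \<beta>. coef_solution (m / 2) (M\<^sup>2 + 1) T c0 d \<beta>)"
    using coef_solution_exists[OF assms, of "M\<^sup>2"] by auto
  have "\<exists>u. positive_solution {0..T} u0 u" if u0: "u0 \<in> H3_torus" "H3_norm u0 = M" "\<forall>x. m \<le> u0 x" for u0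
  proof -
    define c0 where "c0 k = ip u0 (hartley k)" for k
    have c0: "h3_ball (M\<^sup>2) c0" "u0 = hseries c0"
      using H3_imp_h3_ball[OF u0(1)] u0(2) unfolding c0_def[abs_def] by auto
    then obtain d \<beta> where "coef_solution (m / 2) (M\<^sup>2 + 1) T c0 d \<beta>" using ex u0(3) by auto
    then have "positive_solution {0..T} (hseries c0) (\<lambda>t. hseries (d t))"
      using assms T by (intro coef_solution_positive_solution) auto
    then show ?thesis using c0(2) by blast
  qed
  then show ?thesis using T by blast
qed

theorem theorem1p2:
  shows "\<exists>T :: real \<Rightarrow> real \<Rightarrow> ereal. \<forall>u0 \<in> H3_torus. (\<forall>x. 0 < u0 x) \<longrightarrow>
    (let T0 = T (H3_norm u0) (INF x\<in>{-pi..pi}. u0 x); J = time_interval T0 in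
       0 < T0 \<and>
       (\<exists>u. positive_solution J u0 u \<and>
          (\<forall>v. positive_solution J u0 v \<longrightarrow> (\<forall>t\<in>J. \<forall>x. v t x = u t x))))"
proof -
  define P where "P M m T \<longleftrightarrow> m > 0 \<longrightarrow> T > 0 \<and>
      (\<forall>u0\<in>H3_torus. H3_norm u0 = M \<longrightarrow> (\<forall>x. m \<le> u0 x) \<longrightarrow> (\<exists>u. positive_solution {0..T} u0 u))"
    for M m T :: real
  \<comment> \<open>The choice is made for each pair of numbers, before any initial value is given.\<close>
  define \<tau> where "\<tau> M m = (SOME T. P M m T)" for M m
  have "\<exists>T. P M m T" for M m using existence_time[of m M] unfolding P_def by blast
  then have P\<tau>: "P M m (\<tau> M m)" for M m unfolding \<tau>_def by (rule someI_ex)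
  have \<tau>: "\<tau> M m > 0 \<and>
      (\<forall>u0\<in>H3_torus. H3_norm u0 = M \<longrightarrow> (\<forall>x. m \<le> u0 x) \<longrightarrow> (\<exists>u. positive_solution {0..\<tau> M m} u0 u))"
    if "m > 0" for M m using P\<tau>[of M m] that unfolding P_def by blast
  show ?thesis
  proof (rule exI[of _ "\<lambda>M m. ereal (\<tau> M m)"], intro ballI impI)
    fix u0 assume H: "u0 \<in> H3_torus" and pos: "\<forall>x. 0 < u0 x"
    define m where "m = (INF x\<in>{-pi..pi}. u0 x)"
    have cont: "continuous_on {-pi..pi} u0" using H by (auto simp: H3_torus_def intro: continuous_on_subset)
    obtain y where y: "y \<in> {-pi..pi}" "\<forall>x\<in>{-pi..pi}. u0 y \<le> u0 x"
      using continuous_attains_inf[OF compact_Icc _ cont] by fastforce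
    have m_eq: "m = u0 y" unfolding m_def by (rule cInf_eq_minimum) (use y in auto)
    have m: "m > 0" using pos m_eq by simp
    have low: "m \<le> u0 x" for x
    proof -
      have "u0 (x + 2 * pi) = u0 x" for x
        by (rule trans[OF fun_cong[OF H3_imp_h3_ball(2)[OF H]]
              trans[OF hseries_periodic fun_cong[OF H3_imp_h3_ball(2)[OF H], symmetric]]])
      then show ?thesis using periodic_range[of u0 x] y(2) m_eq by auto
    qed
    define T where "T = \<tau> (H3_norm u0) m"
    have T: "T > 0" using \<tau>[OF m] by (simp add: T_def)
    obtain u where u: "positive_solution {0..T} u0 u" using \<tau>[OF m] H low unfolding T_def by blast
    have uniq: "v t x = u t x" if v: "positive_solution {0..T} u0 v" and t: "t \<in> {0..T}" for v t x
      by (rule antisym[OF solution_le[OF v u T t] solution_le[OF u v T t]])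
    show "let T0 = ereal (\<tau> (H3_norm u0) (INF x\<in>{-pi..pi}. u0 x)); J = time_interval T0 in
       0 < T0 \<and> (\<exists>u. positive_solution J u0 u \<and>
          (\<forall>v. positive_solution J u0 v \<longrightarrow> (\<forall>t\<in>J. \<forall>x. v t x = u t x)))"
      unfolding Let_def m_def[symmetric] T_def[symmetric] time_interval_ereal
    proof (intro conjI exI[of _ u] allI impI ballI)
      show "0 < ereal T" using T by simp
    qed (rule u uniq; assumption?)+
  qed
qed

end
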